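(* Fix $q\in(0,1)$ and, for $\theta=(\theta_i)_{i=1}^\infty\in\mathcal{N}$, let $P^\theta$ be the extreme $q$-central probability measure on $(\Omega,\mathcal{C})$ described in the context. Then: (1) If $\theta$ is constant, then $P^\theta$ is atomic with a single atom. (2) If $\theta$ is not constant but bounded, then $P^\theta$ is atomic with infinitely many atoms. (3) If $\theta$ is unbounded, then the Krieger--Araki--Woods ratio set of $(\Omega,\mathcal{C},P^\theta,\mathfrak{S})$ equals $\{q^{2n}\mid n\in\mathbb{Z}\}\cup\{0\}$ (i.e. the system is of type III$_{q^2}$).
   Context: Gelfand--Tsetlin graph: for $N\ge1$ let $\mathrm{Sign}_N=\{\lambda\in\mathbb{Z}^N\mid \lambda_1\ge\cdots\ge\lambda_N\}$, $\mathrm{Sign}_0=\{*\}$, and $|\lambda|=\lambda_1+\cdots+\lambda_N$. For $\mu\in\mathrm{Sign}_{N-1}$, $\lambda\in\mathrm{Sign}_N$ write $\mu\prec\lambda$ if $\lambda_1\ge\mu_1\ge\lambda_2\ge\cdots\ge\mu_{N-1}\ge\lambda_N$ (with $*\prec\lambda$ for all $\lambda\in\mathrm{Sign}_1$). Edges of level $N$ are pairs $[\mu,\lambda]$ with $\mu\in\mathrm{Sign}_{N-1},\lambda\in\mathrm{Sign}_N,\mu\prec\lambda$, with source $s([\mu,\lambda])=\mu$ and range $r([\mu,\lambda])=\lambda$. A path is a sequence of edges $(e_n)$ with $r(e_n)=s(e_{n+1})$. Weight: $w([\mu,\lambda])=q^{N|\mu|-(N-1)|\lambda|}$ for a level-$N$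 edge, and $w$ of a finite path is the product of the weights of its edges. For $\mu\in\mathrm{Sign}_K,\lambda\in\mathrm{Sign}_N$, $K<N$, $\dim_q(\mu,\lambda)=\sum_\alpha w(\alpha)$ over finite paths $\alpha$ from $\mu$ to $\lambda$, and $\dim_q(\lambda)=\dim_q( *,\lambda)$. $\Omega$ is the set of infinite paths starting at $*$; for a finite path $\alpha=(e_n)_{n=1}^N$ from $*$, $C_\alpha=\{\omega\in\Omega\mid \omega_n=e_n,\ n\le N\}$; $\mathcal{C}$ is the $\sigma$-algebra generated by these cylinder sets. A probability measure $P$ on $(\Omega,\mathcal{C})$ is $q$-central if $P(C_\alpha)/w(\alpha)=P(\{\omega\mid r(\omega_N)=\lambda\})/\dim_q(\lambda)$ for all $\lambda\in\mathrm{Sign}_N$ and all finite paths $\alpha$ from $*$ to $\lambda$. For $\lambda\in\mathrm{Sign}_N$, each permutation $\gamma_0$ of the set of finite paths from $*$ to $\lambda$ acts on $\Omega$ by $\gamma(\omega)=(\gamma_0(\omega_1,\dots,\omega_N),\omega_{N+1},\dots)$ if $r(\omega_N)=\lambda$ and $\gamma(\omega)=\omega$ otherwise; $\mathfrak{S}_N$ is the group generated by these transformations for all $\lambda\in\mathrm{Sign}_N$, and $\mathfrak{S}=\bigcup_N\mathfrak{S}_N$. $q$-central measures are $\mathfrak{S}$-quasi-invariant. Let $\mathcal{N}=\{\theta\in\mathbb{Z}^\infty\mid\theta_1\le\theta_2\le\cdots\}$ and $\lambda(n;\theta)=(\theta_n,\theta_{n-1},\dots,\theta_1)\in\mathrm{Sign}_n$.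 (Known fact, Gorin:) for each $\theta\in\mathcal{N}$ there is a unique $q$-central probability measure $P^\theta$ with $P^\theta(C_\alpha)/\dim_q(\lambda)=\lim_{n\to\infty}\dim_q(\lambda,\lambda(n;\theta))/\dim_q(\lambda(n;\theta))$ for every finite path $\alpha$ from $*$ to $\lambda\in\mathrm{Sign}_N$; these are exactly the extreme (equivalently $\mathfrak{S}$-ergodic) $q$-central probability measures. The full group $[\mathfrak{S}]$ consists of measurable transformations $\gamma$ of $\Omega$ such that for every $\omega$ there is $\gamma_0\in\mathfrak{S}$ with $\gamma(\omega)=\gamma_0(\omega)$. For an $\mathfrak{S}$-quasi-invariant probability measure $P$, the ratio set $r(\Omega,\mathcal{C},P,\mathfrak{S})$ is the set of $r\in[0,\infty)$ such that for every $\epsilon>0$ and every $A\in\mathcal{C}$ with $P(A)>0$ there exist $B\in\mathcal{C}$ and $\gamma\in[\mathfrak{S}]$ with $P(B)>0$, $B\subseteq A$, $\gamma(B)\subseteq A$ and $|\frac{dP\circ\gamma}{dP}(\omega)-r|<\epsilon$ for a.e. $\omega\in B$.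
   Formalization: The measure P^θ is characterised by P^θ(C_α)/w(α) = lim dim_q(λ,λ(n;θ))/dim_q(λ(n;θ)); the printed denominator dim_q(λ) contradicts q-centrality, since paths to λ=(1,0) have weights q^{-1} and q. *)

theory Defs
  imports "HOL-Probability.Probability" "HOL-Combinatorics.Permutations"
begin

text \<open>Signatures of length N are nonincreasing integer lists of length N; the
  empty list plays the role of the unique element of Sign_0.\<close>

definition Sign :: "nat \<Rightarrow> int list set" where
  "Sign N = {l. length l = N \<and> sorted_wrt (\<ge>) l}"

definition interlace :: "int list \<Rightarrow> int list \<Rightarrow> bool" where
  "interlace mu lam \<longleftrightarrow> length lam = Suc (length mu) \<and>
     (\<forall>i < length mu. mu ! i \<le> lam ! i \<and> lam ! Suc i \<le> mu ! i)"

type_synonym edge = "int list \<times> int list"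

definition is_edge :: "nat \<Rightarrow> edge \<Rightarrow> bool" where
  "is_edge N e \<longleftrightarrow> N \<ge> 1 \<and> fst e \<in> Sign (N - 1) \<and> snd e \<in> Sign N \<and> interlace (fst e) (snd e)"

definition sumsig :: "int list \<Rightarrow> int" where
  "sumsig l = sum_list l"

definition wedge :: "real \<Rightarrow> edge \<Rightarrow> real" where
  "wedge q e = (let N = int (length (snd e)) in
                 q powi (N * sumsig (fst e) - (N - 1) * sumsig (snd e)))"

definition wpath :: "real \<Rightarrow> edge list \<Rightarrow> real" where
  "wpath q \<alpha> = prod_list (map (wedge q) \<alpha>)"

definition fpaths :: "int list \<Rightarrow> int list \<Rightarrow> edge list set" where
  "fpaths mu lam = {\<alpha>. length mu < length lam \<and> length \<alpha> = length lam - length mu \<and>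
      (\<forall>j < length \<alpha>. is_edge (length mu + j + 1) (\<alpha> ! j)) \<and>
      fst (\<alpha> ! 0) = mu \<and> snd (last \<alpha>) = lam \<and>
      (\<forall>j. Suc j < length \<alpha> \<longrightarrow> snd (\<alpha> ! j) = fst (\<alpha> ! Suc j))}"

definition dimq :: "real \<Rightarrow> int list \<Rightarrow> int list \<Rightarrow> real" where
  "dimq q mu lam = (\<Sum>\<alpha>\<in>fpaths mu lam. wpath q \<alpha>)"

text \<open>Infinite paths from *, indexed from 0: omega n is the edge of level n+1.\<close>
definition GT_space :: "(nat \<Rightarrow> edge) set" where
  "GT_space = {\<omega>. (\<forall>n. is_edge (Suc n) (\<omega> n) \<and> snd (\<omega> n) = fst (\<omega> (Suc n))) \<and> fst (\<omega> 0) = []}"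

definition cyl :: "edge list \<Rightarrow> (nat \<Rightarrow> edge) set" where
  "cyl \<alpha> = {\<omega> \<in> GT_space. \<forall>n < length \<alpha>. \<omega> n = \<alpha> ! n}"

definition GT_alg :: "(nat \<Rightarrow> edge) measure" where
  "GT_alg = sigma GT_space {cyl \<alpha> | \<alpha> lam. \<alpha> \<in> fpaths [] lam}"

definition q_central :: "real \<Rightarrow> (nat \<Rightarrow> edge) measure \<Rightarrow> bool" where
  "q_central q P \<longleftrightarrow> prob_space P \<and> sets P = sets GT_alg \<and>
     (\<forall>lam \<alpha>. \<alpha> \<in> fpaths [] lam \<longrightarrow>
        measure P (cyl \<alpha>) / wpath q \<alpha> =
        measure P {\<omega> \<in> GT_space. snd (\<omega> (length lam - 1)) = lam} / dimq q [] lam)"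

text \<open>lambda(n;theta) = (theta_n, ..., theta_1); theta is indexed from 0.\<close>
definition lam_theta :: "nat \<Rightarrow> (nat \<Rightarrow> int) \<Rightarrow> int list" where
  "lam_theta n \<theta> = rev (map \<theta> [0..<n])"

definition gen_trans :: "nat \<Rightarrow> int list \<Rightarrow> (edge list \<Rightarrow> edge list) \<Rightarrow> (nat \<Rightarrow> edge) \<Rightarrow> (nat \<Rightarrow> edge)" where
  "gen_trans N lam g0 \<omega> =
     (if map \<omega> [0..<N] \<in> fpaths [] lam
      then (\<lambda>n. if n < N then g0 (map \<omega> [0..<N]) ! n else \<omega> n)
      else \<omega>)"

definition gens :: "nat \<Rightarrow> ((nat \<Rightarrow> edge) \<Rightarrow> (nat \<Rightarrow> edge)) set" where
  "gens N = {gen_trans N lam g0 | lam g0. N \<ge> 1 \<and> lam \<in> Sign N \<and> g0 permutes fpaths [] lam}"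

text \<open>The group generated by gens N (the generators are closed under inverses).\<close>
inductive_set SymN :: "nat \<Rightarrow> ((nat \<Rightarrow> edge) \<Rightarrow> (nat \<Rightarrow> edge)) set" for N where
  id: "id \<in> SymN N"
| comp: "g \<in> gens N \<Longrightarrow> h \<in> SymN N \<Longrightarrow> g \<circ> h \<in> SymN N"

definition Sym :: "((nat \<Rightarrow> edge) \<Rightarrow> (nat \<Rightarrow> edge)) set" where
  "Sym = (\<Union>N. SymN N)"

definition full_group :: "((nat \<Rightarrow> edge) \<Rightarrow> (nat \<Rightarrow> edge)) set" where
  "full_group = {\<gamma>. \<gamma> \<in> GT_alg \<rightarrow>\<^sub>M GT_alg \<and> bij_betw \<gamma> GT_space GT_space \<and>
       the_inv_into GT_space \<gamma> \<in> GT_alg \<rightarrow>\<^sub>M GT_alg \<and>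
       (\<forall>\<omega> \<in> GT_space. \<exists>\<gamma>0 \<in> Sym. \<gamma> \<omega> = \<gamma>0 \<omega>)}"

text \<open>Radon--Nikodym derivative d(P o gamma)/dP, where (P o gamma)(A) = P(gamma A),
  i.e. P o gamma is the image of P under gamma^{-1}.\<close>
definition RN_comp :: "(nat \<Rightarrow> edge) measure \<Rightarrow> ((nat \<Rightarrow> edge) \<Rightarrow> (nat \<Rightarrow> edge)) \<Rightarrow> (nat \<Rightarrow> edge) \<Rightarrow> real" where
  "RN_comp P \<gamma> = (\<lambda>\<omega>. enn2real (RN_deriv P (distr P P (the_inv_into GT_space \<gamma>)) \<omega>))"

definition ratio_set :: "(nat \<Rightarrow> edge) measure \<Rightarrow> real set" where
  "ratio_set P = {r. r \<ge> 0 \<and> (\<forall>\<epsilon>>0. \<forall>A \<in> sets P. measure P A > 0 \<longrightarrow>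
      (\<exists>B \<in> sets P. \<exists>\<gamma> \<in> full_group. measure P B > 0 \<and> B \<subseteq> A \<and> \<gamma> ` B \<subseteq> A \<and>
         (AE \<omega> in P. \<omega> \<in> B \<longrightarrow> \<bar>RN_comp P \<gamma> \<omega> - r\<bar> < \<epsilon>)))}"

definition atom :: "'a measure \<Rightarrow> 'a \<Rightarrow> bool" where
  "atom P \<omega> \<longleftrightarrow> \<omega> \<in> space P \<and> {\<omega>} \<in> sets P \<and> measure P {\<omega>} > 0"

definition atomic :: "'a measure \<Rightarrow> bool" where
  "atomic P \<longleftrightarrow> (AE \<omega> in P. atom P \<omega>)"

end

theory Submission
  imports Defs
begin

text \<open>
  A path is a triangular array \<open>c k j\<close> (the \<open>j\<close>-th smallest coordinate of the signature on level
  \<open>k\<close>) with \<open>c (k + 1) j \<le> c k j \<le> c (k + 1) (j + 1)\<close>. Exchanging two prefixes with the same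
  endpoint multiplies a q-central measure by \<open>q powi (2 * d)\<close>, where \<open>d\<close> is the change of the sum of
  all coordinates below the endpoint.

  The measure attached to \<open>\<theta>\<close> is the limit of the weight distributions on paths that follow
  \<open>\<theta>\<close> from level \<open>n\<close> on. Under these, the \<open>j\<close>-th coordinate never falls below \<open>\<theta> j\<close> and a late
  departure from \<open>\<theta> j\<close> is exponentially unlikely, because pushing the coordinate down by one over
  many levels gains a large power of \<open>1 / q\<close>. So almost surely \<open>c k j\<close> is eventually \<open>\<theta> j\<close>.

  If \<open>\<theta>\<close> is bounded by its maximum \<open>M\<close>, all coordinates stay below \<open>M\<close>, hence almost every path
  is eventually the path of \<open>\<theta>\<close>; these countably many paths are the atoms.

  If \<open>\<theta>\<close> is unbounded, the number of coordinates \<open>\<le> t\<close> on level \<open>k\<close> grows by 0 or 1 per level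
  and stops at the finite number of indices with \<open>\<theta> j \<le> t\<close>. Choosing the starting level with the
  parity opposite to that number forces an increase by exactly 1 over two consecutive levels, and
  there a single box can be moved. This move has ratio \<open>q powi 2\<close> or \<open>q powi - 2\<close>, and a set of
  positive measure that is close to a union of cylinders cannot be disjoint from its image under
  it. So every set of positive measure contains pairs of ratio \<open>q powi 2\<close>, which generates the
  ratio set.
\<close>

section \<open>Paths as triangular arrays\<close>

text \<open>Reversal counts the coordinates from the smallest one, so that an index keeps its
  meaning on every level and matches the index of \<open>\<theta>\<close>. Level \<open>k\<close> is
  the source of the edge \<open>\<omega> k\<close> and hence depends on that edge alone.\<close>

definition coord :: "(nat \<Rightarrow> edge) \<Rightarrow> nat \<Rightarrow> nat \<Rightarrow> int" where
  "coord \<omega> k j = rev (fst (\<omega> k)) ! j"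

definition gt_array :: "(nat \<Rightarrow> nat \<Rightarrow> int) \<Rightarrow> bool" where
  "gt_array c \<longleftrightarrow> (\<forall>k. \<forall>j<k. c (Suc k) j \<le> c k j \<and> c k j \<le> c (Suc k) (Suc j))"

text \<open>Inverse of \<open>coord\<close> on the arrays of paths: modified paths are built below
  by editing the array and converting back.\<close>

definition path_of :: "(nat \<Rightarrow> nat \<Rightarrow> int) \<Rightarrow> nat \<Rightarrow> edge" where
  "path_of c = (\<lambda>k. (lam_theta k (c k), lam_theta (Suc k) (c (Suc k))))"

lemma length_lam_theta [simp]: "length (lam_theta n f) = n"
  by (simp add: lam_theta_def)

lemma nth_rev_lam_theta: "j < n \<Longrightarrow> rev (lam_theta n f) ! j = f j"
  by (simp add: lam_theta_def)

lemma lam_theta_cong: "(\<And>j. j < n \<Longrightarrow> f j = g j) \<Longrightarrow> lam_theta n f = lam_theta n g"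
  by (simp add: lam_theta_def)

lemma lam_theta_nth: "i < n \<Longrightarrow> lam_theta n f ! i = f (n - Suc i)"
  by (simp add: lam_theta_def rev_nth)

text \<open>Two neighbours on level \<open>Suc l\<close> enclose an entry of level \<open>l\<close>,
  so interlacing alone forces the rows to be nondecreasing.\<close>

lemma gt_array_mono:
  assumes "gt_array c" "i \<le> j" "j < k"
  shows "c k i \<le> c k j"
  using assms(2,3)
proof (induction j rule: dec_induct)
  case (step n)
  from step.prems obtain l where l: "k = Suc l" "n < l" by (cases k) auto
  have "c k n \<le> c k (Suc n)"
    using assms(1) l unfolding gt_array_def by (meson order_trans)
  with step show ?case by simp
qed simp

lemma gt_array_decseq:
  assumes "gt_array c" "j < k" "k \<le> l"
  shows "c l j \<le> c k j"
  using assms(3)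
proof (induction l rule: dec_induct)
  case (step n)
  then have "c (Suc n) j \<le> c n j" using assms unfolding gt_array_def by auto
  with step show ?case by simp
qed simp

lemma gt_array_le_diagonal:
  assumes "gt_array c" "j < k"
  shows "c k j \<le> c (k + d) (j + d)"
proof (induction d)
  case (Suc d)
  have "c (k + d) (j + d) \<le> c (Suc (k + d)) (Suc (j + d))"
    using assms unfolding gt_array_def by auto
  with Suc show ?case by simp
qed simp

lemma Sign_lam_theta:
  assumes "\<And>i j. i \<le> j \<Longrightarrow> j < k \<Longrightarrow> f i \<le> f j"
  shows "lam_theta k f \<in> Sign k"
  using assms by (auto simp: Sign_def sorted_wrt_iff_nth_less lam_theta_nth)

lemma path_of_in_GT_space:
  assumes "gt_array c"
  shows "path_of c \<in> GT_space"
proof -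
  have S: "lam_theta k (c k) \<in> Sign k" for k
    by (rule Sign_lam_theta) (use gt_array_mono[OF assms] in auto)
  have I: "interlace (lam_theta k (c k)) (lam_theta (Suc k) (c (Suc k)))" for k
    unfolding interlace_def
  proof (intro conjI allI impI)
    fix i assume i: "i < length (lam_theta k (c k))"
    then have "k - i = Suc (k - Suc i)" by simp
    with assms i show "lam_theta k (c k) ! i \<le> lam_theta (Suc k) (c (Suc k)) ! i"
      by (simp add: lam_theta_nth gt_array_def)
    from assms i show "lam_theta (Suc k) (c (Suc k)) ! Suc i \<le> lam_theta k (c k) ! i"
      by (simp add: lam_theta_nth gt_array_def)
  qed simp
  have "fst (path_of c 0) = []" by (simp add: path_of_def lam_theta_def)
  then show ?thesis
    using S I by (simp add: GT_space_def is_edge_def path_of_def)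
qed

lemma GT_space_length: "\<omega> \<in> GT_space \<Longrightarrow> length (fst (\<omega> n)) = n"
  by (auto simp: GT_space_def is_edge_def Sign_def)

lemma GT_space_snd: "\<omega> \<in> GT_space \<Longrightarrow> snd (\<omega> n) = fst (\<omega> (Suc n))"
  by (auto simp: GT_space_def)

lemma GT_space_is_edge: "\<omega> \<in> GT_space \<Longrightarrow> is_edge (Suc n) (\<omega> n)"
  by (auto simp: GT_space_def)

lemma GT_space_edge: "\<omega> \<in> GT_space \<Longrightarrow> \<omega> n = (fst (\<omega> n), fst (\<omega> (Suc n)))"
  by (metis GT_space_snd prod.collapse)

lemma GT_space_fst_0: "\<omega> \<in> GT_space \<Longrightarrow> fst (\<omega> 0) = []"
  by (auto simp: GT_space_def)

lemma lam_theta_coord: "\<omega> \<in> GT_space \<Longrightarrow> lam_theta k (coord \<omega> k) = fst (\<omega> k)"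
  by (rule nth_equalityI)
    (auto simp: GT_space_length lam_theta_nth coord_def rev_nth)

lemma path_of_coord: "\<omega> \<in> GT_space \<Longrightarrow> path_of (coord \<omega>) = \<omega>"
  by (rule ext) (metis GT_space_edge lam_theta_coord path_of_def)

lemma coord_path_of: "j < k \<Longrightarrow> coord (path_of c) k j = c k j"
  by (simp add: coord_def path_of_def nth_rev_lam_theta)

lemma gt_array_coord:
  assumes "\<omega> \<in> GT_space"
  shows "gt_array (coord \<omega>)"
  unfolding gt_array_def
proof (intro allI impI)
  fix k j :: nat assume j: "j < k"
  have I: "interlace (fst (\<omega> k)) (fst (\<omega> (Suc k)))"
    using GT_space_is_edge[OF assms, of k] GT_space_snd[OF assms, of k] by (simp add: is_edge_def)
  have "k - j = Suc (k - Suc j)" using j by simp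
  moreover have "k - Suc j < k" using j by simp
  ultimately show "coord \<omega> (Suc k) j \<le> coord \<omega> k j \<and> coord \<omega> k j \<le> coord \<omega> (Suc k) (Suc j)"
    using I j GT_space_length[OF assms] unfolding interlace_def coord_def
    by (auto simp: rev_nth)
qed

lemma GT_space_eqI:
  assumes "\<omega> \<in> GT_space" "\<omega>' \<in> GT_space" "\<And>k j. j < k \<Longrightarrow> coord \<omega> k j = coord \<omega>' k j"
  shows "\<omega> = \<omega>'"
proof -
  have "path_of (coord \<omega>) = path_of (coord \<omega>')"
      unfolding path_of_def by (intro ext prod_eqI) (auto intro!: lam_theta_cong assms(3))
  with assms path_of_coord show ?thesis by metis
qed


lemma fst_eq_lam_theta_iff:
  assumes "\<omega> \<in> GT_space"
  shows "fst (\<omega> k) = lam_theta k f \<longleftrightarrow> (\<forall>j<k. coord \<omega> k j = f j)"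
  by (metis assms coord_def lam_theta_cong lam_theta_coord nth_rev_lam_theta)

section \<open>Level sums and the weight of a prefix\<close>

definition level_sum :: "(nat \<Rightarrow> edge) \<Rightarrow> nat \<Rightarrow> int" where
  "level_sum \<omega> N = (\<Sum>k<N. sumsig (fst (\<omega> k)))"

lemma sumsig_lam_theta: "sumsig (lam_theta k f) = (\<Sum>j<k. f j)"
  by (simp add: sumsig_def lam_theta_def interv_sum_list_conv_sum_set_nat atLeast0LessThan)

lemma sumsig_coord: "\<omega> \<in> GT_space \<Longrightarrow> sumsig (fst (\<omega> k)) = (\<Sum>j<k. coord \<omega> k j)"
  by (metis lam_theta_coord sumsig_lam_theta)

lemma wpath_append: "wpath q (\<alpha> @ \<beta>) = wpath q \<alpha> * wpath q \<beta>"
  by (simp add: wpath_def)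

lemma wpath_pos: "0 < q \<Longrightarrow> 0 < wpath q \<alpha>"
  by (induction \<alpha>) (auto simp: wpath_def wedge_def Let_def)

text \<open>Level \<open>k\<close> enters with coefficient \<open>k + 1\<close> from the edge
  leaving it and \<open>- (k - 1)\<close> from the edge reaching it, so every level below the
  endpoint counts twice. For a fixed endpoint the weight therefore depends on
  \<open>level_sum\<close> only.\<close>

lemma wpath_prefix:
  assumes "\<omega> \<in> GT_space" "q \<noteq> 0"
  shows "wpath q (map \<omega> [0..<N]) = q powi (2 * level_sum \<omega> N - (int N - 1) * sumsig (fst (\<omega> N)))"
proof (induction N)
  case 0
  then show ?case
    using assms by (simp add: wpath_def level_sum_def GT_space_fst_0 sumsig_def)
next
  case (Suc N)
  have "wedge q (\<omega> N) = q powi (int (Suc N) * sumsig (fst (\<omega> N)) - int N * sumsig (fst (\<omega> (Suc N))))"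
    using assms by (simp add: wedge_def Let_def GT_space_snd GT_space_length)
  then show ?case
    using Suc assms(2)
    by (simp add: wpath_append level_sum_def)
       (simp add: wpath_def power_int_add[symmetric] algebra_simps)
qed

lemma fpaths_segment:
  assumes "\<omega> \<in> GT_space" "N < n"
  shows "map \<omega> [N..<n] \<in> fpaths (fst (\<omega> N)) (fst (\<omega> n))"
proof -
  have "snd (last (map \<omega> [N..<n])) = fst (\<omega> n)"
    using assms GT_space_snd[OF assms(1), of "n - 1"] by (simp add: last_map)
  then show ?thesis
    using assms by (auto simp: fpaths_def GT_space_length GT_space_is_edge GT_space_snd nth_Cons')
qed

lemma fpaths_prefix:
  assumes "\<omega> \<in> GT_space" "0 < n"
  shows "map \<omega> [0..<n] \<in> fpaths [] (fst (\<omega> n))"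
  using fpaths_segment[OF assms] by (simp add: GT_space_fst_0 assms)

text \<open>Gluing creates only two junctions, at \<open>mu\<close> and at \<open>lam\<close>. The
  case \<open>mu = []\<close> gives the prefix exchange \<open>graft\<close>; a general
  \<open>mu\<close> serves to identify the paths counted by \<open>dimq\<close> with infinite
  paths.\<close>

lemma splice_in_GT_space:
  assumes \<alpha>: "\<alpha> \<in> fpaths mu lam" and "\<omega> \<in> GT_space" "\<eta> \<in> GT_space"
    and mu: "fst (\<omega> (length mu)) = mu" and lam: "fst (\<eta> (length lam)) = lam"
  shows "(\<lambda>n. if n < length mu then \<omega> n else if n < length lam then \<alpha> ! (n - length mu) else \<eta> n)
          \<in> GT_space" (is "?f \<in> _")
proof -
  let ?m = "length mu" and ?l = "length lam"
  from \<alpha> have len: "?m < ?l" "length \<alpha> = ?l - ?m"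
    and edge: "\<And>j. j < ?l - ?m \<Longrightarrow> is_edge (?m + j + 1) (\<alpha> ! j)"
    and hd: "fst (\<alpha> ! 0) = mu" and last: "snd (last \<alpha>) = lam"
    and link: "\<And>j. Suc j < ?l - ?m \<Longrightarrow> snd (\<alpha> ! j) = fst (\<alpha> ! Suc j)"
    by (auto simp: fpaths_def)
  have "\<alpha> \<noteq> []" using len by auto
  then have last': "snd (\<alpha> ! (?l - ?m - 1)) = lam" using last len by (simp add: last_conv_nth)
  have "is_edge (Suc n) (?f n)" for n
    using edge[of "n - ?m"] GT_space_is_edge assms(2,3) by auto
  moreover have "snd (?f n) = fst (?f (Suc n))" for n
  proof -
    consider "Suc n < ?m" | "Suc n = ?m" | "?m \<le> n" "Suc n < ?l" | "?m \<le> n" "Suc n = ?l" | "?l \<le> n"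
      by linarith
    then show ?thesis
    proof cases
      case 2
      then have "snd (\<omega> n) = mu" using GT_space_snd[OF assms(2), of n] mu by simp
      then show ?thesis using 2 len hd by auto
    next
      case 3
      then show ?thesis using link[of "n - ?m"] by (simp add: Suc_diff_le)
    next
      case 4
      then have "n - ?m = ?l - ?m - 1" by linarith
      then show ?thesis using 4 last' lam by auto
    qed (use len GT_space_snd assms(2,3) in auto)
  qed
  moreover have "fst (?f 0) = []"
    using GT_space_fst_0[OF assms(2)] hd len by (cases "?m = 0") auto
  ultimately show ?thesis unfolding GT_space_def by blast
qed

text \<open>Between the cylinders of two prefixes with the same endpoint this is a bijection,
  inverted by grafting the old prefix back.\<close>

definition graft :: "edge list \<Rightarrow> (nat \<Rightarrow> edge) \<Rightarrow> nat \<Rightarrow> edge" where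
  "graft \<beta> \<omega> = (\<lambda>n. if n < length \<beta> then \<beta> ! n else \<omega> n)"

lemma fpaths_length: "\<alpha> \<in> fpaths [] lam \<Longrightarrow> length \<alpha> = length lam \<and> 0 < length lam"
  by (simp add: fpaths_def)

lemma graft_in_GT_space:
  assumes "\<beta> \<in> fpaths [] lam" "\<omega> \<in> GT_space" "fst (\<omega> (length lam)) = lam"
  shows "graft \<beta> \<omega> \<in> GT_space"
  using splice_in_GT_space[OF assms(1,2,2) _ assms(3)] GT_space_fst_0[OF assms(2)]
    fpaths_length[OF assms(1)]
  by (simp add: graft_def cong: if_cong)

lemma cyl_end:
  assumes "\<alpha> \<in> fpaths [] lam" "\<omega> \<in> cyl \<alpha>"
  shows "fst (\<omega> (length lam)) = lam"
proof -
  have len: "length \<alpha> = length lam" "0 < length lam" using fpaths_length[OF assms(1)] by auto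
  have "snd (last \<alpha>) = lam" using assms by (simp add: fpaths_def)
  moreover have "last \<alpha> = \<omega> (length lam - 1)"
    using len assms(2) by (subst last_conv_nth) (auto simp: cyl_def)
  ultimately show ?thesis
    using assms(2) len GT_space_snd[of \<omega> "length lam - 1"] by (simp add: cyl_def)
qed

lemma cyl_prefix_eq: "\<omega> \<in> cyl \<alpha> \<Longrightarrow> map \<omega> [0..<length \<alpha>] = \<alpha>"
  by (rule nth_equalityI) (auto simp: cyl_def)

lemma in_cyl_prefix_iff:
  "\<omega> \<in> cyl (map \<eta> [0..<N]) \<longleftrightarrow> \<omega> \<in> GT_space \<and> (\<forall>n<N. \<omega> n = \<eta> n)"
  by (auto simp: cyl_def)

lemma graft_in_cyl:
  assumes "\<alpha> \<in> fpaths [] lam" "\<beta> \<in> fpaths [] lam" "\<omega> \<in> cyl \<alpha>"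
  shows "graft \<beta> \<omega> \<in> cyl \<beta>"
  using graft_in_GT_space[OF assms(2), of \<omega>] cyl_end[OF assms(1,3)] assms(3)
  by (auto simp: cyl_def graft_def)

lemma graft_graft:
  assumes "\<alpha> \<in> fpaths [] lam" "\<beta> \<in> fpaths [] lam" "\<omega> \<in> cyl \<alpha>"
  shows "graft \<alpha> (graft \<beta> \<omega>) = \<omega>"
  using assms fpaths_length[OF assms(1)] fpaths_length[OF assms(2)]
  by (auto simp: graft_def cyl_def)

lemma fpaths_in_prefix:
  assumes "\<alpha> \<in> fpaths [] lam"
  obtains \<omega> where "\<omega> \<in> cyl \<alpha>"
proof -
  have len: "length \<alpha> = length lam" "0 < length lam" using fpaths_length[OF assms] by auto
  have "\<And>j. j < length lam \<Longrightarrow> is_edge (Suc j) (\<alpha> ! j)"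
    using assms by (auto simp: fpaths_def)
  from this[of "length lam - 1"] have "is_edge (length lam) (last \<alpha>)"
    using len by (subst last_conv_nth) auto
  moreover have "snd (last \<alpha>) = lam" using assms by (simp add: fpaths_def)
  ultimately have S: "lam \<in> Sign (length lam)" by (simp add: is_edge_def)
  \<comment> \<open>The path is continued by an array that is constant in the level: its row is the
    reversed signature, padded with the maximum \<open>m\<close> of \<open>lam\<close>. For such an
    array interlacing amounts to a nondecreasing row.\<close>
  define m where "m = Max (set lam)"
  define f where "f j = (if j < length lam then rev lam ! j else m)" for j
  have m: "x \<le> m" if "x \<in> set lam" for x using that by (simp add: m_def)
  have mono: "f i \<le> f j" if "i \<le> j" for i j
  proof (cases "j < length lam")
    case True
    have "lam ! (length lam - Suc i) \<le> lam ! (length lam - Suc j)"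
      using S True that
      by (cases "i = j") (auto simp: Sign_def sorted_wrt_iff_nth_less)
    with True that show ?thesis by (simp add: f_def rev_nth)
  next
    case False
    then show ?thesis using m by (auto simp: f_def rev_nth)
  qed
  then have "gt_array (\<lambda>_. f)" by (simp add: gt_array_def)
  then have \<eta>: "path_of (\<lambda>_. f) \<in> GT_space" by (rule path_of_in_GT_space)
  have "fst (path_of (\<lambda>_. f) (length lam)) = lam"
    by (auto simp: path_of_def f_def lam_theta_nth rev_nth intro!: nth_equalityI)
  from graft_in_GT_space[OF assms \<eta> this] have "graft \<alpha> (path_of (\<lambda>_. f)) \<in> cyl \<alpha>"
    by (simp add: cyl_def graft_def)
  then show thesis by (rule that)
qed

section \<open>Tail equivalence and its integer cocycle\<close>

definition tail_rel :: "int \<Rightarrow> (nat \<Rightarrow> edge) \<Rightarrow> (nat \<Rightarrow> edge) \<Rightarrow> bool" where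
  "tail_rel d \<omega> \<omega>' \<longleftrightarrow> \<omega> \<in> GT_space \<and> \<omega>' \<in> GT_space \<and>
     (\<exists>N. (\<forall>k\<ge>N. \<omega> k = \<omega>' k) \<and> level_sum \<omega>' N - level_sum \<omega> N = d)"

lemma level_sum_diff_eq:
  assumes "\<forall>k\<ge>N. \<omega> k = \<omega>' k" "N \<le> n"
  shows "level_sum \<omega>' n - level_sum \<omega> n = level_sum \<omega>' N - level_sum \<omega> N"
  using assms(2)
proof (induction n rule: dec_induct)
  case (step n)
  then show ?case using assms(1) by (simp add: level_sum_def)
qed simp

text \<open>The difference of level sums is the same at all levels from which the paths agree, as a
  comparison at the larger of two such levels shows. So \<open>d\<close> is determined by the pair
  and may be read off at any convenient level.\<close>

lemma tail_rel_iff: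
  assumes "\<omega> \<in> GT_space" "\<omega>' \<in> GT_space" "\<forall>k\<ge>N. \<omega> k = \<omega>' k"
  shows "tail_rel d \<omega> \<omega>' \<longleftrightarrow> level_sum \<omega>' N - level_sum \<omega> N = d"
proof
  assume "tail_rel d \<omega> \<omega>'"
  then obtain M where M: "\<forall>k\<ge>M. \<omega> k = \<omega>' k" "level_sum \<omega>' M - level_sum \<omega> M = d"
    by (auto simp: tail_rel_def)
  then show "level_sum \<omega>' N - level_sum \<omega> N = d"
    using level_sum_diff_eq[OF M(1), of "max M N"] level_sum_diff_eq[OF assms(3), of "max M N"] by simp
qed (use assms in \<open>auto simp: tail_rel_def\<close>)

lemma tail_rel_refl: "\<omega> \<in> GT_space \<Longrightarrow> tail_rel 0 \<omega> \<omega>"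
  by (auto simp: tail_rel_def)

lemma tail_rel_sym: "tail_rel d \<omega> \<omega>' \<Longrightarrow> tail_rel (- d) \<omega>' \<omega>"
  unfolding tail_rel_def by (metis minus_diff_eq)

lemma tail_rel_trans:
  assumes "tail_rel d \<omega> \<omega>'" "tail_rel e \<omega>' \<omega>''"
  shows "tail_rel (d + e) \<omega> \<omega>''"
proof -
  from assms obtain N M where N: "\<forall>k\<ge>N. \<omega> k = \<omega>' k" and M: "\<forall>k\<ge>M. \<omega>' k = \<omega>'' k"
    and in_space: "\<omega> \<in> GT_space" "\<omega>' \<in> GT_space" "\<omega>'' \<in> GT_space"
    by (auto simp: tail_rel_def)
  let ?K = "max N M"
  have "level_sum \<omega>' ?K - level_sum \<omega> ?K = d" "level_sum \<omega>'' ?K - level_sum \<omega>' ?K = e"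
    using assms N M in_space by (auto simp flip: tail_rel_iff)
  then show ?thesis
    using in_space N M by (subst tail_rel_iff[of _ _ ?K]) auto
qed

section \<open>Transport of a q-central measure along tail equivalence\<close>

text \<open>The endpoint terms of the two weights cancel, which leaves twice the difference of level
  sums in the exponent. The converse direction compares exponents, as \<open>0 < q < 1\<close>
  allows.\<close>

lemma tail_rel_graft_iff:
  assumes q: "0 < q" "q < 1" and \<alpha>: "\<alpha> \<in> fpaths [] lam" and \<beta>: "\<beta> \<in> fpaths [] lam" and \<omega>: "\<omega> \<in> cyl \<alpha>"
  shows "tail_rel d \<omega> (graft \<beta> \<omega>) \<longleftrightarrow> wpath q \<beta> = q powi (2 * d) * wpath q \<alpha>"
proof -
  let ?N = "length lam" and ?\<eta> = "graft \<beta> \<omega>"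
  have len: "length \<alpha> = ?N" "length \<beta> = ?N" using \<alpha> \<beta> fpaths_length by auto
  have \<eta>: "?\<eta> \<in> cyl \<beta>" using graft_in_cyl[OF \<alpha> \<beta> \<omega>] .
  have in_space: "\<omega> \<in> GT_space" "?\<eta> \<in> GT_space" using \<omega> \<eta> by (auto simp: cyl_def)
  have "wpath q \<alpha> = q powi (2 * level_sum \<omega> ?N - (int ?N - 1) * sumsig lam)"
    using wpath_prefix[OF in_space(1), of q ?N] cyl_prefix_eq[OF \<omega>] cyl_end[OF \<alpha> \<omega>] len q by simp
  moreover have "wpath q \<beta> = q powi (2 * level_sum ?\<eta> ?N - (int ?N - 1) * sumsig lam)"
    using wpath_prefix[OF in_space(2), of q ?N] cyl_prefix_eq[OF \<eta>] cyl_end[OF \<beta> \<eta>] len q by simp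
  ultimately have "wpath q \<beta> = q powi (2 * d) * wpath q \<alpha> \<longleftrightarrow>
      q powi (2 * level_sum ?\<eta> ?N - (int ?N - 1) * sumsig lam) =
      q powi (2 * d + (2 * level_sum \<omega> ?N - (int ?N - 1) * sumsig lam))"
    using q by (simp add: power_int_add)
  also have "\<dots> \<longleftrightarrow> level_sum ?\<eta> ?N - level_sum \<omega> ?N = d"
  proof -
    have "q powi i \<noteq> q powi j" if "i < j" for i j :: int
      using power_int_strict_decreasing[OF that q] by simp
    then have inj: "q powi i = q powi j \<longleftrightarrow> i = j" for i j :: int
      using linorder_less_linear[of i j] by metis
    show ?thesis unfolding inj by linarith
  qed
  finally show ?thesis
    using tail_rel_iff[OF in_space, of ?N] len by (simp add: graft_def)
qed

section \<open>The sigma-algebra, finite-level sets and measurability of grafts\<close>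

lemma space_GT_alg [simp]: "space GT_alg = GT_space"
  by (auto simp: GT_alg_def space_measure_of_conv)

lemma cyl_in_sets [measurable]: "cyl \<alpha> \<in> sets GT_alg"
\<comment> \<open>Only cylinders of genuine finite paths are generators. Any other list has an empty
  cylinder, except \<open>[]\<close>, whose cylinder is the whole space.\<close>
proof (cases "cyl \<alpha> = {} \<or> \<alpha> = []")
  case True
  have "cyl [] = GT_space" by (simp add: cyl_def)
  with True sets.top[of GT_alg] show ?thesis by (metis sets.empty_sets space_GT_alg)
next
  case False
  then obtain \<omega> where "\<omega> \<in> cyl \<alpha>" by auto
  then have "\<alpha> \<in> fpaths [] (fst (\<omega> (length \<alpha>)))"
    using fpaths_prefix[of \<omega> "length \<alpha>"] cyl_prefix_eq[of \<omega> \<alpha>] False by (auto simp: cyl_def)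
  then have "cyl \<alpha> \<in> {cyl \<alpha> |\<alpha> lam. \<alpha> \<in> fpaths [] lam}" by blast
  moreover have "{cyl \<alpha> |\<alpha> lam. \<alpha> \<in> fpaths [] lam} \<subseteq> Pow GT_space" by (auto simp: cyl_def)
  ultimately show ?thesis unfolding GT_alg_def by (simp add: sigma_sets.Basic)
qed

text \<open>The events decided by the first \<open>N\<close> edges, described as the sets saturated
  under agreement of these edges. There are countably many prefixes, so each such set is a countable
  union of cylinders and hence measurable.\<close>

definition level_set :: "nat \<Rightarrow> (nat \<Rightarrow> edge) set \<Rightarrow> bool" where
  "level_set N D \<longleftrightarrow> D \<subseteq> GT_space \<and>
     (\<forall>\<omega>\<in>D. \<forall>\<omega>'\<in>GT_space. (\<forall>n<N. \<omega> n = \<omega>' n) \<longrightarrow> \<omega>' \<in> D)"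

lemma level_set_Collect:
  assumes "\<And>\<omega> \<omega>'. (\<And>n. n < N \<Longrightarrow> \<omega> n = \<omega>' n) \<Longrightarrow> Q \<omega> = Q \<omega>'"
  shows "level_set N {\<omega>\<in>GT_space. Q \<omega>}"
  unfolding level_set_def
proof (intro conjI ballI impI)
  fix \<omega> \<omega>' assume "\<omega> \<in> {\<omega>\<in>GT_space. Q \<omega>}" "\<omega>' \<in> GT_space" "\<forall>n<N. \<omega> n = \<omega>' n"
  with assms[of \<omega> \<omega>'] show "\<omega>' \<in> {\<omega>\<in>GT_space. Q \<omega>}" by simp
qed simp

lemma level_set_eq_UN:
  "level_set N D \<Longrightarrow> D = (\<Union>\<alpha>\<in>(\<lambda>\<omega>. map \<omega> [0..<N]) ` D. cyl \<alpha>)"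
  by (fastforce simp: level_set_def in_cyl_prefix_iff)

lemma level_set_in_sets:
  assumes "level_set N D"
  shows "D \<in> sets GT_alg"
  by (subst level_set_eq_UN[OF assms]) (intro sets.countable_UN'' cyl_in_sets, auto)

lemma level_set_mono: "level_set N D \<Longrightarrow> N \<le> M \<Longrightarrow> level_set M D"
  by (force simp: level_set_def)

lemma measurable_edge [measurable]: "(\<lambda>\<omega>. \<omega> n) \<in> measurable GT_alg (count_space UNIV)"
proof -
  have "{\<omega> \<in> GT_space. \<omega> n = e} \<in> sets GT_alg" for e
    by (rule level_set_in_sets[of "Suc n"]) (auto intro: level_set_Collect)
  then show ?thesis
    by (subst measurable_count_space_eq_countable) (auto simp: vimage_def Int_def conj_commute)
qed

lemma measurable_GT_algI:
  assumes "\<And>\<omega>. \<omega> \<in> space M \<Longrightarrow> f \<omega> \<in> GT_space"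
    and [measurable]: "\<And>n. (\<lambda>\<omega>. f \<omega> n) \<in> measurable M (count_space UNIV)"
  shows "f \<in> measurable M GT_alg"
  unfolding GT_alg_def
proof (rule measurable_measure_of)
  show "{cyl \<alpha> |\<alpha> lam. \<alpha> \<in> fpaths [] lam} \<subseteq> Pow GT_space" by (auto simp: cyl_def)
  show "f \<in> space M \<rightarrow> GT_space" using assms by auto
  fix y assume "y \<in> {cyl \<alpha> |\<alpha> lam. \<alpha> \<in> fpaths [] lam}"
  then obtain \<alpha> where y: "y = cyl \<alpha>" by auto
  have "f -` y \<inter> space M = {\<omega> \<in> space M. \<forall>n<length \<alpha>. f \<omega> n = \<alpha> ! n}"
    using assms(1) by (auto simp: y cyl_def)
  also have "\<dots> \<in> sets M" by measurable
  finally show "f -` y \<inter> space M \<in> sets M" .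
qed

lemma graft_vimage_in_sets [measurable]:
  assumes "\<alpha> \<in> fpaths [] lam" "\<beta> \<in> fpaths [] lam" "E \<in> sets GT_alg"
  shows "{\<omega> \<in> cyl \<alpha>. graft \<beta> \<omega> \<in> E} \<in> sets GT_alg"
proof -
  \<comment> \<open>Outside \<open>cyl \<alpha>\<close> a graft can leave \<open>GT_space\<close>;
    the identity there yields a map of the whole space, to which \<open>measurable_GT_algI\<close>
    applies.\<close>
  define f where "f \<omega> = (if \<omega> \<in> cyl \<alpha> then graft \<beta> \<omega> else \<omega>)" for \<omega>
  have "f \<in> measurable GT_alg GT_alg"
  proof (rule measurable_GT_algI)
    show "f \<omega> \<in> GT_space" if "\<omega> \<in> space GT_alg" for \<omega>
      using that graft_in_cyl[OF assms(1,2)] by (auto simp: f_def cyl_def)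
    show "(\<lambda>\<omega>. f \<omega> n) \<in> measurable GT_alg (count_space UNIV)" for n
      unfolding f_def graft_def if_distribR by measurable
  qed
  then have "f -` E \<inter> space GT_alg \<inter> cyl \<alpha> \<in> sets GT_alg" using assms(3) by measurable
  also have "f -` E \<inter> space GT_alg \<inter> cyl \<alpha> = {\<omega> \<in> cyl \<alpha>. graft \<beta> \<omega> \<in> E}"
    by (auto simp: f_def cyl_def)
  finally show ?thesis .
qed

definition tail_sat :: "int \<Rightarrow> (nat \<Rightarrow> edge) set \<Rightarrow> (nat \<Rightarrow> edge) set" where
  "tail_sat d Z = {\<omega>. \<exists>\<omega>'\<in>Z. tail_rel d \<omega> \<omega>'}"

definition swaps :: "real \<Rightarrow> int \<Rightarrow> (edge list \<times> edge list) set" where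
  "swaps q d = {(\<alpha>, \<beta>) | \<alpha> \<beta>. \<exists>lam. \<alpha> \<in> fpaths [] lam \<and> \<beta> \<in> fpaths [] lam \<and>
     wpath q \<beta> = q powi (2 * d) * wpath q \<alpha>}"

text \<open>Related points differ by one exchange of prefixes with a common endpoint, and there are
  only countably many pairs of prefixes. This reduces measurability and null sets of saturations to
  single grafts.\<close>

lemma tail_sat_eq_UN:
  assumes q: "0 < q" "q < 1"
  shows "tail_sat d Z = (\<Union>(\<alpha>, \<beta>)\<in>swaps q d. {\<omega> \<in> cyl \<alpha>. graft \<beta> \<omega> \<in> Z})"
proof (intro equalityI subsetI)
  fix \<omega> assume "\<omega> \<in> tail_sat d Z"
  then obtain \<omega>' where Z: "\<omega>' \<in> Z" and rel: "tail_rel d \<omega> \<omega>'" by (auto simp: tail_sat_def)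
  then obtain N where N: "\<forall>k\<ge>N. \<omega> k = \<omega>' k" and in_space: "\<omega> \<in> GT_space" "\<omega>' \<in> GT_space"
    by (auto simp: tail_rel_def)
  \<comment> \<open>One level beyond \<open>N\<close> is used because \<open>fpaths\<close> contains
    no empty path.\<close>
  let ?n = "Suc N"
  have \<alpha>: "map \<omega> [0..<?n] \<in> fpaths [] (fst (\<omega> ?n))" using in_space by (intro fpaths_prefix) auto
  have "map \<omega>' [0..<?n] \<in> fpaths [] (fst (\<omega>' ?n))" using in_space by (intro fpaths_prefix) auto
  then have \<beta>: "map \<omega>' [0..<?n] \<in> fpaths [] (fst (\<omega> ?n))" using N by simp
  have cyl: "\<omega> \<in> cyl (map \<omega> [0..<?n])" using in_space by (simp add: in_cyl_prefix_iff del: upt_Suc)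
  have graft: "graft (map \<omega>' [0..<?n]) \<omega> = \<omega>'" using N by (auto simp: graft_def simp del: upt_Suc)
  from tail_rel_graft_iff[OF q \<alpha> \<beta> cyl, of d] graft rel
  have "(map \<omega> [0..<?n], map \<omega>' [0..<?n]) \<in> swaps q d"
    using \<alpha> \<beta> by (auto simp: swaps_def)
  then show "\<omega> \<in> (\<Union>(\<alpha>, \<beta>)\<in>swaps q d. {\<omega> \<in> cyl \<alpha>. graft \<beta> \<omega> \<in> Z})"
    using cyl graft Z by force
next
  fix \<omega> assume "\<omega> \<in> (\<Union>(\<alpha>, \<beta>)\<in>swaps q d. {\<omega> \<in> cyl \<alpha>. graft \<beta> \<omega> \<in> Z})"
  then obtain \<alpha> \<beta> lam where "\<alpha> \<in> fpaths [] lam" "\<beta> \<in> fpaths [] lam"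
    "wpath q \<beta> = q powi (2 * d) * wpath q \<alpha>" "\<omega> \<in> cyl \<alpha>" "graft \<beta> \<omega> \<in> Z"
    by (auto simp: swaps_def)
  with tail_rel_graft_iff[OF q this(1,2,4)] show "\<omega> \<in> tail_sat d Z"
    by (auto simp: tail_sat_def)
qed

text \<open>Two cylinders are nested or disjoint, so adjoining the empty set gives a generating
  pi-system, as the induction in \<open>measure_graft_vimage\<close> requires.\<close>

lemma Int_stable_cyls: "Int_stable (insert {} {cyl \<alpha> |\<alpha> lam. \<alpha> \<in> fpaths [] lam})"
proof -
  have *: "cyl \<alpha> \<inter> cyl \<beta> = {} \<or> cyl \<alpha> \<inter> cyl \<beta> = cyl \<beta>" if "length \<alpha> \<le> length \<beta>" for \<alpha> \<beta>
    using that by (auto simp: cyl_def)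
  show ?thesis
  proof (rule Int_stableI)
    fix A B assume AB: "A \<in> insert {} {cyl \<alpha> |\<alpha> lam. \<alpha> \<in> fpaths [] lam}"
      "B \<in> insert {} {cyl \<alpha> |\<alpha> lam. \<alpha> \<in> fpaths [] lam}"
    show "A \<inter> B \<in> insert {} {cyl \<alpha> |\<alpha> lam. \<alpha> \<in> fpaths [] lam}"
    proof (cases "A = {} \<or> B = {}")
      case False
      with AB obtain \<alpha> \<beta> where "A = cyl \<alpha>" "B = cyl \<beta>" by auto
      then have "A \<inter> B \<in> {{}, A, B}"
        using *[of \<alpha> \<beta>] *[of \<beta> \<alpha>] by (cases "length \<alpha> \<le> length \<beta>") (auto simp: Int_commute)
      with AB show ?thesis by auto
    qed auto
  qed
qed

lemma sets_GT_alg: "sets GT_alg = sigma_sets GT_space (insert {} {cyl \<alpha> |\<alpha> lam. \<alpha> \<in> fpaths [] lam})"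
proof -
  have "sets GT_alg = sigma_sets GT_space {cyl \<alpha> |\<alpha> lam. \<alpha> \<in> fpaths [] lam}"
    unfolding GT_alg_def by (rule sets_measure_of) (auto simp: cyl_def)
  also have "\<dots> = sigma_sets GT_space (insert {} {cyl \<alpha> |\<alpha> lam. \<alpha> \<in> fpaths [] lam})"
    by (intro equalityI sigma_sets_mono subsetI)
       (auto intro: sigma_sets.Basic sigma_sets.Empty)
  finally show ?thesis .
qed

section \<open>Mass under prefix exchange and quasi-invariance\<close>

locale q_central_measure =
  fixes q :: real and P :: "(nat \<Rightarrow> edge) measure"
  assumes q: "0 < q" "q < 1" and central: "q_central q P"
begin

lemma sets_P [measurable_cong, simp]: "sets P = sets GT_alg"
  using central by (simp add: q_central_def)

lemma space_P [simp]: "space P = GT_space"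
  using sets_eq_imp_space_eq[OF sets_P] by simp

sublocale prob_space P
  using central by (simp add: q_central_def)

lemma measure_cyl_proportional:
  assumes "\<alpha> \<in> fpaths [] lam" "\<beta> \<in> fpaths [] lam"
  shows "wpath q \<alpha> * measure P (cyl \<beta>) = wpath q \<beta> * measure P (cyl \<alpha>)"
proof -
  have "measure P (cyl \<alpha>) / wpath q \<alpha> = measure P (cyl \<beta>) / wpath q \<beta>"
    using central assms by (simp add: q_central_def)
  then show ?thesis
    using wpath_pos[OF q(1), of \<alpha>] wpath_pos[OF q(1), of \<beta>] by (simp add: field_simps)
qed

text \<open>If \<open>\<gamma>\<close> is compatible with \<open>\<beta>\<close> and not longer, its
  cylinder contains that of \<open>\<beta>\<close>, and centrality applies to
  \<open>\<alpha>\<close> and \<open>\<beta>\<close>. If it is longer, the preimage is the cylinder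
  of \<open>\<alpha>\<close> continued along \<open>\<gamma>\<close>; the two long prefixes share
  their endpoint and the weight of the continuation, which cancels.\<close>

lemma measure_graft_vimage_cyl:
  assumes \<alpha>: "\<alpha> \<in> fpaths [] lam" and \<beta>: "\<beta> \<in> fpaths [] lam"
  shows "wpath q \<alpha> * measure P (cyl \<beta> \<inter> cyl \<gamma>) =
         wpath q \<beta> * measure P {\<omega> \<in> cyl \<alpha>. graft \<beta> \<omega> \<in> cyl \<gamma>}"
proof (cases "cyl \<beta> \<inter> cyl \<gamma> = {}")
  case True
  then have *: "{\<omega> \<in> cyl \<alpha>. graft \<beta> \<omega> \<in> cyl \<gamma>} = {}" using graft_in_cyl[OF \<alpha> \<beta>] by auto
  show ?thesis unfolding * True by simp
next
  case False
  then obtain \<eta> where \<eta>: "\<eta> \<in> cyl \<beta>" "\<eta> \<in> cyl \<gamma>" by auto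
  let ?N = "length lam" and ?n = "length \<gamma>" and ?\<eta>' = "graft \<alpha> \<eta>"
  have len: "length \<alpha> = ?N" "length \<beta> = ?N" "0 < ?N" using \<alpha> \<beta> fpaths_length by auto
  show ?thesis
  proof (cases "?n \<le> ?N")
    case True
    then have "cyl \<beta> \<subseteq> cyl \<gamma>" using \<eta> len by (auto simp: cyl_def)
    then have "cyl \<beta> \<inter> cyl \<gamma> = cyl \<beta>" "{\<omega> \<in> cyl \<alpha>. graft \<beta> \<omega> \<in> cyl \<gamma>} = cyl \<alpha>"
      using graft_in_cyl[OF \<alpha> \<beta>] by auto
    then show ?thesis using measure_cyl_proportional[OF \<alpha> \<beta>] by simp
  next
    case n: False
    have \<eta>': "?\<eta>' \<in> cyl \<alpha>" using graft_in_cyl[OF \<beta> \<alpha> \<eta>(1)] .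
    have in_space: "\<eta> \<in> GT_space" "?\<eta>' \<in> GT_space" using \<eta> \<eta>' by (auto simp: cyl_def)
    have \<gamma>: "\<gamma> = map \<eta> [0..<?n]" using cyl_prefix_eq[OF \<eta>(2)] by simp
    define \<gamma>' where "\<gamma>' = map ?\<eta>' [0..<?n]"
    have tl: "\<eta> k = ?\<eta>' k" if "k \<ge> ?N" for k using that len by (simp add: graft_def)
    have split: "[0..<?n] = [0..<?N] @ [?N..<?n]"
      using n upt_add_eq_append[of 0 ?N "?n - ?N"] by simp
    have w\<gamma>: "wpath q \<gamma> = wpath q \<beta> * wpath q (map \<eta> [?N..<?n])"
      by (subst \<gamma>, subst split) (use cyl_prefix_eq[OF \<eta>(1)] len in \<open>simp add: wpath_append\<close>)
    have tl_map: "map ?\<eta>' [?N..<?n] = map \<eta> [?N..<?n]" using tl by auto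
    have w\<gamma>': "wpath q \<gamma>' = wpath q \<alpha> * wpath q (map \<eta> [?N..<?n])"
      unfolding \<gamma>'_def split map_append wpath_append tl_map using cyl_prefix_eq[OF \<eta>'] len by simp
    have "0 < ?n" using n by linarith
    then have "\<gamma> \<in> fpaths [] (fst (\<eta> ?n))" "\<gamma>' \<in> fpaths [] (fst (?\<eta>' ?n))"
      using fpaths_prefix[OF in_space(1), of ?n] fpaths_prefix[OF in_space(2), of ?n] \<gamma>
      unfolding \<gamma>'_def by (metis, metis)
    moreover have "fst (?\<eta>' ?n) = fst (\<eta> ?n)" using tl[of ?n] n by simp
    ultimately have same_end: "wpath q \<gamma>' * measure P (cyl \<gamma>) = wpath q \<gamma> * measure P (cyl \<gamma>')"
      by (intro measure_cyl_proportional) auto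
    have "cyl \<beta> \<inter> cyl \<gamma> = cyl \<gamma>" using \<eta> n len by (auto simp: cyl_def)
    moreover have "{\<omega> \<in> cyl \<alpha>. graft \<beta> \<omega> \<in> cyl \<gamma>} = cyl \<gamma>'"
    proof (intro equalityI subsetI)
      fix \<omega> assume "\<omega> \<in> {\<omega> \<in> cyl \<alpha>. graft \<beta> \<omega> \<in> cyl \<gamma>}"
      then have \<omega>: "\<omega> \<in> cyl \<alpha>" "graft \<beta> \<omega> \<in> cyl \<gamma>" by auto
      have "\<omega> i = ?\<eta>' i" if "i < ?n" for i
      proof (cases "i < ?N")
        case True
        then show ?thesis using \<omega> len by (simp add: cyl_def graft_def)
      next
        case False
        have "graft \<beta> \<omega> i = \<gamma> ! i" using \<omega>(2) that by (simp add: cyl_def)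
        then have "\<omega> i = \<gamma> ! i" using False len by (simp add: graft_def)
        then show ?thesis using \<eta>(2) that False len by (simp add: cyl_def graft_def)
      qed
      then show "\<omega> \<in> cyl \<gamma>'" using \<omega> by (auto simp: \<gamma>'_def cyl_def)
    next
      fix \<omega> assume \<omega>: "\<omega> \<in> cyl \<gamma>'"
      have "\<omega> \<in> cyl \<alpha>" using \<omega> n len by (auto simp: cyl_def \<gamma>'_def graft_def)
      moreover from graft_in_cyl[OF \<alpha> \<beta> this] have "graft \<beta> \<omega> \<in> cyl \<gamma>"
        using \<omega> \<eta> n len by (auto simp: cyl_def \<gamma>'_def graft_def)
      ultimately show "\<omega> \<in> {\<omega> \<in> cyl \<alpha>. graft \<beta> \<omega> \<in> cyl \<gamma>}" by simp
    qed
    ultimately show ?thesis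
      using same_end w\<gamma> w\<gamma>' wpath_pos[OF q(1), of "map \<eta> [?N..<?n]"] by simp
  qed
qed

text \<open>Both sides are finite measures in \<open>E\<close>. They agree on the pi-system of
  cylinders, and complements and countable disjoint unions preserve the identity.\<close>

lemma measure_graft_vimage:
  assumes \<alpha>: "\<alpha> \<in> fpaths [] lam" and \<beta>: "\<beta> \<in> fpaths [] lam" and "E \<in> sets P"
  shows "wpath q \<alpha> * measure P (cyl \<beta> \<inter> E) = wpath q \<beta> * measure P {\<omega> \<in> cyl \<alpha>. graft \<beta> \<omega> \<in> E}"
proof -
  let ?X = "\<lambda>E. {\<omega> \<in> cyl \<alpha>. graft \<beta> \<omega> \<in> E}"
  let ?G = "insert {} {cyl \<alpha> |\<alpha> lam. \<alpha> \<in> fpaths [] lam}"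
  have G: "?G \<subseteq> Pow GT_space" by (auto simp: cyl_def)
  have "E \<in> sigma_sets GT_space ?G" using assms(3) sets_GT_alg by simp
  with Int_stable_cyls G show ?thesis
  proof (induction rule: sigma_sets_induct_disjoint)
    case (basic A)
    then consider "A = {}" | \<gamma> where "A = cyl \<gamma>" by auto
    then show ?case by cases (use measure_graft_vimage_cyl[OF \<alpha> \<beta>] in auto)
  next
    case empty
    then show ?case by simp
  next
    case (compl A)
    then have A: "A \<in> sets GT_alg" by (simp add: sets_GT_alg)
    have "?X (GT_space - A) = cyl \<alpha> - ?X A" using graft_in_cyl[OF \<alpha> \<beta>] by (auto simp: cyl_def)
    then have 1: "measure P (?X (GT_space - A)) = measure P (cyl \<alpha>) - measure P (?X A)"
      using graft_vimage_in_sets[OF \<alpha> \<beta> A] by (simp add: finite_measure_Diff Collect_conj_eq)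
    have "cyl \<beta> \<inter> (GT_space - A) = cyl \<beta> - (cyl \<beta> \<inter> A)" by (auto simp: cyl_def)
    then have 2: "measure P (cyl \<beta> \<inter> (GT_space - A)) = measure P (cyl \<beta>) - measure P (cyl \<beta> \<inter> A)"
      using A by (simp add: finite_measure_Diff)
    show ?case unfolding 1 2
      using compl.IH measure_cyl_proportional[OF \<alpha> \<beta>] by (simp add: right_diff_distrib)
  next
    case (union A)
    then have A: "A i \<in> sets GT_alg" for i by (auto simp: sets_GT_alg)
    have "(\<lambda>i. measure P (cyl \<beta> \<inter> A i)) sums measure P (\<Union>i. cyl \<beta> \<inter> A i)"
      by (rule finite_measure_UNION) (use A union.hyps in \<open>auto simp: disjoint_family_on_def\<close>)
    then have 1: "(\<lambda>i. wpath q \<alpha> * measure P (cyl \<beta> \<inter> A i)) sums (wpath q \<alpha> * measure P (cyl \<beta> \<inter> (\<Union>i. A i)))"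
      by (simp add: sums_mult)
    have "(\<lambda>i. measure P (?X (A i))) sums measure P (\<Union>i. ?X (A i))"
      by (rule finite_measure_UNION)
         (use A union.hyps graft_vimage_in_sets[OF \<alpha> \<beta>] in \<open>auto simp: disjoint_family_on_def\<close>)
    moreover have "(\<Union>i. ?X (A i)) = ?X (\<Union>i. A i)" by auto
    ultimately have "(\<lambda>i. wpath q \<beta> * measure P (?X (A i))) sums (wpath q \<beta> * measure P (?X (\<Union>i. A i)))"
      by (simp add: sums_mult)
    with 1 show ?case unfolding union.IH by (rule sums_unique2)
  qed
qed

lemma tail_sat_in_sets [measurable]: "Z \<in> sets GT_alg \<Longrightarrow> tail_sat d Z \<in> sets GT_alg"
  unfolding tail_sat_eq_UN[OF q]
  by (intro sets.countable_UN'') (auto simp: swaps_def)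

text \<open>Quasi-invariance of \<open>P\<close>: each of the countably many grafts pulls a null set
  back to a null set.\<close>

lemma tail_sat_null:
  assumes "Z \<in> sets P" "measure P Z = 0"
  shows "measure P (tail_sat d Z) = 0"
proof -
  have "{\<omega> \<in> cyl \<alpha>. graft \<beta> \<omega> \<in> Z} \<in> null_sets P" if "(\<alpha>, \<beta>) \<in> swaps q d" for \<alpha> \<beta>
  proof -
    from that obtain lam where *: "\<alpha> \<in> fpaths [] lam" "\<beta> \<in> fpaths [] lam" by (auto simp: swaps_def)
    have "measure P (cyl \<beta> \<inter> Z) = 0"
      using assms finite_measure_mono[of "cyl \<beta> \<inter> Z" Z] by (simp add: measure_le_0_iff)
    then have "measure P {\<omega> \<in> cyl \<alpha>. graft \<beta> \<omega> \<in> Z} = 0"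
      using measure_graft_vimage[OF * assms(1)] wpath_pos[OF q(1), of \<beta>] by simp
    then show ?thesis
      using graft_vimage_in_sets[OF *] assms by (auto simp: null_sets_def emeasure_eq_measure)
  qed
  then have "tail_sat d Z \<in> null_sets P"
    unfolding tail_sat_eq_UN[OF q] by (intro null_sets_UN') auto
  then show ?thesis by (simp add: null_sets_def emeasure_eq_measure)
qed

text \<open>Countably many prefix exchanges suffice to describe an injection that moves every point
  inside its tail class; the index pair is made unique by cutting right after the last change.\<close>

lemma emeasure_image_tail_rel:
  assumes f [measurable]: "\<And>n. (\<lambda>\<omega>. f \<omega> n) \<in> measurable GT_alg (count_space UNIV)"
    and G [measurable]: "G \<in> sets GT_alg" and inj: "inj_on f G"
    and rel: "\<And>\<omega>. \<omega> \<in> G \<Longrightarrow> tail_rel d \<omega> (f \<omega>)"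
  shows "f ` G \<in> sets GT_alg" "emeasure P (f ` G) = ennreal (q powi (2 * d)) * emeasure P G"
proof -
  \<comment> \<open>Prefixes of length 1 are exempt from the condition on the last entry, so that
    fixed points of \<open>f\<close> get a pair as well; \<open>fpaths\<close> excludes length
    0.\<close>
  define I where "I = {(\<alpha>, \<beta>). \<alpha> \<noteq> ([] :: edge list) \<and> length \<beta> = length \<alpha> \<and>
    (length \<alpha> = 1 \<or> \<alpha> ! (length \<alpha> - 1) \<noteq> \<beta> ! (length \<alpha> - 1))}"
  define piece where "piece = (\<lambda>(\<alpha>, \<beta>). {\<omega> \<in> G. (\<forall>n<length \<alpha>. \<omega> n = \<alpha> ! n \<and> f \<omega> n = \<beta> ! n) \<and>
    (\<forall>k\<ge>length \<alpha>. f \<omega> k = \<omega> k)})"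
  have "G \<subseteq> GT_space" using sets.sets_into_space[OF G] by simp
  have disj: "disjoint_family_on piece I"
    unfolding disjoint_family_on_def
  proof (intro ballI impI, rule ccontr)
    fix i j assume ij: "i \<in> I" "j \<in> I" "i \<noteq> j" "piece i \<inter> piece j \<noteq> {}"
    obtain \<alpha> \<beta> \<alpha>' \<beta>' where [simp]: "i = (\<alpha>, \<beta>)" "j = (\<alpha>', \<beta>')" by fastforce
    from ij obtain \<omega> where \<omega>: "\<omega> \<in> piece i" "\<omega> \<in> piece j" by auto
    have "length \<alpha> = length \<alpha>'"
    proof (rule linorder_cases[of "length \<alpha>" "length \<alpha>'"])
      assume "length \<alpha> < length \<alpha>'"
      then have "f \<omega> (length \<alpha>' - 1) = \<omega> (length \<alpha>' - 1)" "length \<alpha>' - 1 < length \<alpha>'" "length \<alpha>' \<noteq> 1"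
        using \<omega>(1) ij(1) by (auto simp: piece_def I_def)
      then show ?thesis using \<omega>(2) ij(2) by (auto simp: piece_def I_def)
    next
      assume "length \<alpha>' < length \<alpha>"
      then have "f \<omega> (length \<alpha> - 1) = \<omega> (length \<alpha> - 1)" "length \<alpha> - 1 < length \<alpha>" "length \<alpha> \<noteq> 1"
        using \<omega>(2) ij(2) by (auto simp: piece_def I_def)
      then show ?thesis using \<omega>(1) ij(1) by (auto simp: piece_def I_def)
    qed
    then have "i = j" using \<omega> ij(1,2)
      by (auto simp: piece_def I_def intro!: nth_equalityI)
    with ij show False by simp
  qed
  have cover: "G = (\<Union>i\<in>I. piece i)"
  proof (intro equalityI subsetI)
    fix \<omega> assume \<omega>: "\<omega> \<in> G"
    define Q where "Q n \<longleftrightarrow> 0 < n \<and> (\<forall>k\<ge>n. f \<omega> k = \<omega> k)" for n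
    from rel[OF \<omega>] obtain N where "\<forall>k\<ge>N. f \<omega> k = \<omega> k" unfolding tail_rel_def by metis
    then have "Q (Suc N)" by (simp add: Q_def)
    define n where "n = (LEAST n. Q n)"
    have n: "Q n" unfolding n_def using \<open>Q (Suc N)\<close> by (rule LeastI)
    have "n = 1 \<or> \<omega> (n - 1) \<noteq> f \<omega> (n - 1)"
    proof (rule ccontr)
      assume a: "\<not> ?thesis"
      have "f \<omega> k = \<omega> k" if "k \<ge> n - 1" for k
        using a n that by (cases "k = n - 1") (auto simp: Q_def)
      then have "Q (n - 1)" using a n by (auto simp: Q_def)
      then have "n \<le> n - 1" unfolding n_def by (rule Least_le)
      with n show False unfolding Q_def by linarith
    qed
    then have "(map \<omega> [0..<n], map (f \<omega>) [0..<n]) \<in> I" using n by (auto simp: I_def Q_def)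
    moreover have "\<omega> \<in> piece (map \<omega> [0..<n], map (f \<omega>) [0..<n])"
      using n \<omega> by (auto simp: piece_def Q_def)
    ultimately show "\<omega> \<in> (\<Union>i\<in>I. piece i)" by blast
  qed (auto simp: piece_def)
  have "countable I" by (rule countableI_type)
  have piece_sets [measurable]: "piece i \<in> sets GT_alg" for i
  proof -
    obtain \<alpha> \<beta> where [simp]: "i = (\<alpha>, \<beta>)" by fastforce
    have "piece i = G \<inter> {\<omega> \<in> space GT_alg. (\<forall>n<length \<alpha>. \<omega> n = \<alpha> ! n \<and> f \<omega> n = \<beta> ! n) \<and>
      (\<forall>k\<ge>length \<alpha>. f \<omega> k = \<omega> k)}"
      using \<open>G \<subseteq> GT_space\<close> by (auto simp: piece_def)
    also have "\<dots> \<in> sets GT_alg" by measurable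
    finally show ?thesis .
  qed
  have img: "f ` piece i \<in> sets GT_alg \<and> emeasure P (f ` piece i) = ennreal (q powi (2 * d)) * emeasure P (piece i)"
    if i: "i \<in> I" for i
  proof (cases "piece i = {}")
    case False
    obtain \<alpha> \<beta> where i_eq: "i = (\<alpha>, \<beta>)" by fastforce
    from False obtain \<omega> where \<omega>: "\<omega> \<in> piece i" by auto
    let ?n = "length \<alpha>" and ?lam = "fst (\<omega> (length \<alpha>))"
    have len: "length \<beta> = ?n" "0 < ?n" using i by (auto simp: I_def i_eq)
    have "\<omega> \<in> G" using \<omega> by (auto simp: piece_def i_eq)
    from rel[OF this] have in_space: "\<omega> \<in> GT_space" "f \<omega> \<in> GT_space" by (auto simp: tail_rel_def)
    have "map \<omega> [0..<?n] = \<alpha>" "map (f \<omega>) [0..<?n] = \<beta>" "f \<omega> ?n = \<omega> ?n"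
      using \<omega> len by (auto simp: piece_def i_eq intro!: nth_equalityI)
    then have \<alpha>: "\<alpha> \<in> fpaths [] ?lam" and \<beta>: "\<beta> \<in> fpaths [] ?lam"
      using fpaths_prefix[OF in_space(1), of ?n] fpaths_prefix[OF in_space(2), of ?n] len by auto
    have piece_cyl: "\<eta> \<in> cyl \<alpha>" if "\<eta> \<in> piece i" for \<eta>
      using that \<open>G \<subseteq> GT_space\<close> by (auto simp: piece_def i_eq cyl_def)
    have f_graft: "f \<eta> = graft \<beta> \<eta>" if "\<eta> \<in> piece i" for \<eta>
      using that len by (auto simp: piece_def i_eq graft_def)
    have w: "wpath q \<beta> = q powi (2 * d) * wpath q \<alpha>"
      using tail_rel_graft_iff[OF q \<alpha> \<beta> piece_cyl[OF \<omega>]] rel[OF \<open>\<omega> \<in> G\<close>] f_graft[OF \<omega>] by simp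
    \<comment> \<open>On a piece \<open>f\<close> is a graft, so its image is the preimage of the
      piece under the reverse graft. This yields both the measurability and the measure of the
      image.\<close>
    have image: "f ` piece i = {\<eta> \<in> cyl \<beta>. graft \<alpha> \<eta> \<in> piece i}"
    proof (intro equalityI subsetI)
      fix \<eta> assume "\<eta> \<in> f ` piece i"
      then obtain \<omega> where "\<omega> \<in> piece i" "\<eta> = graft \<beta> \<omega>" using f_graft by auto
      then show "\<eta> \<in> {\<eta> \<in> cyl \<beta>. graft \<alpha> \<eta> \<in> piece i}"
        using graft_in_cyl[OF \<alpha> \<beta>] graft_graft[OF \<alpha> \<beta>] piece_cyl by simp
    next
      fix \<eta> assume "\<eta> \<in> {\<eta> \<in> cyl \<beta>. graft \<alpha> \<eta> \<in> piece i}"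
      then have "graft \<alpha> \<eta> \<in> piece i" "f (graft \<alpha> \<eta>) = \<eta>"
        using graft_graft[OF \<beta> \<alpha>] f_graft by auto
      then show "\<eta> \<in> f ` piece i" by force
    qed
    have sets: "f ` piece i \<in> sets GT_alg"
      unfolding image using \<alpha> \<beta> by measurable
    have "cyl \<beta> \<inter> f ` piece i = f ` piece i" using image by auto
    moreover have "{\<omega> \<in> cyl \<alpha>. graft \<beta> \<omega> \<in> f ` piece i} = piece i"
      using image graft_in_cyl[OF \<alpha> \<beta>] graft_graft[OF \<alpha> \<beta>] piece_cyl by auto
    ultimately have "wpath q \<alpha> * measure P (f ` piece i) = wpath q \<beta> * measure P (piece i)"
      using measure_graft_vimage[OF \<alpha> \<beta>, of "f ` piece i"] sets by simp
    then have "measure P (f ` piece i) = q powi (2 * d) * measure P (piece i)"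
      using w wpath_pos[OF q(1), of \<alpha>] by simp
    then show ?thesis
      using sets q by (simp add: emeasure_eq_measure ennreal_mult')
  qed simp
  have fG: "f ` G = (\<Union>i\<in>I. f ` piece i)" using cover by auto
  show "f ` G \<in> sets GT_alg"
    unfolding fG using \<open>countable I\<close> img by (intro sets.countable_UN'') auto
  have "disjoint_family_on (\<lambda>i. f ` piece i) I"
    unfolding disjoint_family_on_def
  proof (intro ballI impI)
    fix i j assume ij: "i \<in> I" "j \<in> I" "i \<noteq> j"
    have "piece i \<subseteq> G" "piece j \<subseteq> G" by (auto simp: piece_def split: prod.splits)
    from inj_on_image_Int[OF inj this] show "f ` piece i \<inter> f ` piece j = {}"
      using disj ij by (simp add: disjoint_family_on_def)
  qed
  then have "emeasure P (f ` G) = (\<integral>\<^sup>+i. emeasure P (f ` piece i) \<partial>count_space I)"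
    unfolding fG using \<open>countable I\<close> img by (intro emeasure_UN_countable) auto
  also have "\<dots> = (\<integral>\<^sup>+i. ennreal (q powi (2 * d)) * emeasure P (piece i) \<partial>count_space I)"
    by (intro nn_integral_cong) (use img in simp)
  also have "\<dots> = ennreal (q powi (2 * d)) * (\<integral>\<^sup>+i. emeasure P (piece i) \<partial>count_space I)"
    by (rule nn_integral_cmult) simp
  also have "(\<integral>\<^sup>+i. emeasure P (piece i) \<partial>count_space I) = emeasure P (\<Union>i\<in>I. piece i)"
    using \<open>countable I\<close> disj piece_sets by (intro emeasure_UN_countable[symmetric]) simp_all
  also have "(\<Union>i\<in>I. piece i) = G" by (rule cover[symmetric])
  finally show "emeasure P (f ` G) = ennreal (q powi (2 * d)) * emeasure P G" .
qed

end

section \<open>Approximation by finite-level sets\<close>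

lemma level_set_cyl: "level_set (length \<alpha>) (cyl \<alpha>)"
  by (auto simp: level_set_def cyl_def)

lemma level_set_D:
  assumes "level_set N D" "\<omega> \<in> D" "\<omega>' \<in> GT_space" "\<And>n. n < N \<Longrightarrow> \<omega> n = \<omega>' n"
  shows "\<omega>' \<in> D"
  using assms by (simp add: level_set_def)

lemma level_set_Compl:
  assumes "level_set N D"
  shows "level_set N (GT_space - D)"
  unfolding level_set_def
proof (intro conjI ballI impI)
  fix \<omega> \<omega>' assume "\<omega> \<in> GT_space - D" "\<omega>' \<in> GT_space" "\<forall>n<N. \<omega> n = \<omega>' n"
  then show "\<omega>' \<in> GT_space - D" using level_set_D[OF assms, of \<omega>' \<omega>] by auto
qed simp

lemma level_set_UN:
  assumes "\<And>i. i \<in> I \<Longrightarrow> level_set N (D i)"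
  shows "level_set N (\<Union>i\<in>I. D i)"
  unfolding level_set_def
proof (intro conjI ballI impI)
  show "(\<Union>i\<in>I. D i) \<subseteq> GT_space" using assms by (auto simp: level_set_def)
  fix \<omega> \<omega>' assume "\<omega> \<in> (\<Union>i\<in>I. D i)" "\<omega>' \<in> GT_space" "\<forall>n<N. \<omega> n = \<omega>' n"
  then show "\<omega>' \<in> (\<Union>i\<in>I. D i)" using level_set_D[OF assms, of _ \<omega> \<omega>'] by auto
qed

lemma singleton_in_sets:
  assumes "\<omega> \<in> GT_space"
  shows "{\<omega>} \<in> sets GT_alg"
proof -
  have "{\<omega>} = {\<omega>' \<in> space GT_alg. \<forall>n. \<omega>' n = \<omega> n}" using assms by auto
  also have "\<dots> \<in> sets GT_alg" by measurable
  finally show ?thesis .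
qed

text \<open>The sets approximable in measure by finite-level sets include the cylinders and are
  closed under complements and countable unions. For a union, a remainder of mass below
  \<open>\<epsilon> / 2\<close> is cut off and the finitely many other members are approximated
  separately.\<close>

lemma (in q_central_measure) approx_level_set:
  assumes "A \<in> sets P" "0 < \<epsilon>"
  shows "\<exists>N D. level_set N D \<and> measure P ((A - D) \<union> (D - A)) < \<epsilon>"
proof -
  have "A \<in> sigma_sets GT_space (insert {} {cyl \<alpha> |\<alpha> lam. \<alpha> \<in> fpaths [] lam})"
    using assms(1) sets_GT_alg by simp
  then show ?thesis using assms(2)
  proof (induction arbitrary: \<epsilon>)
    case (Basic a)
    then consider "a = {}" | \<alpha> where "a = cyl \<alpha>" by auto
    then show ?case
    proof cases
      case 1
      then show ?thesis using Basic by (intro exI[of _ 0] exI[of _ "{}"]) (simp add: level_set_def)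
    next
      case 2
      then show ?thesis using Basic level_set_cyl[of \<alpha>]
        by (intro exI[of _ "length \<alpha>"] exI[of _ "cyl \<alpha>"]) simp
    qed
  next
    case Empty
    then show ?case by (intro exI[of _ 0] exI[of _ "{}"]) (simp add: level_set_def)
  next
    case (Compl a)
    from Compl.IH[OF Compl.prems] obtain N D where D: "level_set N D"
      "measure P ((a - D) \<union> (D - a)) < \<epsilon>" by blast
    have "a \<subseteq> GT_space" using Compl.hyps sets.sets_into_space[of a GT_alg] by (simp add: sets_GT_alg)
    moreover have "D \<subseteq> GT_space" using D by (simp add: level_set_def)
    ultimately have "(GT_space - a - (GT_space - D)) \<union> (GT_space - D - (GT_space - a)) = (a - D) \<union> (D - a)"
      by auto
    with D level_set_Compl[OF D(1)] show ?case by metis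
  next
    case (Union a)
    have a: "a i \<in> sets P" for i using Union.hyps by (simp add: sets_GT_alg)
    define B where "B m = (\<Union>i<m. a i)" for m
    have B: "B m \<in> sets P" for m using a by (auto simp: B_def)
    have UB: "(\<Union>m. B m) = (\<Union>i. a i)" by (auto simp: B_def)
    have "(\<lambda>m. measure P (B m)) \<longlonglongrightarrow> measure P (\<Union>m. B m)"
      by (rule finite_Lim_measure_incseq) (use B in \<open>auto simp: B_def incseq_def intro: order.strict_trans2\<close>)
    then have "(\<lambda>m. measure P (B m)) \<longlonglongrightarrow> measure P (\<Union>i. a i)" by (simp only: UB)
    then have "\<forall>\<^sub>F m in sequentially. measure P (\<Union>i. a i) - \<epsilon> / 2 < measure P (B m)"
      using Union.prems by (intro order_tendstoD) auto
    then obtain m where m: "measure P (\<Union>i. a i) - \<epsilon> / 2 < measure P (B m)"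
      by (auto simp: eventually_sequentially)
    have "measure P ((\<Union>i. a i) - B m) = measure P (\<Union>i. a i) - measure P (B m)"
      using a B by (intro finite_measure_Diff) (auto simp: B_def)
    with m have rest: "measure P ((\<Union>i. a i) - B m) < \<epsilon> / 2" by simp
    \<comment> \<open>The \<open>m\<close> errors add up to at most \<open>\<epsilon> / 2\<close>;
      \<open>Suc m\<close> keeps the divisor positive for \<open>m = 0\<close>.\<close>
    define \<delta> where "\<delta> = \<epsilon> / 2 / Suc m"
    have "0 < \<delta>" using Union.prems by (simp add: \<delta>_def)
    then have "\<exists>N D. level_set N D \<and> measure P ((a i - D) \<union> (D - a i)) < \<delta>" for i
      by (rule Union.IH)
    then obtain N D where D: "\<And>i. level_set (N i) (D i)"
      and close: "\<And>i. measure P ((a i - D i) \<union> (D i - a i)) < \<delta>" by metis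
    have D_sets: "D i \<in> sets P" for i using level_set_in_sets[OF D] by simp
    \<comment> \<open>The sum of the levels \<open>N i\<close> bounds each of them and serves as a
      common level.\<close>
    have lev: "level_set (\<Sum>i<m. N i) (\<Union>i<m. D i)"
      by (intro level_set_UN level_set_mono[OF D] member_le_sum) auto
    let ?S = "\<lambda>i. (a i - D i) \<union> (D i - a i)"
    have "((\<Union>i. a i) - (\<Union>i<m. D i)) \<union> ((\<Union>i<m. D i) - (\<Union>i. a i)) \<subseteq>
        ((\<Union>i. a i) - B m) \<union> (\<Union>i<m. ?S i)"
      by (auto simp: B_def)
    then have "measure P (((\<Union>i. a i) - (\<Union>i<m. D i)) \<union> ((\<Union>i<m. D i) - (\<Union>i. a i))) \<le>
        measure P (((\<Union>i. a i) - B m) \<union> (\<Union>i<m. ?S i))"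
      using a B D_sets by (intro finite_measure_mono) auto
    also have "\<dots> \<le> measure P ((\<Union>i. a i) - B m) + measure P (\<Union>i<m. ?S i)"
      using a B D_sets by (intro measure_Un_le) auto
    also have "measure P (\<Union>i<m. ?S i) \<le> (\<Sum>i<m. measure P (?S i))"
      using a D_sets by (intro finite_measure_subadditive_finite) auto
    also have "\<dots> \<le> (\<Sum>i<m. \<delta>)" using close by (intro sum_mono) (simp add: less_imp_le)
    also have "\<dots> \<le> \<epsilon> / 2" using Union.prems by (simp add: \<delta>_def field_simps)
    finally show ?case using rest lev by (intro exI conjI) auto
  qed
qed

section \<open>The ratio set and sets without pairs of prescribed ratio\<close>

text \<open>Sets that testify against the ratio \<open>q powi (2 * d)\<close>. If all measurable
  ones are null, the ratio belongs to the ratio set (\<open>powi_in_ratio_set\<close>), so the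
  question no longer involves transformations of the full group.\<close>

definition pair_free :: "int \<Rightarrow> (nat \<Rightarrow> edge) set \<Rightarrow> bool" where
  "pair_free d A \<longleftrightarrow> (\<forall>\<omega>\<in>A. \<forall>\<omega>'\<in>A. \<not> tail_rel d \<omega> \<omega>')"

lemma pair_free_uminus: "pair_free (- d) A \<longleftrightarrow> pair_free d A"
  unfolding pair_free_def using tail_rel_sym by (metis minus_minus)

text \<open>With pair-free sets known to be null, this says that almost every point of
  \<open>A\<close> has a partner of exponent \<open>d\<close> inside \<open>A\<close>.\<close>

lemma pair_free_Diff_tail_sat: "pair_free d (A - tail_sat d A)"
  by (auto simp: pair_free_def tail_sat_def)

lemma SymN_tail:
  assumes "g \<in> SymN N" "k \<ge> N"
  shows "g \<omega> k = \<omega> k"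
  using assms(1)
proof (induction)
  case (comp g h)
  from comp.hyps(1) have "g \<omega>' k = \<omega>' k" for \<omega>'
    using assms(2) by (auto simp: gens_def gen_trans_def)
  with comp.IH show ?case by simp
qed simp

lemma full_group_tail_rel:
  assumes "\<gamma> \<in> full_group" "\<omega> \<in> GT_space"
  obtains d where "tail_rel d \<omega> (\<gamma> \<omega>)"
proof -
  from assms obtain \<gamma>0 where \<gamma>0: "\<gamma>0 \<in> Sym" "\<gamma> \<omega> = \<gamma>0 \<omega>"
    unfolding full_group_def by blast
  then obtain N where "\<gamma>0 \<in> SymN N" by (auto simp: Sym_def)
  from SymN_tail[OF this] \<gamma>0(2) have "\<forall>k\<ge>N. \<omega> k = \<gamma> \<omega> k" by simp
  moreover have "\<gamma> \<omega> \<in> GT_space"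
    using assms by (auto simp: full_group_def dest: bij_betwE)
  ultimately have "tail_rel (level_sum (\<gamma> \<omega>) N - level_sum \<omega> N) \<omega> (\<gamma> \<omega>)"
    using assms(2) by (auto simp: tail_rel_def)
  then show thesis by (rule that)
qed

lemma measurable_level_sum [measurable (raw)]:
  assumes f: "f \<in> measurable M GT_alg"
  shows "(\<lambda>x. level_sum (f x) N) \<in> measurable M (count_space UNIV)"
proof (induction N)
  case (Suc N)
  have edge: "(\<lambda>x. f x N) \<in> measurable M (count_space UNIV)"
    using measurable_compose[OF f measurable_edge] .
  have "(\<lambda>x. (\<lambda>i x. i + sumsig (fst (f x N))) (level_sum (f x) N) x) \<in> measurable M (count_space UNIV)"
    by (rule measurable_compose_countable[OF _ Suc], rule measurable_compose[OF edge])
       (rule measurable_count_space)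
  then show ?case by (simp add: level_sum_def)
qed (simp add: level_sum_def)

lemma tail_rel_in_sets:
  assumes f [measurable]: "f \<in> measurable GT_alg GT_alg"
  shows "{\<omega> \<in> GT_space. tail_rel d \<omega> (f \<omega>)} \<in> sets GT_alg"
proof -
  have [measurable]: "(\<lambda>x. f x k) \<in> measurable GT_alg (count_space UNIV)" for k
    using measurable_compose[OF f measurable_edge] .
  have "f \<omega> \<in> GT_space" if "\<omega> \<in> GT_space" for \<omega>
    using measurable_space[OF f] that by simp
  then have "{\<omega> \<in> GT_space. tail_rel d \<omega> (f \<omega>)} =
      {\<omega> \<in> space GT_alg. \<exists>N. (\<forall>k\<ge>N. \<omega> k = f \<omega> k) \<and> level_sum (f \<omega>) N = d + level_sum \<omega> N}"
    by (auto simp: tail_rel_def algebra_simps)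
  also have "\<dots> = (\<Union>N i. {\<omega> \<in> space GT_alg. (\<forall>k\<ge>N. \<omega> k = f \<omega> k) \<and>
      level_sum (f \<omega>) N = d + i \<and> level_sum \<omega> N = i})"
    by auto
  also have "\<dots> \<in> sets GT_alg"
    by measurable
  finally show ?thesis .
qed

text \<open>Completes the graft to an involution. On \<open>GT_space\<close> it acts as the
  generator that belongs to the transposition of \<open>\<alpha>\<close> and \<open>\<beta>\<close>,
  so it lies in the full group.\<close>

definition swap_prefix :: "edge list \<Rightarrow> edge list \<Rightarrow> (nat \<Rightarrow> edge) \<Rightarrow> nat \<Rightarrow> edge" where
  "swap_prefix \<alpha> \<beta> \<omega> = (if \<omega> \<in> cyl \<alpha> then graft \<beta> \<omega> else if \<omega> \<in> cyl \<beta> then graft \<alpha> \<omega> else \<omega>)"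

lemma swap_prefix_in_full_group:
  assumes \<alpha>: "\<alpha> \<in> fpaths [] lam" and \<beta>: "\<beta> \<in> fpaths [] lam"
  shows "swap_prefix \<alpha> \<beta> \<in> full_group"
proof -
  let ?s = "swap_prefix \<alpha> \<beta>" and ?N = "length lam"
  have len: "length \<alpha> = ?N" "length \<beta> = ?N" "0 < ?N" using \<alpha> \<beta> fpaths_length by auto
  have space: "?s \<omega> \<in> GT_space" if "\<omega> \<in> GT_space" for \<omega>
    using that graft_in_cyl[OF \<alpha> \<beta>, of \<omega>] graft_in_cyl[OF \<beta> \<alpha>, of \<omega>]
    by (auto simp: swap_prefix_def cyl_def)
  \<comment> \<open>Prefixes of equal length with a common extension coincide, so the branches of
    \<open>swap_prefix\<close> overlap only where the exchange is trivial.\<close>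
  have eq: "\<alpha> = \<beta>" if "\<omega> \<in> cyl \<alpha>" "\<omega> \<in> cyl \<beta>" for \<omega>
    using cyl_prefix_eq[OF that(1)] cyl_prefix_eq[OF that(2)] len by simp
  have invol: "?s (?s \<omega>) = \<omega>" for \<omega>
    using graft_in_cyl[OF \<alpha> \<beta>, of \<omega>] graft_in_cyl[OF \<beta> \<alpha>, of \<omega>]
      graft_graft[OF \<alpha> \<beta>, of \<omega>] graft_graft[OF \<beta> \<alpha>, of \<omega>] eq
    by (auto simp: swap_prefix_def)
  have meas: "?s \<in> measurable GT_alg GT_alg"
  proof (rule measurable_GT_algI)
    show "?s \<omega> \<in> GT_space" if "\<omega> \<in> space GT_alg" for \<omega> using that space by simp
    show "(\<lambda>\<omega>. ?s \<omega> n) \<in> measurable GT_alg (count_space UNIV)" for n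
      unfolding swap_prefix_def graft_def if_distribR by measurable
  qed
  have bij: "bij_betw ?s GT_space GT_space"
    by (rule bij_betw_byWitness[where f' = ?s]) (use space invol in auto)
  have "the_inv_into GT_space ?s \<omega> = ?s \<omega>" if "\<omega> \<in> GT_space" for \<omega>
    using bij that space invol by (intro the_inv_into_f_eq) (auto simp: bij_betw_def)
  then have inv: "the_inv_into GT_space ?s \<in> measurable GT_alg GT_alg"
    using meas by (subst measurable_cong[where g = ?s]) auto
  have "\<exists>\<gamma>0\<in>Sym. ?s \<omega> = \<gamma>0 \<omega>" if \<omega>: "\<omega> \<in> GT_space" for \<omega>
  proof -
    let ?g = "gen_trans ?N lam (Transposition.transpose \<alpha> \<beta>)"
    obtain \<eta> where \<eta>: "\<eta> \<in> cyl \<alpha>" using fpaths_in_prefix[OF \<alpha>] .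
    then have "fst (\<eta> ?N) = lam" "\<eta> \<in> GT_space" using cyl_end[OF \<alpha>] by (auto simp: cyl_def)
    then have "lam \<in> Sign ?N" using GT_space_is_edge[of \<eta> ?N] by (simp add: is_edge_def)
    moreover have "Transposition.transpose \<alpha> \<beta> permutes fpaths [] lam" using \<alpha> \<beta> by (rule permutes_swap_id)
    ultimately have "?g \<in> gens ?N" using len unfolding gens_def
      by (auto intro!: exI[of _ lam] exI[of _ "Transposition.transpose \<alpha> \<beta>"] simp: Suc_le_eq)
    then have "?g \<circ> id \<in> SymN ?N" by (intro SymN.intros)
    then have "?g \<in> Sym" by (auto simp: Sym_def)
    moreover have "?s \<omega> = ?g \<omega>"
    proof -
      have "map \<omega> [0..<?N] = \<delta> \<longleftrightarrow> \<omega> \<in> cyl \<delta>" if "length \<delta> = ?N" for \<delta>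
        using \<omega> that cyl_prefix_eq[of \<omega> \<delta>] in_cyl_prefix_iff[of \<omega> \<omega> ?N] by metis
      then have pre: "map \<omega> [0..<?N] = \<alpha> \<longleftrightarrow> \<omega> \<in> cyl \<alpha>" "map \<omega> [0..<?N] = \<beta> \<longleftrightarrow> \<omega> \<in> cyl \<beta>"
        using len by blast+
      show ?thesis
      proof (cases "\<omega> \<in> cyl \<alpha> \<or> \<omega> \<in> cyl \<beta>")
        case True
        then show ?thesis using pre \<alpha> \<beta> len eq
          by (auto simp: swap_prefix_def gen_trans_def graft_def)
      next
        case False
        then have "Transposition.transpose \<alpha> \<beta> (map \<omega> [0..<?N]) = map \<omega> [0..<?N]"
          using pre by (simp add: transpose_apply_other)
        with False show ?thesis by (auto simp: swap_prefix_def gen_trans_def)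
      qed
    qed
    ultimately show ?thesis by blast
  qed
  with meas bij inv show ?thesis by (simp add: full_group_def)
qed

section \<open>From null pair-free sets to the ratio set\<close>

context q_central_measure
begin

lemma null_if_pair_free_0: "pair_free 0 A \<Longrightarrow> A \<in> sets P \<Longrightarrow> measure P A = 0"
  using tail_rel_refl sets.sets_into_space[of A P]
  by (cases "A = {}") (force simp: pair_free_def)+

text \<open>Almost every point of \<open>A\<close> has a partner of exponent \<open>d\<close> in
  \<open>A\<close>. The partners without a further partner of exponent \<open>e\<close> lie in the
  null set \<open>?E\<close>, and by quasi-invariance the points related to \<open>?E\<close> are
  negligible too. Any other point would start a chain of total exponent \<open>d + e\<close> inside
  \<open>A\<close>.\<close>

lemma null_if_pair_free_add:
  assumes d: "\<And>A. A \<in> sets P \<Longrightarrow> pair_free d A \<Longrightarrow> measure P A = 0"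
    and e: "\<And>A. A \<in> sets P \<Longrightarrow> pair_free e A \<Longrightarrow> measure P A = 0"
    and A: "A \<in> sets P" "pair_free (d + e) A"
  shows "measure P A = 0"
proof -
  let ?D = "A - tail_sat d A" and ?E = "A - tail_sat e A"
  have D: "measure P ?D = 0" using A by (intro d pair_free_Diff_tail_sat) auto
  have E: "measure P ?E = 0" using A by (intro e pair_free_Diff_tail_sat) auto
  have sat: "measure P (tail_sat d ?E) = 0" using A E by (intro tail_sat_null) auto
  have "A \<subseteq> ?D \<union> tail_sat d ?E"
  proof
    fix \<omega> assume \<omega>: "\<omega> \<in> A"
    show "\<omega> \<in> ?D \<union> tail_sat d ?E"
    proof (cases "\<omega> \<in> ?D")
      case False
      with \<omega> obtain \<omega>' where \<omega>': "\<omega>' \<in> A" "tail_rel d \<omega> \<omega>'" by (auto simp: tail_sat_def)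
      have "\<omega>' \<notin> tail_sat e A"
      proof
        assume "\<omega>' \<in> tail_sat e A"
        then obtain \<omega>'' where "\<omega>'' \<in> A" "tail_rel e \<omega>' \<omega>''" by (auto simp: tail_sat_def)
        with \<omega> \<omega>' A(2) tail_rel_trans show False unfolding pair_free_def by blast
      qed
      with \<omega>' show ?thesis by (auto simp: tail_sat_def)
    qed simp
  qed
  then have "measure P A \<le> measure P (?D \<union> tail_sat d ?E)"
    using A by (intro finite_measure_mono) auto
  also have "\<dots> \<le> measure P ?D + measure P (tail_sat d ?E)"
    using A by (intro measure_Un_le) auto
  finally show ?thesis using D sat measure_nonneg[of P A] by simp
qed

lemma null_if_pair_free_multiple:
  assumes 1: "\<And>A. A \<in> sets P \<Longrightarrow> pair_free 1 A \<Longrightarrow> measure P A = 0"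
  shows "A \<in> sets P \<Longrightarrow> pair_free d A \<Longrightarrow> measure P A = 0"
proof -
  have nat: "measure P A = 0" if "A \<in> sets P" "pair_free (int n) A" for n A
    using that
  proof (induction n arbitrary: A)
    case 0
    then show ?case using null_if_pair_free_0 by simp
  next
    case (Suc n)
    show ?case
      by (rule null_if_pair_free_add[of 1 "int n"]) (use 1 Suc in \<open>auto simp: add.commute\<close>)
  qed
  assume A: "A \<in> sets P" "pair_free d A"
  show ?thesis
  proof (cases "0 \<le> d")
    case True
    then show ?thesis using nat[of A "nat d"] A by simp
  next
    case False
    then show ?thesis using nat[of A "nat (- d)"] A by (simp add: pair_free_uminus)
  qed
qed

lemma emeasure_distr_the_inv:
  assumes "\<gamma> \<in> full_group" "E \<in> sets P"
  shows "\<gamma> ` E \<in> sets P" "emeasure (distr P P (the_inv_into GT_space \<gamma>)) E = emeasure P (\<gamma> ` E)"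
proof -
  let ?g = "the_inv_into GT_space \<gamma>"
  from assms(1) have meas: "?g \<in> measurable GT_alg GT_alg" and bij: "bij_betw \<gamma> GT_space GT_space"
    by (auto simp: full_group_def)
  have "E \<subseteq> GT_space" using sets.sets_into_space[OF assms(2)] by simp
  then have eq: "?g -` E \<inter> GT_space = \<gamma> ` E"
    using bij by (force simp: bij_betw_def the_inv_into_f_f f_the_inv_into_f)
  from measurable_sets[OF meas, of E] assms(2) eq show "\<gamma> ` E \<in> sets P" by simp
  show "emeasure (distr P P ?g) E = emeasure P (\<gamma> ` E)"
    using meas assms(2) eq by (subst emeasure_distr) auto
qed

text \<open>The image of a null set is covered by its countably many saturations, which gives
  absolute continuity. On measurable subsets of \<open>G\<close> the map scales the measure by a
  constant, so the derivative and that constant have the same integrals there and agree almost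
  everywhere.\<close>

lemma AE_RN_comp_eq:
  assumes \<gamma>: "\<gamma> \<in> full_group" and G [measurable]: "G \<in> sets P"
    and rel: "\<And>\<omega>. \<omega> \<in> G \<Longrightarrow> tail_rel d \<omega> (\<gamma> \<omega>)"
  shows "AE \<omega> in P. \<omega> \<in> G \<longrightarrow> RN_comp P \<gamma> \<omega> = q powi (2 * d)"
proof -
  define N where "N = distr P P (the_inv_into GT_space \<gamma>)"
  let ?f = "RN_deriv P N" and ?c = "ennreal (q powi (2 * d))"
  from \<gamma> have meas: "\<gamma> \<in> measurable GT_alg GT_alg" and bij: "bij_betw \<gamma> GT_space GT_space"
    by (auto simp: full_group_def)
  have edges: "(\<lambda>\<omega>. \<gamma> \<omega> n) \<in> measurable GT_alg (count_space UNIV)" for n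
    using measurable_compose[OF meas measurable_edge] .
  have "absolutely_continuous P N"
    unfolding absolutely_continuous_def
  proof
    fix E assume E: "E \<in> null_sets P"
    then have "E \<subseteq> GT_space" "E \<in> sets P" "measure P E = 0"
      using sets.sets_into_space[of E P] by (auto simp: null_sets_def emeasure_eq_measure)
    have "\<gamma> ` E \<subseteq> (\<Union>d. tail_sat d E)"
    proof
      fix \<omega>' assume "\<omega>' \<in> \<gamma> ` E"
      then obtain \<omega> where \<omega>: "\<omega> \<in> E" "\<omega>' = \<gamma> \<omega>" by auto
      then obtain d where "tail_rel d \<omega> \<omega>'" using full_group_tail_rel[OF \<gamma>, of \<omega>] \<open>E \<subseteq> GT_space\<close> by auto
      then have "tail_rel (- d) \<omega>' \<omega>" by (rule tail_rel_sym)
      with \<omega> show "\<omega>' \<in> (\<Union>d. tail_sat d E)" by (auto simp: tail_sat_def)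
    qed
    moreover have "(\<Union>d. tail_sat d E) \<in> null_sets P"
    proof (rule null_sets_UN')
      show "countable (UNIV :: int set)" by simp
      show "tail_sat d E \<in> null_sets P" for d
        using tail_sat_null[of E d] \<open>E \<in> sets P\<close> \<open>measure P E = 0\<close> tail_sat_in_sets[of E d]
        by (auto simp: null_sets_def emeasure_eq_measure)
    qed
    ultimately have "\<gamma> ` E \<in> null_sets P"
      using emeasure_distr_the_inv(1)[OF \<gamma> \<open>E \<in> sets P\<close>] null_sets_subset by blast
    then show "E \<in> null_sets N"
      using emeasure_distr_the_inv(2)[OF \<gamma> \<open>E \<in> sets P\<close>] \<open>E \<in> sets P\<close>
      by (auto simp: N_def null_sets_def)
  qed
  then have dens: "density P ?f = N"
    by (rule density_RN_deriv) (simp add: N_def)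
  have [measurable]: "?f \<in> borel_measurable P" by (rule borel_measurable_RN_deriv)
  have "AE \<omega> in P. ?f \<omega> * indicator G \<omega> = ?c * indicator G \<omega>"
  proof (rule density_unique_finite_measure)
    fix A assume A [measurable]: "A \<in> sets P"
    have inj: "inj_on \<gamma> (G \<inter> A)"
      using bij sets.sets_into_space[OF A] by (auto simp: bij_betw_def intro: inj_on_subset)
    have GA [measurable]: "G \<inter> A \<in> sets P" "G \<inter> A \<in> sets GT_alg" using G A by auto
    have "(\<integral>\<^sup>+x. ?f x * indicator G x * indicator A x \<partial>P) = (\<integral>\<^sup>+x. ?f x * indicator (G \<inter> A) x \<partial>P)"
      by (intro nn_integral_cong) (auto split: split_indicator)
    also have "\<dots> = emeasure N (G \<inter> A)" by (subst dens[symmetric], subst emeasure_density) auto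
    also have "\<dots> = emeasure P (\<gamma> ` (G \<inter> A))"
      unfolding N_def by (rule emeasure_distr_the_inv[OF \<gamma> GA(1)])
    also have "\<dots> = ?c * emeasure P (G \<inter> A)"
      by (rule emeasure_image_tail_rel(2)[OF edges GA(2) inj]) (use rel in auto)
    also have "\<dots> = (\<integral>\<^sup>+x. ?c * indicator (G \<inter> A) x \<partial>P)" by (simp add: nn_integral_cmult)
    also have "\<dots> = (\<integral>\<^sup>+x. ?c * indicator G x * indicator A x \<partial>P)"
      by (intro nn_integral_cong) (auto split: split_indicator)
    finally show "(\<integral>\<^sup>+x. ?f x * indicator G x * indicator A x \<partial>P) =
      (\<integral>\<^sup>+x. ?c * indicator G x * indicator A x \<partial>P)" .
  qed auto
  then show ?thesis
    by eventually_elim (use q in \<open>auto simp: RN_comp_def N_def[symmetric] split: split_indicator\<close>)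
qed

text \<open>Almost all of \<open>A\<close> lies in \<open>tail_sat d A\<close>, a countable union
  over prefix exchanges, so a single exchange keeps a set of positive measure within
  \<open>A\<close>. On its domain the derivative equals \<open>q powi (2 * d)\<close> exactly,
  whatever \<open>\<epsilon>\<close> is.\<close>

lemma powi_in_ratio_set:
  assumes null: "\<And>A. A \<in> sets P \<Longrightarrow> pair_free d A \<Longrightarrow> measure P A = 0"
  shows "q powi (2 * d) \<in> ratio_set P"
  unfolding ratio_set_def
proof (intro CollectI conjI allI impI ballI)
  show "0 \<le> q powi (2 * d)" using q by simp
  fix \<epsilon> :: real and A assume \<epsilon>: "0 < \<epsilon>" and A [measurable]: "A \<in> sets P" and pos: "0 < measure P A"
  have "\<exists>(\<alpha>, \<beta>)\<in>swaps q d. 0 < measure P (A \<inter> {\<omega> \<in> cyl \<alpha>. graft \<beta> \<omega> \<in> A})"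
  proof (rule ccontr)
    assume no: "\<not> ?thesis"
    have "A \<inter> {\<omega> \<in> cyl \<alpha>. graft \<beta> \<omega> \<in> A} \<in> null_sets P" if "(\<alpha>, \<beta>) \<in> swaps q d" for \<alpha> \<beta>
    proof -
      have "measure P (A \<inter> {\<omega> \<in> cyl \<alpha>. graft \<beta> \<omega> \<in> A}) = 0"
        using no that by (auto simp: not_less measure_le_0_iff)
      moreover have "A \<inter> {\<omega> \<in> cyl \<alpha>. graft \<beta> \<omega> \<in> A} \<in> sets P"
        using that A graft_vimage_in_sets[of \<alpha> _ \<beta> A] by (auto simp: swaps_def)
      ultimately show ?thesis by (simp add: null_sets_def emeasure_eq_measure)
    qed
    then have "(\<Union>(\<alpha>, \<beta>)\<in>swaps q d. A \<inter> {\<omega> \<in> cyl \<alpha>. graft \<beta> \<omega> \<in> A}) \<in> null_sets P"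
      by (intro null_sets_UN') auto
    moreover have "(\<Union>(\<alpha>, \<beta>)\<in>swaps q d. A \<inter> {\<omega> \<in> cyl \<alpha>. graft \<beta> \<omega> \<in> A}) = A \<inter> tail_sat d A"
      unfolding tail_sat_eq_UN[OF q] by auto
    ultimately have "measure P (A \<inter> tail_sat d A) = 0" by (simp add: null_sets_def emeasure_eq_measure)
    moreover have "measure P (A - tail_sat d A) = 0"
      by (rule null) (use A in \<open>auto intro: pair_free_Diff_tail_sat\<close>)
    moreover have "measure P A = measure P (A \<inter> tail_sat d A) + measure P (A - tail_sat d A)"
      using finite_measure_Union[of "A \<inter> tail_sat d A" "A - tail_sat d A"] A tail_sat_in_sets[of A d]
      by (simp add: Int_Diff_Un Int_Diff_disjoint)
    ultimately show False using pos by simp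
  qed
  then obtain \<alpha> \<beta> where sw: "(\<alpha>, \<beta>) \<in> swaps q d"
    and B: "0 < measure P (A \<inter> {\<omega> \<in> cyl \<alpha>. graft \<beta> \<omega> \<in> A})" by auto
  let ?B = "A \<inter> {\<omega> \<in> cyl \<alpha>. graft \<beta> \<omega> \<in> A}" and ?s = "swap_prefix \<alpha> \<beta>"
  from sw obtain lam where \<alpha>: "\<alpha> \<in> fpaths [] lam" and \<beta>: "\<beta> \<in> fpaths [] lam"
    and w: "wpath q \<beta> = q powi (2 * d) * wpath q \<alpha>" by (auto simp: swaps_def)
  have full: "?s \<in> full_group" using swap_prefix_in_full_group[OF \<alpha> \<beta>] .
  have "tail_rel d \<omega> (?s \<omega>)" if "\<omega> \<in> cyl \<alpha>" for \<omega>
    using tail_rel_graft_iff[OF q \<alpha> \<beta> that] w that by (simp add: swap_prefix_def)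
  from AE_RN_comp_eq[OF full _ this] have "AE \<omega> in P. \<omega> \<in> cyl \<alpha> \<longrightarrow> RN_comp P ?s \<omega> = q powi (2 * d)"
    by simp
  then have "AE \<omega> in P. \<omega> \<in> ?B \<longrightarrow> \<bar>RN_comp P ?s \<omega> - q powi (2 * d)\<bar> < \<epsilon>"
    by eventually_elim (use \<epsilon> in auto)
  moreover have "?B \<in> sets P" using graft_vimage_in_sets[OF \<alpha> \<beta>, of A] A by auto
  moreover have "?s ` ?B \<subseteq> A" by (auto simp: swap_prefix_def)
  ultimately show "\<exists>B\<in>sets P. \<exists>\<gamma>\<in>full_group. 0 < measure P B \<and> B \<subseteq> A \<and> \<gamma> ` B \<subseteq> A \<and>
      (AE \<omega> in P. \<omega> \<in> B \<longrightarrow> \<bar>RN_comp P \<gamma> \<omega> - q powi (2 * d)\<bar> < \<epsilon>)"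
    using full B by (intro bexI[of _ ?B] bexI[of _ ?s]) auto
qed

text \<open>Used to obtain the value 0, a limit of ratios but not itself the ratio of an
  exchange.\<close>

lemma ratio_set_closed:
  assumes "0 \<le> r" and "\<And>\<epsilon>. 0 < \<epsilon> \<Longrightarrow> \<exists>s\<in>ratio_set P. \<bar>s - r\<bar> < \<epsilon>"
  shows "r \<in> ratio_set P"
  unfolding ratio_set_def
proof (intro CollectI conjI allI impI ballI)
  fix \<epsilon> :: real and A assume \<epsilon>: "0 < \<epsilon>" and A: "A \<in> sets P" "0 < measure P A"
  from assms(2)[of "\<epsilon> / 2"] \<epsilon> obtain s where s: "s \<in> ratio_set P" "\<bar>s - r\<bar> < \<epsilon> / 2" by auto
  from s(1) \<epsilon> A obtain B \<gamma> where B: "B \<in> sets P" "\<gamma> \<in> full_group" "0 < measure P B" "B \<subseteq> A" "\<gamma> ` B \<subseteq> A"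
    and AE: "AE \<omega> in P. \<omega> \<in> B \<longrightarrow> \<bar>RN_comp P \<gamma> \<omega> - s\<bar> < \<epsilon> / 2"
    unfolding ratio_set_def by (auto dest!: spec[of _ "\<epsilon> / 2"])
  from AE have "AE \<omega> in P. \<omega> \<in> B \<longrightarrow> \<bar>RN_comp P \<gamma> \<omega> - r\<bar> < \<epsilon>"
  proof eventually_elim
    case (elim \<omega>)
    then show ?case using s(2) abs_triangle_ineq[of "RN_comp P \<gamma> \<omega> - s" "s - r"] by auto
  qed
  with B show "\<exists>B\<in>sets P. \<exists>\<gamma>\<in>full_group. 0 < measure P B \<and> B \<subseteq> A \<and> \<gamma> ` B \<subseteq> A \<and>
      (AE \<omega> in P. \<omega> \<in> B \<longrightarrow> \<bar>RN_comp P \<gamma> \<omega> - r\<bar> < \<epsilon>)" by blast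
qed (fact assms(1))

text \<open>A member of the full group splits the space into countably many sets by its exponent
  \<open>d\<close>, and there the derivative is \<open>q powi (2 * d)\<close>. A positive
  \<open>r\<close> that is no such power keeps a positive distance from all these values.\<close>

lemma ratio_set_subset: "ratio_set P \<subseteq> {q powi (2 * n) | n. True} \<union> {0}"
proof
  fix r assume r: "r \<in> ratio_set P"
  show "r \<in> {q powi (2 * n) | n. True} \<union> {0}"
  proof (rule ccontr)
    assume not: "r \<notin> {q powi (2 * n) | n. True} \<union> {0}"
    with r have "0 < r" by (auto simp: ratio_set_def less_le)
    \<comment> \<open>This places \<open>r\<close> between the powers with exponents
      \<open>2 * (m + 1)\<close> and \<open>2 * m\<close>; the base is below 1, so the larger
      exponent gives the lower bound.\<close>
    define m where "m = \<lfloor>log (q\<^sup>2) r\<rfloor>"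
    have q2: "0 < q\<^sup>2" "q\<^sup>2 < 1" using q by (auto simp: power_less_one_iff)
    have pw: "q powi (2 * n) = (q\<^sup>2) powr real_of_int n" for n :: int
      using q by (simp add: powr_real_of_int' power_int_mult power2_eq_square)
    have "r = (q\<^sup>2) powr (log (q\<^sup>2) r)" using q2 \<open>0 < r\<close> by simp
    then have lower: "q powi (2 * (m + 1)) \<le> r" and upper: "r \<le> q powi (2 * m)"
      unfolding pw using q2
      by (metis m_def floor_correct less_imp_le powr_mono', metis m_def of_int_floor_le powr_mono' less_imp_le)
    define \<epsilon> where "\<epsilon> = min (r - q powi (2 * (m + 1))) (q powi (2 * m) - r)"
    have "q powi (2 * n) \<noteq> r" for n using not by blast
    from this[of "m + 1"] this[of m] lower upper have \<epsilon>: "0 < \<epsilon>" by (simp add: \<epsilon>_def)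
    have far: "\<epsilon> \<le> \<bar>q powi (2 * n) - r\<bar>" for n
    proof (cases "n \<le> m")
      case True
      then have "q powi (2 * m) \<le> q powi (2 * n)" using q by (intro power_int_decreasing) auto
      then show ?thesis by (simp add: \<epsilon>_def)
    next
      case False
      then have "q powi (2 * n) \<le> q powi (2 * (m + 1))" using q by (intro power_int_decreasing) auto
      then show ?thesis by (simp add: \<epsilon>_def)
    qed
    \<comment> \<open>It suffices to test membership with the whole space in the role of
      \<open>A\<close>.\<close>
    have "\<exists>B\<in>sets P. \<exists>\<gamma>\<in>full_group. 0 < measure P B \<and> B \<subseteq> GT_space \<and> \<gamma> ` B \<subseteq> GT_space \<and>
      (AE \<omega> in P. \<omega> \<in> B \<longrightarrow> \<bar>RN_comp P \<gamma> \<omega> - r\<bar> < \<epsilon>)"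
      using r \<epsilon> sets.top[of P] prob_space unfolding ratio_set_def by auto
    then obtain B \<gamma> where B: "B \<in> sets P" "0 < measure P B" and \<gamma>: "\<gamma> \<in> full_group"
      and AE: "AE \<omega> in P. \<omega> \<in> B \<longrightarrow> \<bar>RN_comp P \<gamma> \<omega> - r\<bar> < \<epsilon>" by blast
    have "\<gamma> \<in> measurable GT_alg GT_alg" using \<gamma> by (simp add: full_group_def)
    from tail_rel_in_sets[OF this] have "AE \<omega> in P. \<omega> \<in> {\<omega> \<in> GT_space. tail_rel d \<omega> (\<gamma> \<omega>)} \<longrightarrow>
        RN_comp P \<gamma> \<omega> = q powi (2 * d)" for d
      by (intro AE_RN_comp_eq[OF \<gamma>]) auto
    then have "AE \<omega> in P. \<forall>d. \<omega> \<in> {\<omega> \<in> GT_space. tail_rel d \<omega> (\<gamma> \<omega>)} \<longrightarrow>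
        RN_comp P \<gamma> \<omega> = q powi (2 * d)"
      by (subst AE_all_countable) auto
    with AE AE_space have "AE \<omega> in P. \<omega> \<notin> B"
    proof eventually_elim
      case (elim \<omega>)
      then obtain d where "tail_rel d \<omega> (\<gamma> \<omega>)" using full_group_tail_rel[OF \<gamma>, of \<omega>] by auto
      with elim have "RN_comp P \<gamma> \<omega> = q powi (2 * d)" by auto
      with far[of d] elim show ?case by auto
    qed
    then have "measure P B = 0" using B(1) by (simp add: AE_iff_measurable[OF B(1)] measure_eq_0_null_sets prob_eq_0)
    with B show False by simp
  qed
qed

lemma ratio_set_eq:
  assumes "\<And>A. A \<in> sets P \<Longrightarrow> pair_free 1 A \<Longrightarrow> measure P A = 0"
  shows "ratio_set P = {q powi (2 * n) | n. True} \<union> {0}"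
proof (rule antisym[OF ratio_set_subset])
  have powi: "q powi (2 * n) \<in> ratio_set P" for n
    by (rule powi_in_ratio_set) (rule null_if_pair_free_multiple[OF assms])
  have "0 \<in> ratio_set P"
  proof (rule ratio_set_closed)
    fix \<epsilon> :: real assume "0 < \<epsilon>"
    then obtain n where n: "q ^ n < \<epsilon>" using q real_arch_pow_inv by blast
    have "q powi (2 * int n) \<le> q powi int n" using q by (intro power_int_decreasing) auto
    then have "\<bar>q powi (2 * int n) - 0\<bar> < \<epsilon>" using n q by (simp only: power_int_of_nat) simp
    then show "\<exists>s\<in>ratio_set P. \<bar>s - 0\<bar> < \<epsilon>" using powi by blast
  qed simp
  with powi show "{q powi (2 * n) | n. True} \<union> {0} \<subseteq> ratio_set P" by auto
qed

end

section \<open>Stabilisation of the lowest coordinates\<close>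

locale theta_measure = q_central_measure +
  fixes \<theta> :: "nat \<Rightarrow> int"
  assumes mono_theta: "mono \<theta>"
    and char: "\<And>lam \<alpha>. \<alpha> \<in> fpaths [] lam \<Longrightarrow>
        ((\<lambda>n. dimq q lam (lam_theta n \<theta>) / dimq q [] (lam_theta n \<theta>))
           \<longlongrightarrow> measure P (cyl \<alpha>) / wpath q \<alpha>) sequentially"
begin

section \<open>The finite weight distributions and their limit \<open>P\<close>\<close>

definition base :: "nat \<Rightarrow> edge" where
  "base = path_of (\<lambda>_. \<theta>)"

lemma theta_le: "i \<le> j \<Longrightarrow> \<theta> i \<le> \<theta> j"
  using mono_theta by (rule monoD)

lemma base_in_GT_space [simp]: "base \<in> GT_space"
  unfolding base_def by (rule path_of_in_GT_space) (simp add: gt_array_def theta_le)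

lemma fst_base [simp]: "fst (base k) = lam_theta k \<theta>"
  by (simp add: base_def path_of_def)

text \<open>Infinite paths standing for the finite paths from the root to
  \<open>lam_theta n \<theta>\<close>, continued by \<open>\<theta>\<close>. In this form the
  distributions for all \<open>n\<close> live on the same space as \<open>P\<close>.\<close>

definition tails :: "nat \<Rightarrow> (nat \<Rightarrow> edge) set" where
  "tails n = {\<omega> \<in> GT_space. \<forall>k\<ge>n. fst (\<omega> k) = lam_theta k \<theta>}"

text \<open>By \<open>wpath_prefix\<close> this is the total weight of the corresponding finite
  paths, up to a factor that depends only on their common endpoint. The factor cancels in
  \<open>mass n E / mass n UNIV\<close>, which is a probability.\<close>

definition mass :: "nat \<Rightarrow> (nat \<Rightarrow> edge) set \<Rightarrow> real" where
  "mass n E = (\<Sum>\<omega>\<in>tails n \<inter> E. q powi (2 * level_sum \<omega> n))"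

lemma base_in_tails: "base \<in> tails n"
  by (simp add: tails_def)

lemma tails_coord: "\<omega> \<in> tails n \<Longrightarrow> j < k \<Longrightarrow> n \<le> k \<Longrightarrow> coord \<omega> k j = \<theta> j"
  by (auto simp: tails_def fst_eq_lam_theta_iff)

lemma tails_lower:
  assumes "\<omega> \<in> tails n" "j < k"
  shows "\<theta> j \<le> coord \<omega> k j"
proof -
  have "gt_array (coord \<omega>)" using assms by (auto simp: tails_def gt_array_coord)
  from gt_array_decseq[OF this assms(2), of "max k n"] tails_coord[OF assms(1), of j "max k n"] assms(2)
  show ?thesis by simp
qed

lemma tails_upper:
  assumes "\<omega> \<in> tails n" "j < k"
  shows "coord \<omega> k j \<le> \<theta> (j + n)"
proof -
  have "gt_array (coord \<omega>)" using assms by (auto simp: tails_def gt_array_coord)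
  from gt_array_le_diagonal[OF this assms(2), of n] tails_coord[OF assms(1), of "j + n" "k + n"] assms(2)
  show ?thesis by simp
qed

lemma tails_edge: "\<omega> \<in> tails n \<Longrightarrow> k \<ge> n \<Longrightarrow> \<omega> k = base k"
  by (rule prod_eqI) (auto simp: tails_def GT_space_snd)

lemma finite_tails: "finite (tails n)"
proof -
  let ?X = "\<Union>k\<le>n. {l. set l \<subseteq> {\<theta> 0..\<theta> (2 * n)} \<and> length l = k}"
  have "finite ?X" by (auto intro: finite_lists_length_eq)
  have fst_in: "fst (\<omega> k) \<in> ?X" if "\<omega> \<in> tails n" "k \<le> n" for \<omega> k
  proof -
    have \<omega>: "\<omega> \<in> GT_space" using that by (simp add: tails_def)
    have "x \<in> {\<theta> 0..\<theta> (2 * n)}" if "x \<in> set (fst (\<omega> k))" for x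
    proof -
      from that obtain i where "i < k" "x = fst (\<omega> k) ! i"
        using GT_space_length[OF \<omega>] by (auto simp: in_set_conv_nth)
      then have x: "x = coord \<omega> k (k - Suc i)" "k - Suc i < k"
        using GT_space_length[OF \<omega>, of k] by (auto simp: coord_def rev_nth)
      have "\<theta> 0 \<le> \<theta> (k - Suc i)" "\<theta> (k - Suc i + n) \<le> \<theta> (2 * n)"
        using \<open>k \<le> n\<close> by (auto intro: theta_le)
      with tails_lower[OF \<open>\<omega> \<in> tails n\<close> x(2)] tails_upper[OF \<open>\<omega> \<in> tails n\<close> x(2)] x(1)
      show ?thesis by simp
    qed
    then show ?thesis using GT_space_length[OF \<omega>] \<open>k \<le> n\<close> by blast
  qed
  have "(\<lambda>\<omega>. map \<omega> [0..<n]) ` tails n \<subseteq> {l. set l \<subseteq> ?X \<times> ?X \<and> length l = n}"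
  proof safe
    fix \<omega> a b assume "\<omega> \<in> tails n" "(a, b) \<in> set (map \<omega> [0..<n])"
    then obtain k where k: "k < n" "(a, b) = \<omega> k" by auto
    then have "a = fst (\<omega> k)" "b = fst (\<omega> (Suc k))"
      using GT_space_snd[of \<omega> k] \<open>\<omega> \<in> tails n\<close> by (auto simp: tails_def dest: sym)
    with fst_in[OF \<open>\<omega> \<in> tails n\<close>, of k] fst_in[OF \<open>\<omega> \<in> tails n\<close>, of "Suc k"] k
    show "a \<in> ?X" "b \<in> ?X" by auto
  qed simp
  moreover have "finite {l. set l \<subseteq> ?X \<times> ?X \<and> length l = n}"
    using \<open>finite ?X\<close> by (intro finite_lists_length_eq finite_cartesian_product)
  moreover have "inj_on (\<lambda>\<omega>. map \<omega> [0..<n]) (tails n)"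
  proof (rule inj_onI, rule ext)
    fix \<omega> \<omega>' k assume "\<omega> \<in> tails n" "\<omega>' \<in> tails n" "map \<omega> [0..<n] = map \<omega>' [0..<n]"
    then show "\<omega> k = \<omega>' k" by (cases "k < n") (auto simp: tails_edge)
  qed
  ultimately show ?thesis by (meson finite_imageD finite_subset)
qed

lemma mass_nonneg: "0 \<le> mass n E"
  unfolding mass_def using q by (intro sum_nonneg) simp

lemma mass_mono: "tails n \<inter> E \<subseteq> F \<Longrightarrow> mass n E \<le> mass n F"
  unfolding mass_def using q finite_tails by (intro sum_mono2) auto

lemma mass_empty: "tails n \<inter> E = {} \<Longrightarrow> mass n E = 0"
  by (simp add: mass_def)

lemma mass_UNIV_pos: "0 < mass n UNIV"
  unfolding mass_def using q base_in_tails[of n] finite_tails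
  by (intro sum_pos2[of _ base]) auto

lemma mass_UN_disjoint:
  assumes "finite F" "disjoint_family_on A F"
  shows "mass n (\<Union>i\<in>F. A i) = (\<Sum>i\<in>F. mass n (A i))"
proof -
  have *: "tails n \<inter> (\<Union>i\<in>F. A i) = (\<Union>i\<in>F. tails n \<inter> A i)" by auto
  show ?thesis
    unfolding mass_def * using assms finite_tails
    by (intro sum.UNION_disjoint) (auto simp: disjoint_family_on_def)
qed

lemma mass_Un_le: "mass n (A \<union> B) \<le> mass n A + mass n B"
proof -
  have "tails n \<inter> (A \<union> B) = (tails n \<inter> A) \<union> (tails n \<inter> B)" by auto
  then show ?thesis
    unfolding mass_def using q finite_tails
    by (simp add: sum_Un) (intro sum_nonneg, simp)
qed

lemma mass_UN_le:
  assumes "finite I"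
  shows "mass n (\<Union>i\<in>I. A i) \<le> (\<Sum>i\<in>I. mass n (A i))"
  using assms
proof (induction I rule: finite_induct)
  case empty
  then show ?case by (simp add: mass_def)
next
  case (insert x F)
  have "mass n (\<Union>i\<in>insert x F. A i) \<le> mass n (A x) + mass n (\<Union>i\<in>F. A i)"
    using mass_Un_le by simp
  with insert show ?case by simp
qed

text \<open>A finite path ending in \<open>lam_theta n \<theta>\<close> corresponds to the element
  of \<open>tails n\<close> that starts along \<open>\<eta>\<close>, follows the finite path and
  continues along \<open>base\<close>.\<close>

lemma dimq_tails:
  assumes \<eta>: "\<eta> \<in> GT_space" and N: "N < n"
  shows "dimq q (fst (\<eta> N)) (lam_theta n \<theta>) =
    (\<Sum>\<omega>\<in>tails n \<inter> {\<omega>. \<forall>k<N. \<omega> k = \<eta> k}. wpath q (map \<omega> [N..<n]))"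
proof -
  let ?X = "tails n \<inter> {\<omega>. \<forall>k<N. \<omega> k = \<eta> k}"
  have len: "length (fst (\<eta> N)) = N" using GT_space_length[OF \<eta>] .
  have fst_N: "fst (\<omega> N) = fst (\<eta> N)" if "\<omega> \<in> ?X" for \<omega>
  proof (cases N)
    case 0
    then show ?thesis using that \<eta> by (simp add: tails_def GT_space_fst_0)
  next
    case (Suc M)
    then have "\<omega> M = \<eta> M" using that by simp
    then show ?thesis using that \<eta> Suc GT_space_snd[of \<omega> M] GT_space_snd[of \<eta> M] by (simp add: tails_def)
  qed
  have "bij_betw (\<lambda>\<omega>. map \<omega> [N..<n]) ?X (fpaths (fst (\<eta> N)) (lam_theta n \<theta>))"
    unfolding bij_betw_def
  proof (intro conjI equalityI subsetI)
    show "inj_on (\<lambda>\<omega>. map \<omega> [N..<n]) ?X"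
    proof (rule inj_onI, rule ext)
      fix \<omega> \<omega>' k assume "\<omega> \<in> ?X" "\<omega>' \<in> ?X" "map \<omega> [N..<n] = map \<omega>' [N..<n]"
      then show "\<omega> k = \<omega>' k"
        by (cases "k < N"; cases "k < n") (auto simp: tails_edge)
    qed
  next
    fix \<beta> assume "\<beta> \<in> (\<lambda>\<omega>. map \<omega> [N..<n]) ` ?X"
    then obtain \<omega> where \<omega>: "\<omega> \<in> ?X" "\<beta> = map \<omega> [N..<n]" by auto
    then show "\<beta> \<in> fpaths (fst (\<eta> N)) (lam_theta n \<theta>)"
      using fpaths_segment[of \<omega>, OF _ N] fst_N[OF \<omega>(1)] by (auto simp: tails_def)
  next
    fix \<beta> assume \<beta>: "\<beta> \<in> fpaths (fst (\<eta> N)) (lam_theta n \<theta>)"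
    define \<omega> where "\<omega> k = (if k < N then \<eta> k else if k < n then \<beta> ! (k - N) else base k)" for k
    have "length \<beta> = n - N" using \<beta> len by (simp add: fpaths_def)
    have "\<omega> \<in> GT_space"
      using splice_in_GT_space[OF \<beta> \<eta> base_in_GT_space] len by (simp add: \<omega>_def[abs_def] cong: if_cong)
    then have "\<omega> \<in> ?X" using N by (auto simp: tails_def \<omega>_def)
    moreover have "map \<omega> [N..<n] = \<beta>"
      using \<open>length \<beta> = n - N\<close> N by (auto simp: \<omega>_def intro!: nth_equalityI)
    ultimately show "\<beta> \<in> (\<lambda>\<omega>. map \<omega> [N..<n]) ` ?X" by force
  qed
  then show ?thesis unfolding dimq_def by (rule sum.reindex_bij_betw[symmetric])
qed

lemma dimq_eq_mass:
  assumes \<eta>: "\<eta> \<in> GT_space" and N: "N < n"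
  shows "wpath q (map \<eta> [0..<N]) * dimq q (fst (\<eta> N)) (lam_theta n \<theta>) =
    q powi (- (int n - 1) * sumsig (lam_theta n \<theta>)) * mass n {\<omega>. \<forall>k<N. \<omega> k = \<eta> k}"
proof -
  have "wpath q (map \<eta> [0..<N]) * wpath q (map \<omega> [N..<n]) =
      q powi (- (int n - 1) * sumsig (lam_theta n \<theta>)) * q powi (2 * level_sum \<omega> n)"
    if "\<omega> \<in> tails n \<inter> {\<omega>. \<forall>k<N. \<omega> k = \<eta> k}" for \<omega>
  proof -
    have \<omega>: "\<omega> \<in> GT_space" "fst (\<omega> n) = lam_theta n \<theta>" using that by (auto simp: tails_def)
    have "[0..<n] = [0..<N] @ [N..<n]" using N upt_add_eq_append[of 0 N "n - N"] by simp
    then have "wpath q (map \<omega> [0..<n]) = wpath q (map \<omega> [0..<N]) * wpath q (map \<omega> [N..<n])"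
      by (simp add: wpath_append)
    moreover have "map \<omega> [0..<N] = map \<eta> [0..<N]" using that by auto
    ultimately have "wpath q (map \<eta> [0..<N]) * wpath q (map \<omega> [N..<n]) =
        q powi (2 * level_sum \<omega> n - (int n - 1) * sumsig (lam_theta n \<theta>))"
      using wpath_prefix[OF \<omega>(1), of q n] q \<omega>(2) by simp
    also have "\<dots> = q powi (- (int n - 1) * sumsig (lam_theta n \<theta>)) * q powi (2 * level_sum \<omega> n)"
      using q by (subst power_int_add[symmetric]) (auto simp: algebra_simps)
    finally show ?thesis .
  qed
  then show ?thesis
    unfolding dimq_tails[OF assms] mass_def sum_distrib_left by (intro sum.cong refl)
qed

lemma mass_cyl: "mass n (cyl (map \<eta> [0..<N])) = mass n {\<omega>. \<forall>k<N. \<omega> k = \<eta> k}"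
proof -
  have "tails n \<inter> cyl (map \<eta> [0..<N]) = tails n \<inter> {\<omega>. \<forall>k<N. \<omega> k = \<eta> k}"
    by (auto simp: in_cyl_prefix_iff tails_def)
  then show ?thesis by (simp add: mass_def)
qed

text \<open>The hypothesis \<open>char\<close> read as convergence of the finite distributions on
  cylinders. The denominator \<open>dimq q []\<close> is the case of the empty prefix in
  \<open>dimq_eq_mass\<close>.\<close>

lemma measure_cyl_limit:
  assumes "\<alpha> \<in> fpaths [] lam"
  shows "(\<lambda>n. mass n (cyl \<alpha>) / mass n UNIV) \<longlonglongrightarrow> measure P (cyl \<alpha>)"
proof -
  obtain \<eta> where \<eta>: "\<eta> \<in> cyl \<alpha>" using fpaths_in_prefix[OF assms] .
  let ?N = "length lam"
  have \<eta>': "\<eta> \<in> GT_space" using \<eta> by (simp add: cyl_def)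
  have \<alpha>: "\<alpha> = map \<eta> [0..<?N]" and lam: "lam = fst (\<eta> ?N)"
    using cyl_prefix_eq[OF \<eta>] fpaths_length[OF assms] cyl_end[OF assms \<eta>] by auto
  have w: "wpath q \<alpha> > 0" using wpath_pos q by simp
  have "(\<lambda>n. wpath q \<alpha> * (dimq q lam (lam_theta n \<theta>) / dimq q [] (lam_theta n \<theta>)))
      \<longlonglongrightarrow> wpath q \<alpha> * (measure P (cyl \<alpha>) / wpath q \<alpha>)"
    by (intro tendsto_mult tendsto_const char assms)
  moreover have "wpath q \<alpha> * (measure P (cyl \<alpha>) / wpath q \<alpha>) = measure P (cyl \<alpha>)" using w by simp
  moreover have "\<forall>\<^sub>F n in sequentially. wpath q \<alpha> * (dimq q lam (lam_theta n \<theta>) / dimq q [] (lam_theta n \<theta>)) =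
      mass n (cyl \<alpha>) / mass n UNIV"
    using eventually_gt_at_top[of ?N]
  proof eventually_elim
    case (elim n)
    let ?c = "q powi (- (int n - 1) * sumsig (lam_theta n \<theta>))"
    have "?c \<noteq> 0" using q by simp
    have "wpath q \<alpha> * dimq q lam (lam_theta n \<theta>) = ?c * mass n (cyl \<alpha>)"
      using dimq_eq_mass[OF \<eta>' elim] mass_cyl[of n \<eta> ?N] \<alpha> lam by metis
    moreover have "dimq q [] (lam_theta n \<theta>) = ?c * mass n UNIV"
      using dimq_eq_mass[OF \<eta>', of 0 n] elim \<eta>' by (simp add: GT_space_fst_0 wpath_def)
    ultimately have "wpath q \<alpha> * dimq q lam (lam_theta n \<theta>) / dimq q [] (lam_theta n \<theta>) =
        (?c * mass n (cyl \<alpha>)) / (?c * mass n UNIV)" by (simp only:)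
    then show ?case using \<open>?c \<noteq> 0\<close> by (metis mult_divide_mult_cancel_left times_divide_eq_right)
  qed
  ultimately show ?thesis by (simp add: tendsto_cong)
qed

text \<open>A finite-level set may consist of infinitely many cylinders, so limits cannot simply be
  summed over them. An upper bound survives: it passes to the limit for every finite subunion and
  then to their increasing union.\<close>

lemma measure_level_set_le:
  assumes lev: "level_set N E" and le: "\<And>n. n > N \<Longrightarrow> mass n E \<le> \<epsilon> * mass n UNIV"
  shows "measure P E \<le> \<epsilon>"
proof (cases "E = {}")
  case True
  have "0 \<le> \<epsilon> * mass (Suc N) UNIV" using le[of "Suc N"] mass_nonneg[of "Suc N" E] by simp
  then have "0 \<le> \<epsilon>" using mass_UNIV_pos[of "Suc N"] by (simp add: zero_le_mult_iff)
  with True show ?thesis by simp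
next
  case False
  \<comment> \<open>Prefixes of length \<open>Suc N\<close> are never empty, which makes each of
    them a finite path.\<close>
  let ?S = "(\<lambda>\<omega>. map \<omega> [0..<Suc N]) ` E"
  have ES: "E = (\<Union>\<alpha>\<in>?S. cyl \<alpha>)"
    by (rule level_set_eq_UN[OF level_set_mono[OF lev]]) simp
  have "E \<subseteq> GT_space" using lev by (simp add: level_set_def)
  have S_fp: "\<exists>lam. \<alpha> \<in> fpaths [] lam" if "\<alpha> \<in> ?S" for \<alpha>
    using that fpaths_prefix \<open>E \<subseteq> GT_space\<close> by blast
  have S_len: "length \<alpha> = Suc N" if "\<alpha> \<in> ?S" for \<alpha> using that by auto
  have fin: "measure P (\<Union>\<alpha>\<in>F. cyl \<alpha>) \<le> \<epsilon>" if F: "finite F" "F \<subseteq> ?S" for F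
  proof -
    have disj: "disjoint_family_on cyl F"
      unfolding disjoint_family_on_def
    proof (intro ballI impI equals0I)
      fix \<alpha> \<beta> \<omega> assume *: "\<alpha> \<in> F" "\<beta> \<in> F" "\<alpha> \<noteq> \<beta>" "\<omega> \<in> cyl \<alpha> \<inter> cyl \<beta>"
      then have "map \<omega> [0..<length \<alpha>] = \<alpha>" "map \<omega> [0..<length \<beta>] = \<beta>"
        by (blast intro: cyl_prefix_eq)+
      moreover have "length \<alpha> = Suc N" "length \<beta> = Suc N"
        using * F(2) by (blast intro: S_len)+
      ultimately show False using *(3) by metis
    qed
    have "(\<lambda>n. \<Sum>\<alpha>\<in>F. mass n (cyl \<alpha>) / mass n UNIV) \<longlonglongrightarrow> (\<Sum>\<alpha>\<in>F. measure P (cyl \<alpha>))"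
    proof (rule tendsto_sum)
      fix \<alpha> assume "\<alpha> \<in> F"
      with F(2) S_fp obtain lam where "\<alpha> \<in> fpaths [] lam" by blast
      then show "(\<lambda>n. mass n (cyl \<alpha>) / mass n UNIV) \<longlonglongrightarrow> measure P (cyl \<alpha>)"
        by (rule measure_cyl_limit)
    qed
    moreover have "(\<Sum>\<alpha>\<in>F. mass n (cyl \<alpha>) / mass n UNIV) \<le> \<epsilon>" if "n > N" for n
    proof -
      have "(\<Sum>\<alpha>\<in>F. mass n (cyl \<alpha>)) = mass n (\<Union>\<alpha>\<in>F. cyl \<alpha>)"
        using mass_UN_disjoint[OF F(1) disj] by simp
      also have "\<dots> \<le> mass n E" using F(2) by (intro mass_mono) (subst ES, auto)
      also have "\<dots> \<le> \<epsilon> * mass n UNIV" using le[OF that] .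
      finally show ?thesis using mass_UNIV_pos[of n] by (simp add: sum_divide_distrib[symmetric] divide_le_eq)
    qed
    ultimately have "(\<Sum>\<alpha>\<in>F. measure P (cyl \<alpha>)) \<le> \<epsilon>"
      by (intro LIMSEQ_le_const2[of _ _ \<epsilon>]) (auto intro!: exI[of _ "Suc N"])
    then show ?thesis
      using finite_measure_finite_Union[OF F(1) _ disj] by (simp add: image_subset_iff)
  qed
  have S: "countable ?S" by (rule countableI_type)
  have "?S \<noteq> {}" using False by blast
  define f where "f = from_nat_into ?S"
  have f: "f i \<in> ?S" "range f = ?S" for i
    unfolding f_def by (rule from_nat_into[OF \<open>?S \<noteq> {}\<close>], rule range_from_nat_into[OF \<open>?S \<noteq> {}\<close> S])
  define A where "A m = (\<Union>\<alpha>\<in>f ` {..m}. cyl \<alpha>)" for m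
  have "(\<lambda>m. measure P (A m)) \<longlonglongrightarrow> measure P (\<Union>m. A m)"
  proof (rule finite_Lim_measure_incseq)
    show "range A \<subseteq> sets P" by (auto simp: A_def)
    show "incseq A" unfolding A_def by (rule incseq_SucI) (auto simp: atMost_Suc)
  qed
  moreover have "(\<Union>m. A m) = E"
  proof -
    have "(\<Union>m. A m) = (\<Union>\<alpha>\<in>range f. cyl \<alpha>)" by (auto simp: A_def)
    then show ?thesis using ES f(2) by simp
  qed
  moreover have "measure P (A m) \<le> \<epsilon>" for m
    unfolding A_def using f by (intro fin) auto
  ultimately show ?thesis by (intro LIMSEQ_le_const2[of _ _ \<epsilon>]) auto
qed

lemma AE_level_set:
  assumes "\<And>\<omega> \<omega>'. (\<And>n. n < N \<Longrightarrow> \<omega> n = \<omega>' n) \<Longrightarrow> Q \<omega> = Q \<omega>'"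
    and "\<And>n \<omega>. \<omega> \<in> tails n \<Longrightarrow> Q \<omega>"
  shows "AE \<omega> in P. Q \<omega>"
proof -
  let ?E = "{\<omega> \<in> GT_space. \<not> Q \<omega>}"
  have lev: "level_set N ?E" by (rule level_set_Collect) (use assms(1) in blast)
  have "mass n ?E = 0" for n using assms(2) by (intro mass_empty) auto
  then have "measure P ?E \<le> 0" by (intro measure_level_set_le[OF lev]) simp
  moreover have "?E \<in> sets P" using level_set_in_sets[OF lev] by simp
  ultimately have "?E \<in> null_sets P"
    by (simp add: null_sets_def emeasure_eq_measure measure_le_0_iff)
  then show ?thesis by (rule AE_I') auto
qed

lemma AE_coord_lower: "AE \<omega> in P. \<forall>k. \<forall>j<k. \<theta> j \<le> coord \<omega> k j"
proof -
  have "AE \<omega> in P. \<forall>j<k. \<theta> j \<le> coord \<omega> k j" for k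
    by (rule AE_level_set[of "Suc k"]) (auto simp: coord_def tails_lower[unfolded coord_def])
  then show ?thesis by (subst AE_all_countable) auto
qed

lemma AE_coord_upper:
  assumes "\<And>j. \<theta> j \<le> M"
  shows "AE \<omega> in P. \<forall>k. \<forall>j<k. coord \<omega> k j \<le> M"
proof -
  have "coord \<omega> k j \<le> M" if "\<omega> \<in> tails n" "j < k" for \<omega> n k j
    using tails_upper[OF that] assms[of "j + n"] by simp
  then have "AE \<omega> in P. \<forall>j<k. coord \<omega> k j \<le> M" for k
    by (intro AE_level_set[of "Suc k"]) (auto simp: coord_def)
  then show ?thesis by (subst AE_all_countable) auto
qed

section \<open>Late departures from \<theta> are exponentially unlikely\<close>

definition stable :: "nat \<Rightarrow> nat \<Rightarrow> (nat \<Rightarrow> edge) set" where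
  "stable i K = {\<omega>. \<forall>j<i. \<forall>k\<ge>K. coord \<omega> k j = \<theta> j}"

definition last_defect :: "nat \<Rightarrow> nat \<Rightarrow> (nat \<Rightarrow> edge) set" where
  "last_defect i m = {\<omega>. coord \<omega> m i \<noteq> \<theta> i \<and> (\<forall>k>m. coord \<omega> k i = \<theta> i)}"

text \<open>Lowering the \<open>i\<close>-th coordinate by one on the levels \<open>K < k \<le> m\<close> is injective and
  multiplies the weight by \<open>q powi (- 2 * (m - K))\<close>, so late defects are exponentially rare.\<close>

lemma mass_last_defect:
  assumes K: "i \<le> K" "K \<le> m" "i < m"
  shows "mass n (last_defect i m \<inter> stable i K) \<le> q ^ (2 * (m - K)) * mass n UNIV"
proof -
  let ?X = "tails n \<inter> (last_defect i m \<inter> stable i K)"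
  define \<phi> where "\<phi> \<omega> k j = (if j = i \<and> K < k \<and> k \<le> m then coord \<omega> k j - 1 else coord \<omega> k j)" for \<omega> k j
  let ?g = "\<lambda>\<omega>. path_of (\<phi> \<omega>)"
  have props: "gt_array (\<phi> \<omega>) \<and> m < n" if \<omega>: "\<omega> \<in> ?X" for \<omega>
  proof
    have "\<omega> \<in> GT_space" using \<omega> by (simp add: tails_def)
    then have gt: "gt_array (coord \<omega>)" by (rule gt_array_coord)
    have "coord \<omega> m i \<noteq> \<theta> i" using \<omega> by (simp add: last_defect_def)
    then show "m < n" using tails_coord[of \<omega> n i m] \<omega> K by force
    have "\<theta> i < coord \<omega> m i"
      using tails_lower[of \<omega> n i m] \<omega> \<open>coord \<omega> m i \<noteq> \<theta> i\<close> K by auto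
    then have above: "\<theta> i < coord \<omega> k i" if "i < k" "k \<le> m" for k
      using gt_array_decseq[OF gt that] by simp
    have after: "coord \<omega> (Suc m) i = \<theta> i" using \<omega> by (simp add: last_defect_def)
    show "gt_array (\<phi> \<omega>)"
      unfolding gt_array_def
    proof (intro allI impI conjI)
      \<comment> \<open>Lowering tightens only two kinds of inequality: at index \<open>i\<close>
        between levels \<open>m\<close> and \<open>m + 1\<close>, where the defect leaves room, and
        against the entry of index \<open>i - 1\<close> on the level before, which equals
        \<open>\<theta> (i - 1)\<close> by stability.\<close>
      fix k j :: nat assume j: "j < k"
      have 1: "coord \<omega> (Suc k) j \<le> coord \<omega> k j" and 2: "coord \<omega> k j \<le> coord \<omega> (Suc k) (Suc j)"
        using gt j by (auto simp: gt_array_def)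
      show "\<phi> \<omega> (Suc k) j \<le> \<phi> \<omega> k j"
      proof (cases "j = i \<and> k = m \<and> K < m")
        case True
        then show ?thesis using above[of m] after K by (simp add: \<phi>_def)
      qed (use 1 K in \<open>auto simp: \<phi>_def\<close>)
      show "\<phi> \<omega> k j \<le> \<phi> \<omega> (Suc k) (Suc j)"
      proof (cases "Suc j = i \<and> K \<le> k \<and> Suc k \<le> m")
        case True
        then have "coord \<omega> k j = \<theta> j" using \<omega> by (auto simp: stable_def)
        moreover have "\<theta> j \<le> \<theta> (Suc j)" by (rule theta_le) simp
        moreover have "\<theta> i < coord \<omega> (Suc k) i" using True j by (intro above) auto
        ultimately show ?thesis using True by (auto simp: \<phi>_def)
      qed (use 2 in \<open>auto simp: \<phi>_def\<close>)
    qed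
  qed
  have coord_g: "coord (?g \<omega>) k j = \<phi> \<omega> k j" if "j < k" for \<omega> k j
    using that by (rule coord_path_of)
  have g_tails: "?g \<omega> \<in> tails n" if "\<omega> \<in> ?X" for \<omega>
  proof -
    have gs: "?g \<omega> \<in> GT_space" using props[OF that] path_of_in_GT_space by blast
    have "fst (?g \<omega> k) = lam_theta k \<theta>" if "k \<ge> n" for k
    proof -
      have "\<phi> \<omega> k j = \<theta> j" if "j < k" for j
        using that props[OF \<open>\<omega> \<in> ?X\<close>] \<open>n \<le> k\<close> tails_coord[of \<omega> n j k] \<open>\<omega> \<in> ?X\<close> by (simp add: \<phi>_def)
      then show ?thesis by (simp add: fst_eq_lam_theta_iff[OF gs] coord_g)
    qed
    with gs show ?thesis by (simp add: tails_def)
  qed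
  have inj: "inj_on ?g ?X"
  proof (rule inj_onI)
    fix \<omega> \<omega>' assume *: "\<omega> \<in> ?X" "\<omega>' \<in> ?X" "?g \<omega> = ?g \<omega>'"
    show "\<omega> = \<omega>'"
    proof (rule GT_space_eqI)
      fix k j :: nat assume "j < k"
      then have "\<phi> \<omega> k j = \<phi> \<omega>' k j" using * coord_g by metis
      then show "coord \<omega> k j = coord \<omega>' k j" by (simp add: \<phi>_def split: if_splits)
    qed (use * in \<open>auto simp: tails_def\<close>)
  qed
  \<comment> \<open>Exactly the \<open>m - K\<close> lowered levels lose one unit each, and
    \<open>level_sum\<close> at \<open>n\<close> sees all of them because
    \<open>m < n\<close>.\<close>
  have lsum: "level_sum \<omega> n = int (m - K) + level_sum (?g \<omega>) n" if \<omega>: "\<omega> \<in> ?X" for \<omega>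
  proof -
    have in_space: "\<omega> \<in> GT_space" "?g \<omega> \<in> GT_space" using \<omega> g_tails[OF \<omega>] by (auto simp: tails_def)
    have "sumsig (fst (\<omega> k)) = (if K < k \<and> k \<le> m then 1 else 0) + sumsig (fst (?g \<omega> k))" for k
    proof -
      have "(\<Sum>j<k. coord \<omega> k j) = (\<Sum>j<k. (if j = i \<and> K < k \<and> k \<le> m then 1 else 0) + \<phi> \<omega> k j)"
        by (intro sum.cong) (auto simp: \<phi>_def)
      also have "\<dots> = (\<Sum>j<k. if j = i then (if K < k \<and> k \<le> m then 1 else 0) else 0) + (\<Sum>j<k. \<phi> \<omega> k j)"
        by (subst sum.distrib) (intro arg_cong2[of _ _ _ _ "(+)"] sum.cong, auto)
      also have "(\<Sum>j<k. if j = i then (if K < k \<and> k \<le> m then 1 else 0) else 0) =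
          (if K < k \<and> k \<le> m then 1 else (0 :: int))"
        using K by (simp add: sum.delta)
      also have "(\<Sum>j<k. \<phi> \<omega> k j) = sumsig (fst (?g \<omega> k))"
        unfolding sumsig_coord[OF in_space(2)] by (intro sum.cong) (auto simp: coord_g)
      finally show ?thesis by (simp add: sumsig_coord[OF in_space(1)])
    qed
    then have "level_sum \<omega> n = (\<Sum>k<n. if K < k \<and> k \<le> m then 1 else 0) + level_sum (?g \<omega>) n"
      unfolding level_sum_def by (simp add: sum.distrib)
    also have "(\<Sum>k<n. if K < k \<and> k \<le> m then 1 else (0 :: int)) = (\<Sum>k\<in>{K<..m}. 1)"
      using props[OF \<omega>] by (intro sum.mono_neutral_cong_right) auto
    finally show ?thesis by simp
  qed
  have "mass n (last_defect i m \<inter> stable i K) = (\<Sum>\<omega>\<in>?X. q ^ (2 * (m - K)) * q powi (2 * level_sum (?g \<omega>) n))"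
    unfolding mass_def
  proof (intro sum.cong refl)
    fix \<omega> assume "\<omega> \<in> ?X"
    then have "q powi (2 * level_sum \<omega> n) = q powi (int (2 * (m - K)) + 2 * level_sum (?g \<omega>) n)"
      by (simp add: lsum)
    also have "\<dots> = q ^ (2 * (m - K)) * q powi (2 * level_sum (?g \<omega>) n)"
      using q by (subst power_int_add) (simp_all only: power_int_of_nat less_irrefl simp_thms, simp)
    finally show "q powi (2 * level_sum \<omega> n) = q ^ (2 * (m - K)) * q powi (2 * level_sum (?g \<omega>) n)" .
  qed
  also have "\<dots> = q ^ (2 * (m - K)) * (\<Sum>\<omega>\<in>?g ` ?X. q powi (2 * level_sum \<omega> n))"
    by (simp add: sum.reindex[OF inj] sum_distrib_left)
  also have "\<dots> \<le> q ^ (2 * (m - K)) * mass n UNIV"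
    unfolding mass_def using q g_tails finite_tails by (intro mult_left_mono sum_mono2) auto
  finally show ?thesis .
qed

text \<open>On \<open>tails n\<close> every path finally follows \<theta>, so an instability of
  coordinate \<open>i\<close> has a last defect at some level \<open>m \<ge> K\<close>. The bounds
  for the single \<open>m\<close> form a geometric series, and the resulting factor is independent
  of \<open>n\<close>.\<close>

lemma mass_unstable_step:
  assumes K: "i \<le> L" "L \<le> K" "i < K"
  shows "mass n (stable i L - stable (Suc i) K) \<le> q ^ (2 * (K - L)) / (1 - q\<^sup>2) * mass n UNIV"
proof -
  have q2: "0 < q\<^sup>2" "q\<^sup>2 < 1" using q by (auto simp: power_less_one_iff)
  \<comment> \<open>On \<open>tails n\<close> the last defect lies below level \<open>n\<close>; the
    upper end \<open>n + K\<close> makes the range consist of exactly \<open>n\<close> indices,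
    which are later shifted by \<open>K\<close>.\<close>
  have "mass n (stable i L - stable (Suc i) K) \<le> mass n (\<Union>m\<in>{K..<n + K}. last_defect i m \<inter> stable i L)"
  proof (rule mass_mono, rule subsetI)
    fix \<omega> assume \<omega>: "\<omega> \<in> tails n \<inter> (stable i L - stable (Suc i) K)"
    define Q where "Q k \<longleftrightarrow> K \<le> k \<and> coord \<omega> k i \<noteq> \<theta> i" for k
    have ex: "\<exists>k. Q k"
      using \<omega> K unfolding Q_def stable_def by (auto simp: less_Suc_eq)
    have bound: "k \<le> n" if "Q k" for k
      using that tails_coord[of \<omega> n i k] \<omega> K by (force simp: Q_def)
    define m where "m = (GREATEST k. Q k)"
    have m: "Q m" unfolding m_def using ex bound by (metis GreatestI_nat)
    have "coord \<omega> k i = \<theta> i" if "k > m" for k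
    proof (rule ccontr)
      assume "coord \<omega> k i \<noteq> \<theta> i"
      then have "Q k" using that m by (simp add: Q_def)
      then have "k \<le> m" unfolding m_def using bound by (intro Greatest_le_nat[of Q k n]) auto
      with that show False by simp
    qed
    with m have "\<omega> \<in> last_defect i m" by (simp add: last_defect_def Q_def)
    moreover have "m < n"
      using m tails_coord[of \<omega> n i m] \<omega> K by (force simp: Q_def)
    ultimately show "\<omega> \<in> (\<Union>m\<in>{K..<n + K}. last_defect i m \<inter> stable i L)"
      using \<omega> m by (auto simp: Q_def)
  qed
  also have "\<dots> \<le> (\<Sum>m\<in>{K..<n + K}. mass n (last_defect i m \<inter> stable i L))"
    by (rule mass_UN_le) simp
  also have "\<dots> \<le> (\<Sum>m\<in>{K..<n + K}. q ^ (2 * (m - L)) * mass n UNIV)"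
    using K by (intro sum_mono mass_last_defect) auto
  also have "\<dots> = (\<Sum>m<n. q ^ (2 * (K - L)) * (q\<^sup>2) ^ m * mass n UNIV)"
  proof (rule sum.reindex_bij_witness[of _ "\<lambda>m. m + K" "\<lambda>m. m - K"])
    fix m assume m: "m \<in> {K..<n + K}"
    then have "2 * (m - L) = 2 * (K - L) + 2 * (m - K)" using K by auto
    then show "q ^ (2 * (K - L)) * (q\<^sup>2) ^ (m - K) * mass n UNIV = q ^ (2 * (m - L)) * mass n UNIV"
      by (simp only: power_add power_mult)
  qed auto
  also have "\<dots> = q ^ (2 * (K - L)) * (\<Sum>m<n. (q\<^sup>2) ^ m) * mass n UNIV"
    by (simp add: sum_distrib_left sum_distrib_right)
  also have "\<dots> \<le> q ^ (2 * (K - L)) * (1 / (1 - q\<^sup>2)) * mass n UNIV"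
  proof (intro mult_right_mono mult_left_mono)
    have "(\<Sum>m<n. (q\<^sup>2) ^ m) = (1 - (q\<^sup>2) ^ n) / (1 - q\<^sup>2)" using q2 by (subst sum_gp_strict) auto
    also have "\<dots> \<le> 1 / (1 - q\<^sup>2)" using q2 by (intro divide_right_mono) auto
    finally show "(\<Sum>m<n. (q\<^sup>2) ^ m) \<le> 1 / (1 - q\<^sup>2)" .
  qed (use q mass_nonneg in auto)
  finally show ?thesis by simp
qed

text \<open>Induction from the smallest coordinate upwards: once the first \<open>i\<close> have
  settled by level \<open>L\<close>, the next one settles \<open>Suc r\<close> levels later except
  for a small relative mass. The level \<open>K\<close> is uniform in \<open>n\<close>, so the
  estimate passes to \<open>P\<close>.\<close>

lemma mass_unstable:
  assumes "0 < \<epsilon>"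
  shows "\<exists>K\<ge>i. \<forall>n. mass n (- stable i K) \<le> \<epsilon> * mass n UNIV"
  using assms
proof (induction i arbitrary: \<epsilon>)
  case 0
  have "mass n (- stable 0 0) \<le> \<epsilon> * mass n UNIV" for n
    using 0 mass_nonneg[of n UNIV] by (subst mass_empty) (auto simp: stable_def)
  then show ?case by blast
next
  case (Suc i)
  from Suc.IH[of "\<epsilon> / 2"] Suc.prems obtain L where L: "i \<le> L"
    and le: "\<And>n. mass n (- stable i L) \<le> \<epsilon> / 2 * mass n UNIV" by auto
  have q2: "0 < q\<^sup>2" "q\<^sup>2 < 1" using q by (auto simp: power_less_one_iff)
  have "0 < \<epsilon> / 2 * (1 - q\<^sup>2)" using q2 Suc.prems by simp
  then obtain r where "(q\<^sup>2) ^ r < \<epsilon> / 2 * (1 - q\<^sup>2)" using q2 real_arch_pow_inv by blast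
  moreover have "(q\<^sup>2) ^ Suc r \<le> (q\<^sup>2) ^ r" using q2 by (intro power_decreasing) auto
  ultimately have "q ^ (2 * Suc r) \<le> \<epsilon> / 2 * (1 - q\<^sup>2)"
    unfolding power_mult by linarith
  then have r: "q ^ (2 * Suc r) / (1 - q\<^sup>2) \<le> \<epsilon> / 2"
    using q2 by (subst pos_divide_le_eq) auto
  \<comment> \<open>The increment \<open>Suc r\<close> ensures \<open>i < ?K\<close>, as
    \<open>mass_unstable_step\<close> requires.\<close>
  let ?K = "L + Suc r"
  have "mass n (- stable (Suc i) ?K) \<le> \<epsilon> * mass n UNIV" for n
  proof -
    have "mass n (- stable (Suc i) ?K) \<le> mass n (- stable i L \<union> (stable i L - stable (Suc i) ?K))"
      by (rule mass_mono) auto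
    also have "\<dots> \<le> mass n (- stable i L) + mass n (stable i L - stable (Suc i) ?K)"
      by (rule mass_Un_le)
    also have "mass n (stable i L - stable (Suc i) ?K) \<le> q ^ (2 * (?K - L)) / (1 - q\<^sup>2) * mass n UNIV"
      using L by (intro mass_unstable_step) auto
    also have "\<dots> \<le> \<epsilon> / 2 * mass n UNIV"
      using r mass_nonneg[of n UNIV] by (intro mult_right_mono) auto
    finally show ?thesis using le[of n] by simp
  qed
  then show ?case using L by (intro exI[of _ ?K]) auto
qed

text \<open>Agreement on all late levels is not an event of finitely many edges, so agreement on a
  single level \<open>K\<close> is obtained first, through the events \<open>B K\<close>. It
  persists because each coordinate decreases with the level and stays at or above
  \<open>\<theta> j\<close>.\<close>

lemma AE_coord_eventually: "AE \<omega> in P. \<forall>i. \<exists>K. \<forall>k\<ge>K. \<forall>j<i. coord \<omega> k j = \<theta> j"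
proof -
  have "AE \<omega> in P. \<exists>K\<ge>i. \<forall>j<i. coord \<omega> K j = \<theta> j" for i
  proof -
    define B where "B K = {\<omega> \<in> GT_space. \<not> (\<forall>j<i. coord \<omega> K j = \<theta> j)}" for K
    let ?C = "\<Inter>K\<in>{i..}. B K"
    have lev: "level_set (Suc K) (B K)" for K
      unfolding B_def by (rule level_set_Collect) (simp add: coord_def)
    have B_sets: "B K \<in> sets P" for K unfolding sets_P by (rule level_set_in_sets[OF lev])
    have C_sets: "?C \<in> sets P" using B_sets by (intro sets.countable_INT') auto
    have "measure P ?C \<le> \<epsilon>" if \<epsilon>: "0 < \<epsilon>" for \<epsilon>
    proof -
      from mass_unstable[OF \<epsilon>, of i] obtain K where K: "i \<le> K"
        and le: "\<And>n. mass n (- stable i K) \<le> \<epsilon> * mass n UNIV" by blast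
      have "mass n (B K) \<le> mass n (- stable i K)" for n
        by (rule mass_mono) (auto simp: stable_def B_def)
      with le have "measure P (B K) \<le> \<epsilon>"
        by (intro measure_level_set_le[OF lev]) (meson order_trans)
      moreover have "measure P ?C \<le> measure P (B K)"
        using K B_sets by (intro finite_measure_mono) auto
      ultimately show ?thesis by simp
    qed
    then have "measure P ?C \<le> 0" by (rule field_le_epsilon[of _ 0, simplified])
    then have "?C \<in> null_sets P"
      using C_sets by (simp add: null_sets_def emeasure_eq_measure measure_le_0_iff)
    then show ?thesis by (rule AE_I') (auto simp: B_def)
  qed
  then have "AE \<omega> in P. \<forall>i. \<exists>K\<ge>i. \<forall>j<i. coord \<omega> K j = \<theta> j" by (subst AE_all_countable) auto
  with AE_coord_lower AE_space show ?thesis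
  proof eventually_elim
    case (elim \<omega>)
    then have gt: "gt_array (coord \<omega>)" by (simp add: gt_array_coord)
    show ?case
    proof
      fix i
      from elim obtain K where K: "i \<le> K" "\<forall>j<i. coord \<omega> K j = \<theta> j" by blast
      have "coord \<omega> k j = \<theta> j" if "k \<ge> K" "j < i" for k j
      proof -
        have "coord \<omega> k j \<le> coord \<omega> K j" using that K by (intro gt_array_decseq[OF gt]) auto
        moreover have "\<theta> j \<le> coord \<omega> k j" using elim that K by auto
        ultimately show ?thesis using K that by auto
      qed
      then show "\<exists>K. \<forall>k\<ge>K. \<forall>j<i. coord \<omega> k j = \<theta> j" by blast
    qed
  qed
qed

end

section \<open>Bounded and unbounded parameters\<close>

context theta_measure
begin

abbreviation tail_class :: "(nat \<Rightarrow> edge) set" where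
  "tail_class \<equiv> \<Union>n. tails n"

text \<open>A bounded monotone integer sequence is constant from some index \<open>n0\<close> on.
  The lower and upper bounds pin all coordinates of index at least \<open>n0\<close> to
  \<open>\<theta> n0\<close> on every level, and only the \<open>n0\<close> smallest ones need time
  to settle.\<close>

lemma AE_tail_class:
  assumes "bdd_above (range \<theta>)"
  shows "AE \<omega> in P. \<omega> \<in> tail_class"
proof -
  from assms obtain b where b: "\<And>j. \<theta> j \<le> b" by (auto simp: bdd_above_def)
  then have "range \<theta> \<subseteq> {\<theta> 0..b}" using theta_le by auto
  then have "finite (range \<theta>)" by (rule finite_subset) simp
  then have "Max (range \<theta>) \<in> range \<theta>" by (rule Max_in) simp
  then obtain n0 where n0: "\<theta> n0 = Max (range \<theta>)" by (metis imageE)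
  then have le: "\<theta> j \<le> \<theta> n0" for j using \<open>finite (range \<theta>)\<close> by simp
  have const: "\<theta> j = \<theta> n0" if "n0 \<le> j" for j using le[of j] theta_le[OF that] by simp
  from AE_coord_upper[OF le] AE_coord_lower AE_coord_eventually AE_space show ?thesis
  proof eventually_elim
    case (elim \<omega>)
    then have \<omega>: "\<omega> \<in> GT_space" by simp
    from elim obtain K where K: "\<forall>k\<ge>K. \<forall>j<n0. coord \<omega> k j = \<theta> j" by blast
    have "coord \<omega> k j = \<theta> j" if "K \<le> k" "j < k" for k j
    proof (cases "j < n0")
      case False
      then have "\<theta> j = \<theta> n0" by (intro const) simp
      moreover have "\<theta> j \<le> coord \<omega> k j" "coord \<omega> k j \<le> \<theta> n0" using elim that by auto
      ultimately show ?thesis by simp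
    qed (use K that in auto)
    then have "\<omega> \<in> tails K" using \<omega> by (simp add: tails_def fst_eq_lam_theta_iff)
    then show ?case by blast
  qed
qed

lemma tail_class_rel:
  assumes "\<omega> \<in> tail_class" "\<omega>' \<in> tail_class"
  obtains d where "tail_rel d \<omega> \<omega>'"
proof -
  from assms obtain n m where nm: "\<omega> \<in> tails n" "\<omega>' \<in> tails m" by auto
  then have "\<forall>k\<ge>max n m. \<omega> k = \<omega>' k" by (simp add: tails_edge)
  moreover have "\<omega> \<in> GT_space" "\<omega>' \<in> GT_space" using nm by (auto simp: tails_def)
  ultimately have "tail_rel (level_sum \<omega>' (max n m) - level_sum \<omega> (max n m)) \<omega> \<omega>'"
    by (subst tail_rel_iff) auto
  then show thesis by (rule that)
qed

lemma countable_tail_class: "countable tail_class"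
  using finite_tails by (auto intro: countable_finite)

text \<open>The class is countable, has full measure, and any two of its points are tail related. By
  quasi-invariance one point of measure zero would make all of them, and so the whole class,
  null.\<close>

lemma atoms_eq_tail_class:
  assumes "bdd_above (range \<theta>)"
  shows "{\<omega>. atom P \<omega>} = tail_class" "atomic P"
proof -
  have T: "tail_class \<subseteq> GT_space" by (auto simp: tails_def)
  have AE: "AE \<omega> in P. \<omega> \<in> tail_class" by (rule AE_tail_class[OF assms])
  have pos: "measure P {\<omega>} > 0" if \<omega>: "\<omega> \<in> tail_class" for \<omega>
  proof (rule ccontr)
    assume "\<not> ?thesis"
    then have 0: "measure P {\<omega>} = 0" by (simp add: not_less measure_le_0_iff)
    have \<omega>s: "{\<omega>} \<in> sets P" using singleton_in_sets \<omega> T by auto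
    have "{\<omega>'} \<in> null_sets P" if \<omega>': "\<omega>' \<in> tail_class" for \<omega>'
    proof -
      obtain d where "tail_rel d \<omega>' \<omega>" using tail_class_rel[OF \<omega>' \<omega>] .
      then have "{\<omega>'} \<subseteq> tail_sat d {\<omega>}" by (auto simp: tail_sat_def)
      moreover have "tail_sat d {\<omega>} \<in> null_sets P"
        using tail_sat_null[OF \<omega>s 0] tail_sat_in_sets[of "{\<omega>}" d] \<omega>s
        by (simp add: null_sets_def emeasure_eq_measure)
      moreover have "{\<omega>'} \<in> sets P" using singleton_in_sets \<omega>' T by auto
      ultimately show ?thesis using null_sets_subset by blast
    qed
    then have "(\<Union>\<omega>'\<in>tail_class. {\<omega>'}) \<in> null_sets P"
      using countable_tail_class by (intro null_sets_UN') auto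
    then have "AE \<omega> in P. \<omega> \<notin> tail_class" by (intro AE_not_in) simp
    with AE have "AE \<omega> in P. False" by eventually_elim auto
    then show False using AE_False by simp
  qed
  have atom: "atom P \<omega>" if "\<omega> \<in> tail_class" for \<omega>
    using that T pos[OF that] singleton_in_sets by (auto simp: atom_def)
  moreover have "\<omega> \<in> tail_class" if "atom P \<omega>" for \<omega>
  proof (rule ccontr)
    assume not: "\<omega> \<notin> tail_class"
    from AE have "AE \<omega>' in P. \<omega>' \<notin> {\<omega>}" by eventually_elim (use not in auto)
    then have "measure P {\<omega>} = 0"
      using that by (simp add: atom_def prob_eq_0)
    with that show False by (simp add: atom_def)
  qed
  ultimately show "{\<omega>. atom P \<omega>} = tail_class" by blast
  show "atomic P" unfolding atomic_def using AE by eventually_elim (rule atom)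
qed

lemma tail_class_constant:
  assumes "\<forall>n. \<theta> n = \<theta> 0"
  shows "tail_class = {base}"
proof -
  have "\<omega> = base" if \<omega>: "\<omega> \<in> tails n" for \<omega> n
  proof (rule GT_space_eqI)
    fix k j :: nat assume j: "j < k"
    have "coord \<omega> k j = \<theta> 0" if "\<omega> \<in> tails n" for \<omega>
      using tails_lower[OF that j] tails_upper[OF that j] assms by (metis antisym)
    then show "coord \<omega> k j = coord base k j" using \<omega> base_in_tails by metis
  qed (use \<omega> in \<open>auto simp: tails_def\<close>)
  then show ?thesis using base_in_tails by blast
qed

lemma infinite_tail_class:
  assumes "\<exists>n. \<theta> n \<noteq> \<theta> 0"
  shows "infinite tail_class"
proof -
  have "\<exists>i. \<theta> i < \<theta> (Suc i)"
  proof (rule ccontr)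
    assume "\<not> ?thesis"
    then have step: "\<theta> (Suc i) = \<theta> i" for i using theta_le[of i "Suc i"] by (metis antisym_conv2 le_SucI order_refl)
    have "\<theta> n = \<theta> 0" for n by (induction n) (simp_all add: step)
    with assms show False by simp
  qed
  then obtain i where i: "\<theta> i < \<theta> (Suc i)" ..
  \<comment> \<open>At an ascent there is room to raise coordinate \<open>i\<close> by one box on
    all levels up to \<open>m\<close>. Different \<open>m\<close> give different paths;
    \<open>m \<ge> Suc i\<close> ensures that level \<open>m\<close> has a coordinate of index
    \<open>i\<close>.\<close>
  define c where "c m k j = (if j = i \<and> k \<le> m then \<theta> i + 1 else \<theta> j)" for m k j :: nat
  have gt: "gt_array (c m)" for m
    unfolding gt_array_def
  proof (intro allI impI conjI)
    fix k j :: nat assume "j < k"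
    show "c m (Suc k) j \<le> c m k j" by (auto simp: c_def)
    have "\<theta> j \<le> \<theta> (Suc j)" by (rule theta_le) simp
    then show "c m k j \<le> c m (Suc k) (Suc j)" using i by (auto simp: c_def)
  qed
  have coord: "coord (path_of (c m)) k j = c m k j" if "j < k" for m k j using that by (rule coord_path_of)
  have "inj_on (\<lambda>m. path_of (c m)) {Suc i..}"
  proof (rule linorder_inj_onI)
    fix m m' assume m: "m < m'" "m \<in> {Suc i..}" "m' \<in> {Suc i..}"
    have "c m m' i \<noteq> c m' m' i" using m by (simp add: c_def)
    then show "path_of (c m) \<noteq> path_of (c m')" using coord[of i m'] m by (metis Suc_le_lessD atLeast_iff)
  qed auto
  then have "infinite ((\<lambda>m. path_of (c m)) ` {Suc i..})"
    by (simp add: finite_image_iff infinite_Ici)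
  moreover have "path_of (c m) \<in> tails (Suc m)" for m
  proof -
    have "path_of (c m) \<in> GT_space" by (rule path_of_in_GT_space[OF gt])
    then show ?thesis by (auto simp: tails_def fst_eq_lam_theta_iff coord) (simp add: c_def)
  qed
  then have "(\<lambda>m. path_of (c m)) ` {Suc i..} \<subseteq> tail_class" by blast
  ultimately show ?thesis using infinite_super by blast
qed

end

section \<open>Counting low coordinates and moving one box\<close>

definition low_count :: "int \<Rightarrow> (nat \<Rightarrow> edge) \<Rightarrow> nat \<Rightarrow> nat" where
  "low_count t \<omega> k = card {j. j < k \<and> coord \<omega> k j \<le> t}"

lemma low_count_le: "low_count t \<omega> k \<le> k"
proof -
  have "low_count t \<omega> k \<le> card {..<k}"
    unfolding low_count_def by (intro card_mono) auto
  then show ?thesis by simp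
qed

text \<open>Rows are nondecreasing, so the coordinates at most \<open>t\<close> fill an initial
  segment of the indices, whose length is the count.\<close>

lemma less_low_count_iff:
  assumes \<omega>: "\<omega> \<in> GT_space" and j: "j < k"
  shows "j < low_count t \<omega> k \<longleftrightarrow> coord \<omega> k j \<le> t"
proof -
  define n where "n = (LEAST j. k \<le> j \<or> t < coord \<omega> k j)"
  have n: "k \<le> n \<or> t < coord \<omega> k n" unfolding n_def by (rule LeastI[of _ k]) simp
  have below: "i < k \<and> coord \<omega> k i \<le> t" if "i < n" for i
    using not_less_Least[OF that[unfolded n_def]] by auto
  have "{j. j < k \<and> coord \<omega> k j \<le> t} = {..<n}"
  proof (intro equalityI subsetI)
    fix i assume i: "i \<in> {j. j < k \<and> coord \<omega> k j \<le> t}"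
    show "i \<in> {..<n}"
    proof (rule ccontr)
      assume "i \<notin> {..<n}"
      then have "n \<le> i" by simp
      with i gt_array_mono[OF gt_array_coord[OF \<omega>], of n i k] n show False by auto
    qed
  qed (use below in auto)
  then show ?thesis using j unfolding low_count_def by auto
qed

text \<open>On the next level the coordinate of the same index is no larger and that of the next
  index no smaller, so the count cannot drop and gains at most one.\<close>

lemma low_count_Suc:
  assumes \<omega>: "\<omega> \<in> GT_space"
  shows "low_count t \<omega> k \<le> low_count t \<omega> (Suc k)" "low_count t \<omega> (Suc k) \<le> Suc (low_count t \<omega> k)"
proof -
  have gt: "coord \<omega> (Suc k) j \<le> coord \<omega> k j" "coord \<omega> k j \<le> coord \<omega> (Suc k) (Suc j)" if "j < k" for j
    using gt_array_coord[OF \<omega>] that by (auto simp: gt_array_def)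
  show "low_count t \<omega> k \<le> low_count t \<omega> (Suc k)"
  proof (rule ccontr)
    assume *: "\<not> ?thesis"
    let ?j = "low_count t \<omega> (Suc k)"
    have j: "?j < k" using * low_count_le[of t \<omega> k] by simp
    then have "coord \<omega> k ?j \<le> t" using * less_low_count_iff[OF \<omega> j, of t] by simp
    then have "coord \<omega> (Suc k) ?j \<le> t" using gt(1)[OF j] by simp
    then show False using less_low_count_iff[OF \<omega>, of ?j "Suc k" t] j by simp
  qed
  show "low_count t \<omega> (Suc k) \<le> Suc (low_count t \<omega> k)"
  proof (rule ccontr)
    assume *: "\<not> ?thesis"
    let ?j = "low_count t \<omega> k"
    have j: "?j < k" using * low_count_le[of t \<omega> "Suc k"] by simp
    then have "coord \<omega> (Suc k) (Suc ?j) \<le> t" using * less_low_count_iff[OF \<omega>, of "Suc ?j" "Suc k" t] by simp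
    then have "coord \<omega> k ?j \<le> t" using gt(2)[OF j] by simp
    then show False using less_low_count_iff[OF \<omega> j, of t] by simp
  qed
qed

text \<open>Level \<open>Suc p\<close> is the target of edge \<open>p\<close> and the source of edge
  \<open>Suc p\<close>, so only these two edges change. The result is a path only where the
  neighbouring entries leave room.\<close>

definition bump :: "nat \<Rightarrow> nat \<Rightarrow> int \<Rightarrow> (nat \<Rightarrow> edge) \<Rightarrow> nat \<Rightarrow> edge" where
  "bump p y d \<omega> = path_of (\<lambda>k j. if k = Suc p \<and> j = y then coord \<omega> k j + d else coord \<omega> k j)"

lemma coord_bump:
  "j < k \<Longrightarrow> coord (bump p y d \<omega>) k j = (if k = Suc p \<and> j = y then coord \<omega> k j + d else coord \<omega> k j)"
  unfolding bump_def by (rule coord_path_of)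

lemma inj_on_bump: "inj_on (bump p y d) GT_space"
proof (rule inj_onI)
  fix \<omega> \<omega>' assume *: "\<omega> \<in> GT_space" "\<omega>' \<in> GT_space" "bump p y d \<omega> = bump p y d \<omega>'"
  show "\<omega> = \<omega>'"
  proof (rule GT_space_eqI)
    fix k j :: nat assume "j < k"
    with *(3) coord_bump[of j k p y d] show "coord \<omega> k j = coord \<omega>' k j" by (metis add_right_cancel)
  qed (use * in auto)
qed

lemma bump_edge_eq:
  assumes "\<omega> \<in> GT_space" "n \<noteq> p" "n \<noteq> Suc p"
  shows "bump p y d \<omega> n = \<omega> n"
proof -
  have "\<omega> n = path_of (coord \<omega>) n" using assms path_of_coord by simp
  then show ?thesis using assms(2,3) by (simp add: bump_def path_of_def)
qed

lemma measurable_bump: "(\<lambda>\<omega>. bump p y d \<omega> n) \<in> measurable GT_alg (count_space UNIV)"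
proof -
  define F where "F e e' = (lam_theta n (\<lambda>j. if n = Suc p \<and> j = y then rev (fst e) ! j + d else rev (fst e) ! j),
    lam_theta (Suc n) (\<lambda>j. if Suc n = Suc p \<and> j = y then rev (fst e') ! j + d else rev (fst e') ! j))"
    for e e' :: edge
  have "(\<lambda>\<omega>. (\<lambda>e \<omega>. F e (\<omega> (Suc n))) (\<omega> n) \<omega>) \<in> measurable GT_alg (count_space UNIV)"
    by (rule measurable_compose_countable[OF _ measurable_edge], rule measurable_compose[OF measurable_edge])
       (rule measurable_count_space)
  moreover have "(\<lambda>\<omega>. bump p y d \<omega> n) = (\<lambda>\<omega>. F (\<omega> n) (\<omega> (Suc n)))"
    unfolding bump_def path_of_def coord_def F_def by simp
  ultimately show ?thesis by simp
qed

lemma tail_rel_bump: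
  assumes \<omega>: "\<omega> \<in> GT_space" and \<omega>': "bump p y d \<omega> \<in> GT_space" and y: "y \<le> p"
  shows "tail_rel d \<omega> (bump p y d \<omega>)"
proof -
  have "sumsig (fst (bump p y d \<omega> k)) = sumsig (fst (\<omega> k)) + (if k = Suc p then d else 0)" for k
  proof -
    have "(\<Sum>j<k. coord (bump p y d \<omega>) k j) = (\<Sum>j<k. coord \<omega> k j + (if j = y then (if k = Suc p then d else 0) else 0))"
      by (intro sum.cong) (auto simp: coord_bump)
    also have "\<dots> = (\<Sum>j<k. coord \<omega> k j) + (\<Sum>j<k. if j = y then (if k = Suc p then d else 0) else 0)"
      by (rule sum.distrib)
    also have "(\<Sum>j<k. if j = y then (if k = Suc p then d else 0) else 0) = (if k = Suc p then d else 0)"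
      using y by (simp add: sum.delta)
    finally show ?thesis by (simp add: sumsig_coord[OF \<omega>] sumsig_coord[OF \<omega>'])
  qed
  then have "level_sum (bump p y d \<omega>) (p + 2) - level_sum \<omega> (p + 2) = (\<Sum>k<p + 2. if k = Suc p then d else 0)"
    by (simp add: level_sum_def sum.distrib)
  also have "\<dots> = d" by (simp add: sum.delta)
  finally show ?thesis
    using \<omega> \<omega>' bump_edge_eq[OF \<omega>, of _ p y d] by (subst tail_rel_iff[of _ _ "p + 2"]) auto
qed

text \<open>If exactly one more coordinate is at most \<open>t\<close> on level \<open>p + 2\<close> than on level \<open>p\<close>, then one
  coordinate of level \<open>p + 1\<close> is confined by its neighbours to an interval containing both \<open>t\<close>
  and \<open>t + 1\<close>, and can therefore be moved by one box.\<close>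

lemma bump_in_GT_space:
  assumes \<omega>: "\<omega> \<in> GT_space" and p: "low_count t \<omega> p = y" "low_count t \<omega> (Suc (Suc p)) = Suc y"
  shows "coord \<omega> (Suc p) y \<le> t \<Longrightarrow> bump p y 1 \<omega> \<in> GT_space"
    and "t < coord \<omega> (Suc p) y \<Longrightarrow> bump p y (- 1) \<omega> \<in> GT_space"
proof -
  have gt: "coord \<omega> (Suc k) j \<le> coord \<omega> k j" "coord \<omega> k j \<le> coord \<omega> (Suc k) (Suc j)" if "j < k" for k j
    using gt_array_coord[OF \<omega>] that by (auto simp: gt_array_def)
  have y: "y \<le> p" using p low_count_le by blast
  \<comment> \<open>Facts 1 and 3 put the upper neighbours of the entry above \<open>t\<close>,
    facts 2 and 4 put its lower neighbours at or below \<open>t\<close>. For \<open>y = p\<close>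
    the upper and for \<open>y = 0\<close> the lower neighbour on level \<open>p\<close> is
    missing.\<close>
  have 1: "t < coord \<omega> p y" if "y < p" using less_low_count_iff[OF \<omega> that, of t] p by simp
  have 2: "coord \<omega> p j \<le> t" if "Suc j = y" for j
    using less_low_count_iff[OF \<omega>, of j p t] p y that by simp
  have 3: "t < coord \<omega> (Suc (Suc p)) (Suc y)" using less_low_count_iff[OF \<omega>, of "Suc y" "Suc (Suc p)" t] p y by simp
  have 4: "coord \<omega> (Suc (Suc p)) y \<le> t" using less_low_count_iff[OF \<omega>, of y "Suc (Suc p)" t] p y by simp
  show "bump p y 1 \<omega> \<in> GT_space" if x: "coord \<omega> (Suc p) y \<le> t"
    unfolding bump_def
  proof (rule path_of_in_GT_space, unfold gt_array_def, intro allI impI conjI)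
    fix k j :: nat assume j: "j < k"
    let ?c = "\<lambda>k j. if k = Suc p \<and> j = y then coord \<omega> k j + 1 else coord \<omega> k j"
    show "?c (Suc k) j \<le> ?c k j" using gt(1)[OF j] 1 x j by auto
    show "?c k j \<le> ?c (Suc k) (Suc j)" using gt(2)[OF j] 3 x j by auto
  qed
  show "bump p y (- 1) \<omega> \<in> GT_space" if x: "t < coord \<omega> (Suc p) y"
    unfolding bump_def
  proof (rule path_of_in_GT_space, unfold gt_array_def, intro allI impI conjI)
    fix k j :: nat assume j: "j < k"
    let ?c = "\<lambda>k j. if k = Suc p \<and> j = y then coord \<omega> k j + - 1 else coord \<omega> k j"
    show "?c (Suc k) j \<le> ?c k j" using gt(1)[OF j] 4 x j by auto
    show "?c k j \<le> ?c (Suc k) (Suc j)" using gt(2)[OF j] 2[of j] x j by auto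
  qed
qed

lemma low_count_bump: "k \<noteq> Suc p \<Longrightarrow> low_count t (bump p y d \<omega>) k = low_count t \<omega> k"
  unfolding low_count_def by (intro arg_cong[of _ _ card]) (auto simp: coord_bump)

lemma coord_le_in_sets [measurable]: "{\<omega> \<in> GT_space. coord \<omega> k j \<le> t} \<in> sets GT_alg"
  by (rule level_set_in_sets[of "Suc k"], rule level_set_Collect) (simp add: coord_def)

section \<open>Contraction for sets without pairs of exponent 1\<close>

context q_central_measure
begin

text \<open>Moving a box changes the exponent by 1 or -1, so it takes points of a pair-free
  \<open>A\<close> out of \<open>A\<close> while they stay in \<open>G\<close>. Paths whose entry is
  at most \<open>t\<close> are moved up, the others down. Both moves are injective and scale the
  measure by \<open>q powi 2\<close> and \<open>q powi - 2\<close>; the inverses of these factors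
  add up to the constant.\<close>

lemma bump_contraction:
  assumes A: "A \<in> sets P" "pair_free 1 A" and G: "G \<in> sets P"
    and count: "\<And>\<omega>. \<omega> \<in> G \<Longrightarrow> low_count t \<omega> p = y \<and> low_count t \<omega> (Suc (Suc p)) = Suc y"
    and inv: "\<And>\<omega> d. \<omega> \<in> G \<Longrightarrow> bump p y d \<omega> \<in> GT_space \<Longrightarrow> bump p y d \<omega> \<in> G"
  shows "measure P (G \<inter> A) \<le> (q powi - 2 + q powi 2) * measure P (G - A)"
proof -
  have G_space: "G \<subseteq> GT_space" using sets.sets_into_space[OF G] by simp
  have y: "y \<le> p" if "\<omega> \<in> G" for \<omega> using count[OF that] low_count_le[of t \<omega> p] by simp
  have half: "q powi (2 * d) * measure P (G \<inter> A \<inter> X) \<le> measure P (G - A)"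
    if d: "d = 1 \<or> d = - 1" and X: "X \<in> sets P" and b: "\<And>\<omega>. \<omega> \<in> G \<inter> A \<inter> X \<Longrightarrow> bump p y d \<omega> \<in> GT_space" for d X
  proof -
    let ?H = "G \<inter> A \<inter> X"
    have H: "?H \<in> sets GT_alg" using A G X by auto
    have rel: "tail_rel d \<omega> (bump p y d \<omega>)" if "\<omega> \<in> ?H" for \<omega>
      using that G_space b[OF that] y by (intro tail_rel_bump) auto
    have inj: "inj_on (bump p y d) ?H"
      by (rule inj_on_subset[OF inj_on_bump]) (use G_space in auto)
    note img = emeasure_image_tail_rel[OF measurable_bump H inj rel]
    have "bump p y d ` ?H \<subseteq> G - A"
    proof safe
      fix \<omega> assume \<omega>: "\<omega> \<in> G" "\<omega> \<in> A" "\<omega> \<in> X"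
      then show "bump p y d \<omega> \<in> G" using inv b by auto
      assume "bump p y d \<omega> \<in> A"
      moreover have "pair_free d A" using A(2) d pair_free_uminus[of 1 A] by auto
      ultimately show False using rel[of \<omega>] \<omega> unfolding pair_free_def by blast
    qed
    then have "measure P (bump p y d ` ?H) \<le> measure P (G - A)"
      using A G by (intro finite_measure_mono) auto
    moreover have "measure P (bump p y d ` ?H) = q powi (2 * d) * measure P ?H"
      using img(2) q by (simp add: emeasure_eq_measure ennreal_mult'[symmetric])
    ultimately show ?thesis by simp
  qed
  let ?X = "{\<omega> \<in> GT_space. coord \<omega> (Suc p) y \<le> t}"
  have X: "?X \<in> sets P" "GT_space - ?X \<in> sets P" using coord_le_in_sets sets.compl_sets[of ?X P] by auto
  have "bump p y 1 \<omega> \<in> GT_space" if "\<omega> \<in> G \<inter> A \<inter> ?X" for \<omega>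
    using that count by (intro bump_in_GT_space(1)) auto
  then have "q powi (2 * 1) * measure P (G \<inter> A \<inter> ?X) \<le> measure P (G - A)"
    using X(1) by (intro half) auto
  then have 1: "measure P (G \<inter> A \<inter> ?X) \<le> q powi - 2 * measure P (G - A)"
    using q by (simp add: power_int_minus field_simps)
  have "bump p y (- 1) \<omega> \<in> GT_space" if "\<omega> \<in> G \<inter> A \<inter> (GT_space - ?X)" for \<omega>
    using that count by (intro bump_in_GT_space(2)) auto
  then have "q powi (2 * - 1) * measure P (G \<inter> A \<inter> (GT_space - ?X)) \<le> measure P (G - A)"
    using X(2) by (intro half) auto
  then have 2: "measure P (G \<inter> A \<inter> (GT_space - ?X)) \<le> q powi 2 * measure P (G - A)"
    using q by (simp add: power_int_minus field_simps)
  have "G \<inter> A \<subseteq> (G \<inter> A \<inter> ?X) \<union> (G \<inter> A \<inter> (GT_space - ?X))" using G_space by auto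
  then have "measure P (G \<inter> A) \<le> measure P ((G \<inter> A \<inter> ?X) \<union> (G \<inter> A \<inter> (GT_space - ?X)))"
    using A G X by (intro finite_measure_mono) auto
  also have "\<dots> \<le> measure P (G \<inter> A \<inter> ?X) + measure P (G \<inter> A \<inter> (GT_space - ?X))"
    using A G X by (intro measure_Un_le) auto
  finally show ?thesis using 1 2 by (simp add: algebra_simps)
qed

text \<open>The set \<open>D \<inter> U\<close> is cut according to the first \<open>l\<close> with
  an increase by one and the count \<open>y\<close> on level \<open>K + 2 * l\<close>. The box moves
  on level \<open>K + 2 * l + 1\<close>, which no condition on the counts inspects, and it leaves
  the edges below \<open>N\<close> that decide \<open>D\<close> untouched. So each piece is
  invariant under the move, and the contractions can be summed.\<close>

lemma bump_contraction_first:
  fixes t :: int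
  assumes A: "A \<in> sets P" "pair_free 1 A" and D: "level_set N D" "N \<le> K"
  defines "U \<equiv> {\<omega> \<in> GT_space. \<exists>l. low_count t \<omega> (Suc (Suc (K + 2 * l))) = Suc (low_count t \<omega> (K + 2 * l))}"
  shows "U \<in> sets P" "measure P (D \<inter> U \<inter> A) \<le> (q powi - 2 + q powi 2) * measure P (D - A)"
proof -
  define J where "J \<omega> l \<longleftrightarrow> low_count t \<omega> (Suc (Suc (K + 2 * l))) = Suc (low_count t \<omega> (K + 2 * l))" for \<omega> l
  define G where "G = (\<lambda>(l, y). {\<omega> \<in> D. low_count t \<omega> (K + 2 * l) = y \<and>
    low_count t \<omega> (Suc (Suc (K + 2 * l))) = Suc y \<and> (\<forall>l'<l. \<not> J \<omega> l')})"
  \<comment> \<open>Level \<open>k\<close> is the source of edge \<open>k\<close>, so a condition on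
    level \<open>K + 2 * l + 2\<close> involves the edges up to and including that index.\<close>
  have J_sets [measurable]: "{\<omega> \<in> GT_space. J \<omega> l} \<in> sets GT_alg" for l
    by (rule level_set_in_sets[of "Suc (Suc (Suc (K + 2 * l)))"], rule level_set_Collect)
       (simp add: J_def low_count_def coord_def)
  have D_sets: "D \<in> sets GT_alg" "D \<subseteq> GT_space"
    using D(1) by (auto intro: level_set_in_sets simp: level_set_def)
  have "U = (\<Union>l. {\<omega> \<in> GT_space. J \<omega> l})" by (auto simp: U_def J_def)
  then show U_sets: "U \<in> sets P" by simp
  have G_sets: "G i \<in> sets P" for i
  proof -
    obtain l y where i: "i = (l, y)" by fastforce
    have "level_set (Suc (Suc (Suc (K + 2 * l)))) {\<omega> \<in> GT_space. low_count t \<omega> (K + 2 * l) = y \<and>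
        low_count t \<omega> (Suc (Suc (K + 2 * l))) = Suc y \<and> (\<forall>l'<l. \<not> J \<omega> l')}"
    proof (rule level_set_Collect)
      fix \<omega> \<omega>' :: "nat \<Rightarrow> edge"
      assume eq: "\<And>n. n < Suc (Suc (Suc (K + 2 * l))) \<Longrightarrow> \<omega> n = \<omega>' n"
      have "low_count t \<omega> n = low_count t \<omega>' n" if "n \<le> Suc (Suc (K + 2 * l))" for n
        using eq[of n] that by (simp add: low_count_def coord_def)
      then show "(low_count t \<omega> (K + 2 * l) = y \<and>
        low_count t \<omega> (Suc (Suc (K + 2 * l))) = Suc y \<and> (\<forall>l'<l. \<not> J \<omega> l')) =
        (low_count t \<omega>' (K + 2 * l) = y \<and>
        low_count t \<omega>' (Suc (Suc (K + 2 * l))) = Suc y \<and> (\<forall>l'<l. \<not> J \<omega>' l'))"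
        by (simp add: J_def)
    qed
    from level_set_in_sets[OF this] D_sets(1)
    have "D \<inter> {\<omega> \<in> GT_space. low_count t \<omega> (K + 2 * l) = y \<and>
        low_count t \<omega> (Suc (Suc (K + 2 * l))) = Suc y \<and> (\<forall>l'<l. \<not> J \<omega> l')} \<in> sets GT_alg"
      by (rule sets.Int[rotated])
    moreover have "G i = D \<inter> {\<omega> \<in> GT_space. low_count t \<omega> (K + 2 * l) = y \<and>
        low_count t \<omega> (Suc (Suc (K + 2 * l))) = Suc y \<and> (\<forall>l'<l. \<not> J \<omega> l')}"
      using D_sets(2) by (auto simp: G_def i)
    ultimately show ?thesis by simp
  qed
  have disj: "disjoint_family G"
    unfolding disjoint_family_on_def
  proof (intro ballI impI equals0I)
    fix i i' \<omega> assume *: "i \<noteq> i'" "\<omega> \<in> G i \<inter> G i'"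
    obtain l y l' y' where i: "i = (l, y)" "i' = (l', y')" by fastforce
    have "J \<omega> l" "J \<omega> l'" "\<forall>m<l. \<not> J \<omega> m" "\<forall>m<l'. \<not> J \<omega> m" "y = low_count t \<omega> (K + 2 * l)"
      "y' = low_count t \<omega> (K + 2 * l')"
      using *(2) by (auto simp: G_def i J_def)
    moreover from this have "l = l'" by (metis linorder_neqE_nat)
    ultimately show False using *(1) i by simp
  qed
  have cover: "D \<inter> U = (\<Union>i. G i)"
  proof (intro equalityI subsetI)
    fix \<omega> assume \<omega>: "\<omega> \<in> D \<inter> U"
    then obtain l0 where "J \<omega> l0" by (auto simp: U_def J_def)
    define l where "l = (LEAST l. J \<omega> l)"
    have "J \<omega> l" unfolding l_def using \<open>J \<omega> l0\<close> by (rule LeastI)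
    moreover have "\<forall>l'<l. \<not> J \<omega> l'" unfolding l_def using not_less_Least by blast
    ultimately have "\<omega> \<in> G (l, low_count t \<omega> (K + 2 * l))" using \<omega> by (simp add: G_def J_def)
    then show "\<omega> \<in> (\<Union>i. G i)" by blast
  next
    fix \<omega> assume "\<omega> \<in> (\<Union>i. G i)"
    then obtain l y where "\<omega> \<in> G (l, y)" by auto
    then show "\<omega> \<in> D \<inter> U" using D_sets(2) by (auto simp: G_def U_def)
  qed
  let ?C = "q powi - 2 + q powi 2"
  have C: "0 \<le> ?C" using q by simp
  have contr: "measure P (G i \<inter> A) \<le> ?C * measure P (G i - A)" for i
  proof -
    obtain l y where i: "i = (l, y)" by fastforce
    show ?thesis
    proof (rule bump_contraction[OF A G_sets, where t = t and p = "K + 2 * l" and y = y])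
      fix \<omega> d assume \<omega>: "\<omega> \<in> G i" and b: "bump (K + 2 * l) y d \<omega> \<in> GT_space"
      let ?b = "bump (K + 2 * l) y d \<omega>"
      have "\<omega> \<in> D" using \<omega> by (simp add: G_def i)
      then have "\<omega> \<in> GT_space" using D_sets by auto
      have "\<omega> n = ?b n" if "n < N" for n
        using bump_edge_eq[OF \<open>\<omega> \<in> GT_space\<close>, of n "K + 2 * l" y d] that D(2) by simp
      then have "?b \<in> D" using level_set_D[OF D(1) \<open>\<omega> \<in> D\<close> b] by simp
      moreover have "J ?b l' = J \<omega> l'" if "l' < l" for l'
        using that by (simp add: J_def low_count_bump)
      ultimately show "?b \<in> G i" using \<omega> by (simp add: G_def i low_count_bump)
    qed (auto simp: G_def i)
  qed
  have "emeasure P (D \<inter> U \<inter> A) = emeasure P (\<Union>i. G i \<inter> A)" using cover by simp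
  also have "\<dots> = (\<integral>\<^sup>+i. emeasure P (G i \<inter> A) \<partial>count_space UNIV)"
    using G_sets A by (intro emeasure_UN_countable disjoint_family_subset[OF disj]) auto
  also have "\<dots> \<le> (\<integral>\<^sup>+i. ennreal ?C * emeasure P (G i - A) \<partial>count_space UNIV)"
    using contr C by (intro nn_integral_mono) (simp add: emeasure_eq_measure ennreal_mult'[symmetric])
  also have "\<dots> = ennreal ?C * (\<integral>\<^sup>+i. emeasure P (G i - A) \<partial>count_space UNIV)"
    by (rule nn_integral_cmult) simp
  also have "(\<integral>\<^sup>+i. emeasure P (G i - A) \<partial>count_space UNIV) = emeasure P (\<Union>i. G i - A)"
    using G_sets A by (intro emeasure_UN_countable[symmetric] disjoint_family_subset[OF disj]) auto
  also have "\<dots> \<le> emeasure P (D - A)"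
    using cover A D_sets by (intro emeasure_mono) auto
  finally have "emeasure P (D \<inter> U \<inter> A) \<le> ennreal ?C * emeasure P (D - A)"
    by (simp add: mult_left_mono)
  then show "measure P (D \<inter> U \<inter> A) \<le> ?C * measure P (D - A)"
    using C by (simp add: emeasure_eq_measure ennreal_mult'[symmetric])
qed

end

section \<open>Unbounded parameter: pairs of exponent 1 in every set of positive measure\<close>

context theta_measure
begin

text \<open>The \<open>m\<close> lowest coordinates settle at values
  \<open>\<theta> j \<le> t\<close>, while all others stay at or above \<open>\<theta> j > t\<close>
  on every level.\<close>

lemma AE_low_count_eventually:
  assumes m: "\<And>j. \<theta> j \<le> t \<longleftrightarrow> j < m"
  shows "AE \<omega> in P. \<exists>K. \<forall>k\<ge>K. low_count t \<omega> k = m"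
  using AE_coord_lower AE_coord_eventually
proof eventually_elim
  case (elim \<omega>)
  then obtain K where K: "\<forall>k\<ge>K. \<forall>j<m. coord \<omega> k j = \<theta> j" by blast
  have "low_count t \<omega> k = m" if k: "max K m \<le> k" for k
  proof -
    have "j < k \<and> coord \<omega> k j \<le> t \<longleftrightarrow> j < m" for j
    proof (cases "j < m")
      case True
      then show ?thesis using K k m[of j] by auto
    next
      case False
      then have "t < \<theta> j" using m[of j] by simp
      then show ?thesis using False elim by (meson not_le order_less_le_trans)
    qed
    then show ?thesis by (simp add: low_count_def lessThan_def[symmetric])
  qed
  then show ?case by blast
qed

text \<open>Over two levels the count grows by 0, 1 or 2. Without an increase by exactly 1 its
  parity along the levels \<open>K + 2 * l\<close> would remain that of \<open>K\<close>, contrary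
  to the final value \<open>m\<close>.\<close>

lemma exists_odd_jump:
  assumes \<omega>: "\<omega> \<in> GT_space" and K: "low_count t \<omega> K = K" and odd: "odd (m + K)"
    and lim: "\<forall>k\<ge>k0. low_count t \<omega> k = m"
  shows "\<exists>l. low_count t \<omega> (Suc (Suc (K + 2 * l))) = Suc (low_count t \<omega> (K + 2 * l))"
proof (rule ccontr)
  assume no: "\<not> ?thesis"
  have "even (low_count t \<omega> (K + 2 * l) + K)" for l
  proof (induction l)
    case 0
    then show ?case using K by simp
  next
    case (Suc l)
    let ?x = "low_count t \<omega> (K + 2 * l)" and ?z = "low_count t \<omega> (Suc (Suc (K + 2 * l)))"
    have "?x \<le> ?z" "?z \<le> Suc (Suc ?x)"
      using low_count_Suc[OF \<omega>, of t "K + 2 * l"] low_count_Suc[OF \<omega>, of t "Suc (K + 2 * l)"] by auto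
    moreover have "?z \<noteq> Suc ?x" using no by blast
    ultimately have "?z = ?x \<or> ?z = Suc (Suc ?x)" by linarith
    then show ?case using Suc by auto
  qed
  from this[of k0] lim odd show False by simp
qed

text \<open>Let \<open>D\<close> be a finite-level approximation of \<open>A\<close>. Outside the
  rare event \<open>H t\<close> almost every path lies in \<open>U\<close>, so up to a null set
  \<open>A\<close> is covered by \<open>A - D\<close>, \<open>H t\<close> and
  \<open>D \<inter> U \<inter> A\<close>. The contraction bounds the last part by a multiple of the
  measure of \<open>D - A\<close>, so all three are of order \<open>\<epsilon>\<close>.\<close>

lemma pair_free_1_null:
  assumes unbounded: "\<not> bdd_above (range \<theta>)" and A: "A \<in> sets P" "pair_free 1 A"
  shows "measure P A = 0"
proof -
  let ?C = "q powi - 2 + q powi 2"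
  have C: "0 \<le> ?C" using q by simp
  have bound: "measure P A \<le> (2 + ?C) * \<epsilon>" if \<epsilon>: "0 < \<epsilon>" for \<epsilon>
  proof -
    from approx_level_set[OF A(1) \<epsilon>] obtain N D where D: "level_set N D"
      and close: "measure P ((A - D) \<union> (D - A)) < \<epsilon>" by blast
    have D_sets: "D \<in> sets P" using level_set_in_sets[OF D] by simp
    \<comment> \<open>The event that the largest coordinate on level \<open>Suc N\<close> exceeds
      \<open>t\<close>; it shrinks to the empty set as \<open>t\<close> grows. Its complement bounds
      the coordinates on levels \<open>N\<close> and \<open>Suc N\<close>, the two candidates for
      the starting level \<open>K\<close>.\<close>
    define H where "H t = GT_space - {\<omega> \<in> GT_space. coord \<omega> (Suc N) N \<le> int t}" for t
    have H_sets: "H t \<in> sets P" for t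
      unfolding H_def using coord_le_in_sets sets.compl_sets[of _ P] by simp
    have "(\<lambda>t. measure P (H t)) \<longlonglongrightarrow> measure P (\<Inter>t. H t)"
      by (rule finite_Lim_measure_decseq) (use H_sets in \<open>auto simp: H_def decseq_def\<close>)
    moreover have "(\<Inter>t. H t) = {}"
    proof (rule equals0I)
      fix \<omega> assume "\<omega> \<in> (\<Inter>t. H t)"
      then have "\<omega> \<in> H (nat (coord \<omega> (Suc N) N))" by blast
      then show False by (simp add: H_def split: if_splits)
    qed
    ultimately have "(\<lambda>t. measure P (H t)) \<longlonglongrightarrow> 0" by simp
    then have "\<forall>\<^sub>F t in sequentially. measure P (H t) < \<epsilon>" using \<epsilon> by (rule order_tendstoD)
    then obtain t where Ht: "measure P (H t) < \<epsilon>" by (auto simp: eventually_sequentially)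
    \<comment> \<open>Unboundedness provides an index with \<open>int t < \<theta> j\<close>, so by
      monotonicity \<open>m\<close> is the finite number of indices with
      \<open>\<theta> j \<le> int t\<close>, the final value of the count.\<close>
    define m where "m = (LEAST j. int t < \<theta> j)"
    have "\<exists>j. int t < \<theta> j" using unbounded by (auto simp: bdd_above_def not_le)
    then have "int t < \<theta> m" unfolding m_def by (rule LeastI_ex)
    then have m: "\<theta> j \<le> int t \<longleftrightarrow> j < m" for j
      using not_less_Least[of j "\<lambda>j. int t < \<theta> j"] theta_le[of m j] unfolding m_def[symmetric]
      by (cases "j < m") auto
    \<comment> \<open>Outside \<open>H t\<close> the count on level \<open>K\<close> is
      \<open>K\<close> itself, so this choice makes its initial parity differ from that of its final
      value \<open>m\<close>.\<close>
    define K where "K = (if odd (m + N) then N else Suc N)"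
    have K: "N \<le> K" "odd (m + K)" by (auto simp: K_def)
    define U where "U = {\<omega> \<in> GT_space. \<exists>l. low_count (int t) \<omega> (Suc (Suc (K + 2 * l))) =
      Suc (low_count (int t) \<omega> (K + 2 * l))}"
    note contr = bump_contraction_first[OF A D K(1), of "int t", folded U_def]
    have "AE \<omega> in P. \<omega> \<in> H t \<or> \<omega> \<in> U"
      using AE_low_count_eventually[OF m] AE_space
    proof eventually_elim
      case (elim \<omega>)
      then have \<omega>: "\<omega> \<in> GT_space" by simp
      show ?case
      proof (cases "\<omega> \<in> H t")
        case False
        then have top: "coord \<omega> (Suc N) N \<le> int t" using \<omega> by (simp add: H_def)
        have gt: "gt_array (coord \<omega>)" using \<omega> by (rule gt_array_coord)
        have "coord \<omega> K j \<le> int t" if "j < K" for j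
        proof (cases "K = N")
          case True
          then have "coord \<omega> K j \<le> coord \<omega> (Suc N) (Suc j)" using gt that by (simp add: gt_array_def)
          also have "\<dots> \<le> coord \<omega> (Suc N) N" using that True by (intro gt_array_mono[OF gt]) auto
          finally show ?thesis using top by simp
        next
          case False
          then have "K = Suc N" by (auto simp: K_def split: if_splits)
          moreover have "coord \<omega> (Suc N) j \<le> coord \<omega> (Suc N) N"
            using that \<open>K = Suc N\<close> by (intro gt_array_mono[OF gt]) auto
          ultimately show ?thesis using top by simp
        qed
        then have "{j. j < K \<and> coord \<omega> K j \<le> int t} = {..<K}" by auto
        then have "low_count (int t) \<omega> K = K" by (simp add: low_count_def)
        with elim exists_odd_jump[OF \<omega> _ K(2)] \<omega> show ?thesis unfolding U_def by blast
      qed simp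
    qed
    then have "AE \<omega> in P. \<omega> \<notin> GT_space - (H t \<union> U)" by eventually_elim auto
    moreover have HU: "GT_space - (H t \<union> U) \<in> sets P"
      using H_sets contr(1) sets.compl_sets[of "H t \<union> U" P] by auto
    ultimately have null: "measure P (GT_space - (H t \<union> U)) = 0" by (simp add: prob_eq_0)
    have parts: "A - D \<in> sets P" "D - A \<in> sets P" "D \<inter> U \<inter> A \<in> sets P" using A D_sets contr(1) by auto
    have sub: "measure P (A - D) \<le> \<epsilon>" "measure P (D - A) \<le> \<epsilon>"
      using close parts finite_measure_mono[of "A - D" "(A - D) \<union> (D - A)"]
        finite_measure_mono[of "D - A" "(A - D) \<union> (D - A)"] by auto
    have "A \<subseteq> GT_space" using sets.sets_into_space[OF A(1)] by simp
    then have "A \<subseteq> (A - D) \<union> ((D \<inter> U \<inter> A) \<union> (H t \<union> (GT_space - (H t \<union> U))))" by auto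
    then have "measure P A \<le> measure P ((A - D) \<union> ((D \<inter> U \<inter> A) \<union> (H t \<union> (GT_space - (H t \<union> U)))))"
      using parts H_sets HU by (intro finite_measure_mono) auto
    also have "\<dots> \<le> measure P (A - D) + measure P ((D \<inter> U \<inter> A) \<union> (H t \<union> (GT_space - (H t \<union> U))))"
      using parts H_sets HU by (intro measure_Un_le) auto
    also have "measure P ((D \<inter> U \<inter> A) \<union> (H t \<union> (GT_space - (H t \<union> U)))) \<le>
        measure P (D \<inter> U \<inter> A) + measure P (H t \<union> (GT_space - (H t \<union> U)))"
      using parts H_sets HU by (intro measure_Un_le) auto
    also have "measure P (H t \<union> (GT_space - (H t \<union> U))) \<le> measure P (H t) + measure P (GT_space - (H t \<union> U))"
      using H_sets HU by (intro measure_Un_le) auto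
    also have "measure P (D \<inter> U \<inter> A) \<le> ?C * \<epsilon>"
      using contr(2) sub(2) C by (meson mult_left_mono order_trans)
    finally have "measure P A \<le> \<epsilon> + (?C * \<epsilon> + (measure P (H t) + 0))" using sub null by simp
    then show ?thesis using Ht by (simp add: algebra_simps)
  qed
  have "measure P A \<le> 0"
  proof (rule field_le_epsilon)
    fix e :: real assume "0 < e"
    then have "measure P A \<le> (2 + ?C) * (e / (2 + ?C))" using C by (intro bound) simp
    then show "measure P A \<le> 0 + e" using C by simp
  qed
  then show ?thesis by (simp add: measure_le_0_iff)
qed

end

theorem theorem1p2:
  fixes q :: real and \<theta> :: "nat \<Rightarrow> int" and P :: "(nat \<Rightarrow> edge) measure"
  assumes q: "0 < q" "q < 1"
    and theta: "mono \<theta>"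
    and central: "q_central q P"
    and char: "\<And>lam \<alpha>. \<alpha> \<in> fpaths [] lam \<Longrightarrow>
        ((\<lambda>n. dimq q lam (lam_theta n \<theta>) / dimq q [] (lam_theta n \<theta>))
           \<longlongrightarrow> measure P (cyl \<alpha>) / wpath q \<alpha>) sequentially"
  shows "((\<forall>n. \<theta> n = \<theta> 0) \<longrightarrow> atomic P \<and> card {\<omega>. atom P \<omega>} = 1)
       \<and> ((\<exists>n. \<theta> n \<noteq> \<theta> 0) \<and> bdd_above (range \<theta>) \<longrightarrow> atomic P \<and> infinite {\<omega>. atom P \<omega>})
       \<and> (\<not> bdd_above (range \<theta>) \<longrightarrow> ratio_set P = {q powi (2 * n) | n. True} \<union> {0})"
proof -
  interpret theta_measure q P \<theta>
    using assms by unfold_locales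
  have "atomic P \<and> card {\<omega>. atom P \<omega>} = 1" if const: "\<forall>n. \<theta> n = \<theta> 0"
  proof -
    have "range \<theta> \<subseteq> {\<theta> 0}" using const by auto
    then have "bdd_above (range \<theta>)" by (rule bdd_above_mono[rotated]) simp
    from atoms_eq_tail_class[OF this] tail_class_constant[OF const] show ?thesis by simp
  qed
  moreover have "atomic P \<and> infinite {\<omega>. atom P \<omega>}" if "\<exists>n. \<theta> n \<noteq> \<theta> 0" "bdd_above (range \<theta>)"
    using atoms_eq_tail_class[OF that(2)] infinite_tail_class[OF that(1)] by simp
  moreover have "ratio_set P = {q powi (2 * n) | n. True} \<union> {0}" if "\<not> bdd_above (range \<theta>)"
    using pair_free_1_null[OF that] by (rule ratio_set_eq)
  ultimately show ?thesis by blast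
qed

end
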